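(* Let $N\ge3$, $p>\frac{N+2}{N-2}$ and $\lambda\le\frac{N(N-2)}{4}$. Then the equation $$\Delta_{\mathbb{H}^N}u+\lambda u+u^p=0\qquad\text{in }\mathbb{H}^N\setminus\{Q\}$$ admits a unique positive radial singular solution $u_s$, which satisfies $$u_s(r)=L(\sinh r)^{-m}+\frac{L^p-(\lambda-m)L}{4N-4-6m}(\sinh r)^{2-m}+O\bigl((\sinh r)^{4-m}\bigr)\qquad\text{as } r\to0^+.$$ Furthermore, the following hold: (i) If $\lambda<0$, then $u_s(r)\to(-\lambda)^{1/(p-1)}$ as $r\to+\infty$. (ii) If $\lambda=0$, then $u_s(r)\sim\left(\frac{N-1}{p-1}\right)^{1/(p-1)}r^{-1/(p-1)}$ as $r\to+\infty$. (iii) If $0<\lambda\le\frac{N(N-2)}{4}$, then $u_s(r)\sim\bar u_\infty e^{-\mu r}$ as $r\to+\infty$, for some $\bar u_\infty>0$.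
   Context: $\mathbb{H}^N$ is the $N$-dimensional hyperbolic space (constant curvature $-1$), $\Delta_{\mathbb{H}^N}$ its Laplace–Beltrami operator, $Q\in\mathbb{H}^N$ a fixed point, and $r=d_{\mathbb{H}^N}(x,Q)$. "Radial" means depending only on $r$; for radial $u=u(r)$ the equation reads $$u''+(N-1)\coth r\,u'+\lambda u+u^p=0,\qquad r>0.$$ A function $u\in C^2((0,\infty))$ is a positive radial singular solution if it solves this ODE, $u(r)>0$ for all $r>0$, and $u(r)\to+\infty$ as $r\to0^+$. Notation: $m=\frac{2}{p-1}$, $L=\bigl(m(N-2-m)\bigr)^{1/(p-1)}$, $\mu=\frac{N-1}{2}-\sqrt{\frac{(N-1)^2}{4}-\lambda}$. The relation $f\sim g$ means $f/g\to1$. *)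

theory Defs
  imports "HOL-Analysis.Analysis" "HOL-Library.Landau_Symbols"
begin

text \<open>
  A radial function on the hyperbolic space of dimension \<open>N\<close>, punctured at \<open>Q\<close>, is given by its
  profile \<open>u\<close>, a function of the distance \<open>r > 0\<close> to \<open>Q\<close>.  Only the values of \<open>u\<close> on
  \<open>{0<..}\<close> carry meaning; the values at \<open>r \<le> 0\<close> are junk.
\<close>

definition C2_pos :: "(real \<Rightarrow> real) \<Rightarrow> bool" where
  "C2_pos u \<longleftrightarrow>
     (\<forall>r>0. u differentiable (at r)) \<and>
     (\<forall>r>0. deriv u differentiable (at r)) \<and>
     continuous_on {0<..} (deriv (deriv u))"

text \<open>
  The radial part of the Laplace--Beltrami operator in curvature \<open>-1\<close> is
  \<open>u'' + (N - 1) coth r u'\<close>, with \<open>coth r = cosh r / sinh r\<close>.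
\<close>

definition radial_laplacian :: "nat \<Rightarrow> (real \<Rightarrow> real) \<Rightarrow> real \<Rightarrow> real" where
  "radial_laplacian N u r =
     deriv (deriv u) r + (real N - 1) * (cosh r / sinh r) * deriv u r"

definition pos_radial_singular_solution ::
    "nat \<Rightarrow> real \<Rightarrow> real \<Rightarrow> (real \<Rightarrow> real) \<Rightarrow> bool" where
  "pos_radial_singular_solution N p lam u \<longleftrightarrow>
     C2_pos u \<and>
     (\<forall>r>0. radial_laplacian N u r + lam * u r + u r powr p = 0) \<and>
     (\<forall>r>0. u r > 0) \<and>
     filterlim u at_top (at_right 0)"

definition m_exp :: "real \<Rightarrow> real" where
  "m_exp p = 2 / (p - 1)"

definition L_const :: "nat \<Rightarrow> real \<Rightarrow> real" where
  "L_const N p = (m_exp p * (real N - 2 - m_exp p)) powr (1 / (p - 1))"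

definition mu_rate :: "nat \<Rightarrow> real \<Rightarrow> real" where
  "mu_rate N lam = (real N - 1) / 2 - sqrt ((real N - 1)\<^sup>2 / 4 - lam)"

end

theory Submission
  imports Defs
begin

text \<open>
  In the variable \<open>t = ln (tanh (r / 2))\<close>, which maps \<open>r > 0\<close> onto \<open>t < 0\<close>, the profile
  \<open>W = (sinh r)^m u\<close> satisfies a damped oscillator equation that becomes autonomous as
  \<open>t \<rightarrow> - \<infinity>\<close> and has the stable rest point \<open>L\<close> there.  Since \<open>p\<close> is supercritical and
  \<open>lam \<le> N (N - 2) / 4\<close>, the Pohozaev-type energy of the equation decreases; it is negative for
  singular profiles, which keeps \<open>W\<close> positive, bounds it, and excludes the fast decay rate at
  infinity.

  Near \<open>- \<infinity>\<close> a quadratic Lyapunov function of the difference of two (approximate) solutions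
  decays exponentially.  This gives uniqueness among profiles tending to \<open>L\<close>, the convergence
  of the solutions started at \<open>t = - n\<close> on the two-term expansion, and the remainder estimate.
  An arbitrary singular profile tends to \<open>L\<close>: it is bounded, hence by a Barbalat argument tends
  to \<open>0\<close> or \<open>L\<close>, and the limit \<open>0\<close> would make \<open>u\<close> bounded.  At infinity one studies the Riccati
  equation of \<open>u' / u\<close>.
\<close>

text \<open>No data can be prescribed at \<open>t = - \<infinity>\<close>. In their place stands the
  linearization \<open>d'' + a * d' + Q * d = 0\<close> at \<open>L\<close>, with
  \<open>a, Q > 0\<close>: it contracts as \<open>t\<close> grows, so errors made at
  \<open>t = - n\<close> are forgotten, and a difference of solutions that stays bounded back to
  \<open>- \<infinity>\<close> must vanish.

  The energy is a bracket times \<open>sh powr a\<close>. At \<open>L\<close> the bracket tends to a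
  positive multiple of \<open>1 / (p + 1) - 1 / 2 < 0\<close>, and where \<open>W = 0\<close> it is
  at least 0; so a solution started near \<open>L\<close> never reaches 0 and extends to all
  \<open>t < 0\<close>. At infinity negativity reads
  \<open>u' / u \<ge> - \<nu> - sqrt Lam - o(1)\<close>, at a positive distance from the fast root,
  which gives the Riccati equation a positive damping towards the slow root.

  Of an arbitrary singular solution only \<open>u \<rightarrow> \<infinity>\<close> is known,
  without a rate. The bound on \<open>W\<close> must come from monotonicity and the divergence form
  of the equation, and the limit 0 is refuted by improving the bound on \<open>- v' / v\<close> from
  \<open>\<nu>\<close> to \<open>m / 2\<close> to a power of \<open>sh\<close>.\<close>

subsection \<open>Calculus on half-lines\<close>

text \<open>The continuity method: a strict bound persists if it cannot first fail by equality. The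
  premise \<open>step\<close> may use the bound on all of \<open>{a..<t}\<close>, which is where
  bootstrap estimates for the differential equation enter.\<close>

lemma continuous_first_exit:
  fixes g :: "real \<Rightarrow> real"
  assumes cont: "continuous_on {a..b} g" and ga: "g a < 0"
    and step: "\<And>t. a < t \<Longrightarrow> t \<le> b \<Longrightarrow> (\<forall>s\<in>{a..<t}. g s < 0) \<Longrightarrow> g t \<noteq> 0"
    and t: "a \<le> t" "t \<le> b"
  shows "g t < 0"
proof (rule ccontr)
  assume "\<not> g t < 0"
  define Z where "Z = {a..b} \<inter> g -` {0..}"
  have "closed Z"
    unfolding Z_def using cont by (intro continuous_closed_preimage) auto
  then have "compact Z"
    unfolding compact_eq_bounded_closed by (auto simp: Z_def intro: bounded_subset[of "{a..b}"])
  moreover have "t \<in> Z" using t \<open>\<not> g t < 0\<close> by (auto simp: Z_def)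
  ultimately obtain \<tau> where \<tau>: "\<tau> \<in> Z" "\<And>s. s \<in> Z \<Longrightarrow> \<tau> \<le> s"
    using compact_attains_inf[of Z] by blast
  have before: "g s < 0" if "s \<in> {a..<\<tau>}" for s
    using that \<tau>(1) \<tau>(2)[of s] by (force simp: Z_def)
  have "a \<le> \<tau>" "\<tau> \<le> b" "g \<tau> \<ge> 0" using \<tau>(1) by (auto simp: Z_def)
  moreover have "a \<noteq> \<tau>" using calculation(3) ga by auto
  ultimately have "a < \<tau>" by simp
  have "g \<tau> \<noteq> 0" using step[OF \<open>a < \<tau>\<close> \<open>\<tau> \<le> b\<close>] before by blast
  then have "g \<tau> > 0" using \<open>g \<tau> \<ge> 0\<close> by simp
  have "\<exists>s. a \<le> s \<and> s \<le> \<tau> \<and> g s = 0"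
    using IVT'[of g a 0 \<tau>] ga \<open>g \<tau> > 0\<close> \<open>a < \<tau>\<close> \<open>\<tau> \<le> b\<close> continuous_on_subset[OF cont, of "{a..\<tau>}"]
    by auto
  then obtain s where "a \<le> s" "s \<le> \<tau>" "g s = 0" by blast
  then show False using before[of s] \<open>g \<tau> > 0\<close> by (cases "s = \<tau>") auto
qed

text \<open>The integrating factor of the constant \<open>k0\<close> suffices: once
  \<open>(e t)^2 < k0^2 * \<eta>\<close>, completing a square gives
  \<open>(z^2)' \<le> - k0 * (z^2 - \<eta>)\<close>, so the excess of \<open>z^2\<close> over
  \<open>\<eta>\<close> is dominated by a decaying exponential.\<close>

lemma damped_tendsto_zero:
  fixes z k e :: "real \<Rightarrow> real"
  assumes der: "\<forall>\<^sub>F t in at_top. (z has_real_derivative (e t - k t * z t)) (at t)"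
    and k: "\<forall>\<^sub>F t in at_top. k t \<ge> k0" and k0: "k0 > 0"
    and e: "(e \<longlongrightarrow> 0) at_top"
  shows "(z \<longlongrightarrow> 0) at_top"
proof -
  have sq: "\<forall>\<^sub>F t in at_top. (z t)^2 < \<epsilon>" if \<epsilon>: "\<epsilon> > 0" for \<epsilon>
  proof -
    define \<eta> where "\<eta> = \<epsilon>/2"
    have "\<eta> > 0" using \<epsilon> by (simp add: \<eta>_def)
    have "((\<lambda>t. (e t)^2) \<longlongrightarrow> 0^2) at_top" by (intro tendsto_intros e)
    then have "\<forall>\<^sub>F t in at_top. (e t)^2 < k0^2 * \<eta>"
      using \<open>\<eta> > 0\<close> k0 by (intro order_tendstoD(2)[of _ 0]) auto
    with der k have "\<forall>\<^sub>F t in at_top. (z has_real_derivative (e t - k t * z t)) (at t) \<and> k t \<ge> k0 \<and> (e t)^2 < k0^2 * \<eta>"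
      by eventually_elim auto
    then obtain T where T: "\<And>t. t \<ge> T \<Longrightarrow> (z has_real_derivative (e t - k t * z t)) (at t)"
      "\<And>t. t \<ge> T \<Longrightarrow> k t \<ge> k0" "\<And>t. t \<ge> T \<Longrightarrow> (e t)^2 < k0^2 * \<eta>"
      unfolding eventually_at_top_linorder by blast
    define G where "G = (\<lambda>t. exp (k0*t) * ((z t)^2 - \<eta>))"
    have G: "G t \<le> G T" if "t \<ge> T" for t
    proof (rule DERIV_nonpos_imp_nonincreasing[OF that])
      fix s assume s: "T \<le> s" "s \<le> t"
      have "(G has_real_derivative exp (k0 * s) * (k0 * ((z s)^2 - \<eta>) + 2 * z s * (e s - k s * z s))) (at s)"
        unfolding G_def by (auto intro!: derivative_eq_intros T s simp: algebra_simps)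
      moreover have "k0 * ((z s)^2 - \<eta>) + 2 * z s * (e s - k s * z s) \<le> 0"
      proof -
        have "(k0 * z s - e s)^2 \<ge> 0" by simp
        then have "2 * (k0 * z s * e s) \<le> k0^2 * (z s)^2 + k0^2 * \<eta>"
          using T(3)[OF s(1)] by (simp add: power2_eq_square algebra_simps)
        then have "k0 * (2 * z s * e s) \<le> k0 * (k0 * (z s)^2 + k0 * \<eta>)"
          by (simp add: power2_eq_square algebra_simps)
        then have 1: "2 * z s * e s \<le> k0 * (z s)^2 + k0 * \<eta>" using k0 by simp
        have "k s * (z s)^2 \<ge> k0 * (z s)^2" using T(2)[OF s(1)] by (simp add: mult_right_mono)
        then show ?thesis using 1 by (simp add: power2_eq_square algebra_simps)
      qed
      ultimately show "\<exists>y. (G has_real_derivative y) (at s) \<and> y \<le> 0"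
        by (meson exp_ge_zero mult_nonneg_nonpos)
    qed
    have "((\<lambda>t. \<eta> + G T * exp (- k0 * t)) \<longlongrightarrow> \<eta> + G T * 0) at_top"
      using k0 by (intro tendsto_intros filterlim_compose[OF exp_at_bot] filterlim_tendsto_neg_mult_at_bot[OF tendsto_const _ filterlim_ident]) auto
    then have "\<forall>\<^sub>F t in at_top. \<eta> + G T * exp (- k0 * t) < \<epsilon>"
      by (rule order_tendstoD(2)) (use \<epsilon> in \<open>simp add: \<eta>_def\<close>)
    with eventually_ge_at_top[of T] show ?thesis
    proof eventually_elim
      case (elim t)
      have "(z t)^2 - \<eta> = exp (- k0*t) * G t" by (simp add: G_def exp_minus)
      also have "... \<le> exp (- k0*t) * G T" using G elim by simp
      finally show ?case using elim by (simp add: mult.commute)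
    qed
  qed
  show ?thesis
  proof (rule tendstoI)
    fix r :: real assume "r > 0"
    show "\<forall>\<^sub>F t in at_top. dist (z t) 0 < r"
      using sq[of "r^2"] \<open>r > 0\<close> by (auto elim!: eventually_mono simp: power2_less_imp_less dest!: power2_less_imp_less[of "\<bar>z _\<bar>" r, simplified])
  qed
qed

text \<open>The function \<open>exp (\<delta> * t) * z t\<close> solves an equation of the same
  kind, with damping \<open>k - \<delta>\<close> and a forcing that still tends to 0 because
  \<open>\<delta> < \<gamma>\<close>. Its limit 0 absorbs every constant, hence the factor 1 in the
  bound.\<close>

lemma damped_exponential_bound:
  fixes z k e :: "real \<Rightarrow> real"
  assumes der: "\<forall>\<^sub>F t in at_top. (z has_real_derivative (e t - k t * z t)) (at t)"
    and k: "\<forall>\<^sub>F t in at_top. k t \<ge> k0" and \<delta>: "\<delta> > 0" "\<delta> < k0" "\<delta> < \<gamma>"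
    and e: "\<forall>\<^sub>F t in at_top. \<bar>e t\<bar> \<le> K * exp (- \<gamma> * t)"
  shows "\<forall>\<^sub>F t in at_top. \<bar>z t\<bar> \<le> exp (- \<delta> * t)"
proof -
  define y where "y = (\<lambda>t. exp (\<delta> * t) * z t)"
  have "(y \<longlongrightarrow> 0) at_top"
  proof (rule damped_tendsto_zero)
    show "\<forall>\<^sub>F t in at_top. (y has_real_derivative (exp (\<delta>*t) * e t - (k t - \<delta>) * y t)) (at t)"
      using der by eventually_elim
        (auto simp: y_def intro!: derivative_eq_intros simp: algebra_simps)
    show "\<forall>\<^sub>F t in at_top. k t - \<delta> \<ge> k0 - \<delta>" using k by eventually_elim auto
    show "k0 - \<delta> > 0" using \<delta> by simp
    show "((\<lambda>t. exp (\<delta>*t) * e t) \<longlongrightarrow> 0) at_top"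
    proof (rule Lim_null_comparison)
      show "\<forall>\<^sub>F t in at_top. norm (exp (\<delta>*t) * e t) \<le> K * exp ((\<delta> - \<gamma>) * t)"
        using e
      proof eventually_elim
        case (elim t)
        have "exp (\<delta>*t) * \<bar>e t\<bar> \<le> exp (\<delta>*t) * (K * exp (- \<gamma> * t))" using elim by simp
        also have "\<dots> = K * exp ((\<delta> - \<gamma>) * t)" by (simp add: algebra_simps flip: exp_add)
        finally show ?case by (simp add: abs_mult)
      qed
      have "((\<lambda>t. K * exp ((\<delta> - \<gamma>) * t)) \<longlongrightarrow> K * 0) at_top"
        using \<delta> by (intro tendsto_intros filterlim_compose[OF exp_at_bot] filterlim_tendsto_neg_mult_at_bot[OF tendsto_const _ filterlim_ident]) auto
      then show "((\<lambda>t. K * exp ((\<delta> - \<gamma>) * t)) \<longlongrightarrow> 0) at_top" by simp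
    qed
  qed
  then have "\<forall>\<^sub>F t in at_top. \<bar>y t\<bar> < 1"
    using tendstoD[of y 0 at_top 1] by simp
  then show ?thesis
  proof eventually_elim
    case (elim t)
    have "exp (- \<delta> * t) * \<bar>y t\<bar> \<le> exp (- \<delta> * t) * 1" using elim by (intro mult_left_mono) auto
    then show ?case by (simp add: y_def abs_mult exp_minus field_simps)
  qed
qed

text \<open>A positive value of \<open>D\<close> would grow like \<open>exp (- k * s)\<close> as
  \<open>s\<close> goes back to \<open>- \<infinity>\<close>, against the bound \<open>M\<close>.
  This turns forward contraction into rigidity at \<open>- \<infinity>\<close>.\<close>

lemma nonpos_of_decay_at_bot:
  fixes D D' :: "real \<Rightarrow> real"
  assumes der: "\<And>t. t \<le> T \<Longrightarrow> (D has_real_derivative D' t) (at t)"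
    and le: "\<And>t. t \<le> T \<Longrightarrow> D' t \<le> - k * D t" and k: "k > 0"
    and bd: "\<And>t. t \<le> T \<Longrightarrow> D t \<le> M" and t: "t \<le> T"
  shows "D t \<le> 0"
proof -
  have mono: "exp (k*t) * D t \<le> exp (k * s) * M" if "s \<le> t" for s
  proof -
    have "exp (k*t) * D t \<le> exp (k * s) * D s"
    proof (rule DERIV_nonpos_imp_nonincreasing[OF that])
      fix x assume x: "s \<le> x" "x \<le> t"
      have "((\<lambda>t. exp (k*t) * D t) has_real_derivative exp (k*x) * (D' x + k * D x)) (at x)"
        using x t by (auto intro!: derivative_eq_intros der simp: algebra_simps)
      moreover have "exp (k*x) * (D' x + k * D x) \<le> 0"
        using le[of x] x t by (simp add: mult_le_0_iff)
      ultimately show "\<exists>y. ((\<lambda>t. exp (k*t) * D t) has_real_derivative y) (at x) \<and> y \<le> 0" by blast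
    qed
    also have "\<dots> \<le> exp (k * s) * M" using bd[of s] that t by simp
    finally show ?thesis .
  qed
  have "((\<lambda>s. exp (k * s) * M) \<longlongrightarrow> 0 * M) at_bot"
    using k by (intro tendsto_intros filterlim_compose[OF exp_at_bot] filterlim_tendsto_pos_mult_at_bot[OF tendsto_const _ filterlim_ident]) auto
  then have "exp (k*t) * D t \<le> 0 * M"
    by (rule tendsto_lowerbound) (auto intro!: eventually_at_bot_linorderI[of t] mono)
  then show ?thesis by (simp add: mult_le_0_iff)
qed

text \<open>A form of Barbalat's lemma.\<close>

lemma tendsto_zero_of_dissipation:
  fixes F F' y y' :: "real \<Rightarrow> real"
  assumes F: "\<And>t. t \<ge> T \<Longrightarrow> (F has_real_derivative F' t) (at t)"
    and F': "\<And>t. t \<ge> T \<Longrightarrow> F' t \<ge> \<kappa> * (y t)^2" and \<kappa>: "\<kappa> > 0"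
    and bd: "\<And>t. t \<ge> T \<Longrightarrow> F t \<le> M"
    and y: "\<And>t. t \<ge> T \<Longrightarrow> (y has_real_derivative y' t) (at t)"
    and y': "\<And>t. t \<ge> T \<Longrightarrow> \<bar>y' t\<bar> \<le> G"
  shows "(y \<longlongrightarrow> 0) at_top"
proof (rule tendstoI)
  fix \<epsilon> :: real assume \<epsilon>: "\<epsilon> > 0"
  define G' where "G' = \<bar>G\<bar> + 1"
  \<comment> \<open>In time \<open>d\<close> the function \<open>y\<close> moves by at most
    \<open>\<epsilon> / 2\<close>, so a value of size \<open>\<epsilon>\<close> forces
    \<open>F\<close> to rise by \<open>\<eta>\<close>; from \<open>T1\<close> on, less than
    \<open>\<eta>\<close> of growth is left.\<close>
  define d where "d = \<epsilon> / (2 * G')"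
  define \<eta> where "\<eta> = \<kappa> * (\<epsilon>/2)^2 * d"
  have G': "G' > 0" "\<And>t. t \<ge> T \<Longrightarrow> \<bar>y' t\<bar> \<le> G'"
    using y' by (force simp: G'_def)+
  have d: "d > 0" using \<epsilon> G' by (simp add: d_def)
  have \<eta>: "\<eta> > 0" using d \<kappa> \<epsilon> by (simp add: \<eta>_def)
  have mono: "F s \<le> F t" if "T \<le> s" "s \<le> t" for s t
  proof (rule DERIV_nonneg_imp_nondecreasing[OF that(2)])
    fix x assume "s \<le> x" "x \<le> t"
    then have "T \<le> x" using that by simp
    then show "\<exists>y. (F has_real_derivative y) (at x) \<and> 0 \<le> y"
      using F[of x] F'[of x] \<kappa> by (meson order_trans zero_le_mult_iff less_imp_le zero_le_power2)
  qed
  define \<sigma> where "\<sigma> = Sup (F ` {T..})"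
  have bdd: "bdd_above (F ` {T..})" using bd by (auto intro!: bdd_aboveI)
  obtain T1 where T1: "T1 \<ge> T" "F T1 > \<sigma> - \<eta>"
    using less_cSup_iff[of "F ` {T..}" "\<sigma> - \<eta>"] bdd \<eta> by (auto simp: \<sigma>_def)
  have up: "F t \<le> \<sigma>" if "t \<ge> T" for t
    using cSup_upper[OF _ bdd, of "F t"] that by (auto simp: \<sigma>_def)
  have "\<bar>y t\<bar> < \<epsilon>" if t: "t \<ge> T1" for t
  proof (rule ccontr)
    assume "\<not> \<bar>y t\<bar> < \<epsilon>"
    then have yt: "\<bar>y t\<bar> \<ge> \<epsilon>" by simp
    have ys: "\<bar>y s\<bar> \<ge> \<epsilon>/2" if s: "t \<le> s" "s \<le> t + d" for s
    proof -
      have "norm (y s - y t) \<le> G' * norm (s - t)"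
      proof (rule field_differentiable_bound[of "{T..}"])
        show "(y has_field_derivative y' z) (at z within {T..})" if "z \<in> {T..}" for z
          using y[of z] that by (auto intro: has_field_derivative_at_within)
        show "norm (y' z) \<le> G'" if "z \<in> {T..}" for z
          using G'(2)[of z] that by auto
      qed (use T1 t s in auto)
      also have "\<dots> \<le> G' * d" using s G' by (intro mult_left_mono) auto
      also have "\<dots> = \<epsilon>/2" using G' by (simp add: d_def)
      finally have "\<bar>y s - y t\<bar> \<le> \<epsilon>/2" by simp
      then show ?thesis using yt by arith
    qed
    have "F t - \<kappa> * (\<epsilon>/2)^2 * t \<le> F (t+d) - \<kappa> * (\<epsilon>/2)^2 * (t + d)"
    proof (rule DERIV_nonneg_imp_nondecreasing[where f = "\<lambda>t. F t - \<kappa> * (\<epsilon>/2)^2 * t"])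
      show "t \<le> t + d" using d by simp
      fix s assume s: "t \<le> s" "s \<le> t + d"
      have "((\<lambda>t. F t - \<kappa> * (\<epsilon>/2)^2 * t) has_real_derivative F' s - \<kappa> * (\<epsilon>/2)^2) (at s)"
        using s t T1 by (auto intro!: derivative_eq_intros F)
      moreover have "\<kappa> * (\<epsilon>/2)^2 \<le> \<kappa> * (y s)^2"
        using ys[OF s] \<kappa> \<epsilon> by (metis abs_le_square_iff abs_of_pos half_gt_zero mult_left_mono less_imp_le)
      then have "F' s - \<kappa> * (\<epsilon>/2)^2 \<ge> 0" using F'[of s] s t T1 by auto
      ultimately show "\<exists>y. ((\<lambda>t. F t - \<kappa> * (\<epsilon>/2)^2 * t) has_real_derivative y) (at s) \<and> 0 \<le> y" by blast
    qed
    then have "F t + \<eta> \<le> F (t+d)" by (simp add: \<eta>_def algebra_simps)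
    moreover have "F T1 \<le> F t" "F (t+d) \<le> \<sigma>" using mono[of T1 t] up[of "t+d"] T1 t d by auto
    ultimately show False using T1 by simp
  qed
  then show "\<forall>\<^sub>F t in at_top. dist (y t) 0 < \<epsilon>"
    by (auto intro!: eventually_at_top_linorderI[of T1])
qed

text \<open>Some value of \<open>y'\<close> in a unit interval equals the increment of
  \<open>y\<close> there, hence is small. Since \<open>x\<close> moves little in that interval and
  \<open>g\<close> is uniformly continuous, smallness of \<open>g\<close> at this one time passes to
  its left end \<open>t\<close>.\<close>

lemma force_tendsto_zero:
  fixes x y e g :: "real \<Rightarrow> real"
  assumes x: "\<forall>\<^sub>F t in at_top. (x has_real_derivative y t) (at t)"
    and y: "\<forall>\<^sub>F t in at_top. (y has_real_derivative (e t - g (x t))) (at t)"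
    and y0: "(y \<longlongrightarrow> 0) at_top" and e0: "(e \<longlongrightarrow> 0) at_top"
    and g: "continuous_on {0..M} g" and xM: "\<forall>\<^sub>F t in at_top. x t \<in> {0..M}"
  shows "((\<lambda>t. g (x t)) \<longlongrightarrow> 0) at_top"
proof (rule tendstoI)
  fix \<epsilon>0 :: real assume \<epsilon>0: "\<epsilon>0 > 0"
  \<comment> \<open>Four errors are added: two values of \<open>y\<close>, one of \<open>e\<close>,
    and the variation of \<open>g\<close> along \<open>x\<close>.\<close>
  define \<epsilon> where "\<epsilon> = \<epsilon>0 / 4"
  have \<epsilon>: "\<epsilon> > 0" using \<epsilon>0 by (simp add: \<epsilon>_def)
  have "uniformly_continuous_on {0..M} g"
    using g compact_uniformly_continuous by blast
  then obtain d where d: "d > 0" "\<And>a b. a \<in> {0..M} \<Longrightarrow> b \<in> {0..M} \<Longrightarrow> \<bar>b - a\<bar> < d \<Longrightarrow> \<bar>g b - g a\<bar> < \<epsilon>"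
    using \<epsilon> unfolding uniformly_continuous_on_def dist_real_def by metis
  have "\<forall>\<^sub>F t in at_top. \<bar>y t\<bar> < min d \<epsilon>" "\<forall>\<^sub>F t in at_top. \<bar>e t\<bar> < \<epsilon>"
    using tendstoD[OF y0, of "min d \<epsilon>"] tendstoD[OF e0, of \<epsilon>] d \<epsilon> by auto
  with x y xM have "\<forall>\<^sub>F t in at_top. (x has_real_derivative y t) (at t) \<and> (y has_real_derivative (e t - g (x t))) (at t)
      \<and> \<bar>y t\<bar> < min d \<epsilon> \<and> \<bar>e t\<bar> < \<epsilon> \<and> x t \<in> {0..M}"
    by eventually_elim auto
  then obtain T where T: "\<And>t. t \<ge> T \<Longrightarrow> (x has_real_derivative y t) (at t)"
     "\<And>t. t \<ge> T \<Longrightarrow> (y has_real_derivative (e t - g (x t))) (at t)"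
     "\<And>t. t \<ge> T \<Longrightarrow> \<bar>y t\<bar> < min d \<epsilon>" "\<And>t. t \<ge> T \<Longrightarrow> \<bar>e t\<bar> < \<epsilon>" "\<And>t. t \<ge> T \<Longrightarrow> x t \<in> {0..M}"
    unfolding eventually_at_top_linorder by blast
  have "dist (g (x t)) 0 < \<epsilon>0" if t: "t \<ge> T" for t
  proof -
    obtain \<xi> where \<xi>: "t < \<xi>" "\<xi> < t+1" "y (t+1) - y t = (t + 1 - t) * (e \<xi> - g (x \<xi>))"
      using MVT2[of t "t+1" y "\<lambda>t. e t - g (x t)"] T(2) t by auto
    obtain \<zeta> where \<zeta>: "t < \<zeta>" "\<zeta> < \<xi>" "x \<xi> - x t = (\<xi> - t) * y \<zeta>"
      using MVT2[of t \<xi> x y] T(1) t \<xi> by auto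
    have "\<bar>x \<xi> - x t\<bar> \<le> 1 * \<bar>y \<zeta>\<bar>" unfolding \<zeta> abs_mult using \<xi> by (intro mult_right_mono) auto
    then have "\<bar>x \<xi> - x t\<bar> < d" using T(3)[of \<zeta>] \<zeta> t by auto
    then have "\<bar>g (x \<xi>) - g (x t)\<bar> < \<epsilon>" using d(2) T(5) t \<xi> by auto
    moreover have "\<bar>y (t+1)\<bar> < \<epsilon>" "\<bar>y t\<bar> < \<epsilon>" "\<bar>e \<xi>\<bar> < \<epsilon>" using T(3)[of t] T(3)[of "t+1"] T(4)[of \<xi>] t \<xi> by auto
    ultimately have "\<bar>g (x t)\<bar> < 4 * \<epsilon>" using \<xi>(3) by auto
    then show ?thesis by (simp add: \<epsilon>_def)
  qed
  then show "\<forall>\<^sub>F t in at_top. dist (g (x t)) 0 < \<epsilon>0"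
    by (auto intro!: eventually_at_top_linorderI[of T])
qed

text \<open>A lower bound \<open>h\<close> of limit 0 replaces the limit of \<open>g\<close>: in the
  applications \<open>g\<close> is a nonnegative quantity minus a power of \<open>sh\<close>, and
  \<open>h\<close> is what remains when that quantity is dropped.\<close>

lemma nonneg_of_nondecreasing_at_bot:
  fixes g g' h :: "real \<Rightarrow> real"
  assumes der: "\<And>t. t \<le> T \<Longrightarrow> (g has_real_derivative g' t) (at t)" and g': "\<And>t. t \<le> T \<Longrightarrow> g' t \<ge> 0"
    and h: "\<And>t. t \<le> T \<Longrightarrow> h t \<le> g t" "(h \<longlongrightarrow> 0) at_bot" and t: "t \<le> T"
  shows "g t \<ge> 0"
proof (rule tendsto_upperbound[OF h(2)])
  have "h s \<le> g t" if "s \<le> t" for s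
  proof -
    have "g s \<le> g t"
    proof (rule DERIV_nonneg_imp_nondecreasing[OF that])
      fix x assume "s \<le> x" "x \<le> t"
      then have "x \<le> T" using t by simp
      then show "\<exists>y. (g has_real_derivative y) (at x) \<and> y \<ge> 0" using der g' by blast
    qed
    then show ?thesis using h(1)[of s] that t by simp
  qed
  then show "\<forall>\<^sub>F s in at_bot. h s \<le> g t" by (auto simp: eventually_at_bot_linorder)
qed simp

text \<open>With the tail \<open>g\<close> of the integral of the bound, \<open>f - g\<close>
  increases and \<open>f + g\<close> decreases, so \<open>f - g\<close> is bounded and converges;
  \<open>g\<close> itself tends to 0.\<close>

lemma convergent_of_exponential_derivative:
  fixes f f' :: "real \<Rightarrow> real"
  assumes f: "\<And>t. t \<ge> T \<Longrightarrow> (f has_real_derivative f' t) (at t)"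
    and le: "\<And>t. t \<ge> T \<Longrightarrow> \<bar>f' t\<bar> \<le> exp (- d * t)" and d: "d > 0"
  obtains c where "(f \<longlongrightarrow> c) at_top"
proof -
  define g where "g t = exp (- d * t) / d" for t
  have g: "(g has_real_derivative - exp (- d * t)) (at t)" for t
    unfolding g_def using d by (auto intro!: derivative_eq_intros)
  have g0: "(g \<longlongrightarrow> 0) at_top"
  proof -
    have "((\<lambda>t. exp (- d * t) / d) \<longlongrightarrow> 0 / d) at_top"
      using d by (intro tendsto_intros filterlim_compose[OF exp_at_bot] filterlim_tendsto_neg_mult_at_bot[OF tendsto_const _ filterlim_ident]) auto
    then show ?thesis by (simp add: g_def[abs_def])
  qed
  have up: "f s - g s \<le> f t - g t" if "T \<le> s" "s \<le> t" for s t
  proof (rule DERIV_nonneg_imp_nondecreasing[OF that(2), of "\<lambda>t. f t - g t"])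
    fix x assume "s \<le> x" "x \<le> t"
    then have x: "T \<le> x" using that by simp
    have "f' x + exp (- d * x) \<ge> 0" using le[OF x] by linarith
    then show "\<exists>y. ((\<lambda>t. f t - g t) has_real_derivative y) (at x) \<and> y \<ge> 0"
      using DERIV_diff[OF f[OF x] g[of x]] by auto
  qed
  have down: "f t + g t \<le> f s + g s" if "T \<le> s" "s \<le> t" for s t
  proof (rule DERIV_nonpos_imp_nonincreasing[OF that(2), of "\<lambda>t. f t + g t"])
    fix x assume "s \<le> x" "x \<le> t"
    then have x: "T \<le> x" using that by simp
    have "f' x - exp (- d * x) \<le> 0" using le[OF x] by linarith
    then show "\<exists>y. ((\<lambda>t. f t + g t) has_real_derivative y) (at x) \<and> y \<le> 0"
      using DERIV_add[OF f[OF x] g[of x]] by auto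
  qed
  have g_pos: "g t > 0" for t using d by (simp add: g_def)
  have bdd: "bdd_above ((\<lambda>t. f t - g t) ` {T..})"
  proof (rule bdd_aboveI2)
    fix t assume "t \<in> {T..}"
    then show "f t - g t \<le> f T + g T" using down[of T t] g_pos[of t] by auto
  qed
  define c where "c = Sup ((\<lambda>t. f t - g t) ` {T..})"
  have "((\<lambda>t. f t - g t) \<longlongrightarrow> c) at_top"
  proof (rule order_tendstoI)
    fix y assume "y < c"
    then obtain s where s: "s \<ge> T" "y < f s - g s"
      using less_cSup_iff[of "(\<lambda>t. f t - g t) ` {T..}" y] bdd by (auto simp: c_def)
    then show "\<forall>\<^sub>F t in at_top. y < f t - g t"
      using up[of s] by (auto intro!: eventually_at_top_linorderI[of s] intro: less_le_trans)
  next
    fix y assume y: "c < y"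
    show "\<forall>\<^sub>F t in at_top. f t - g t < y"
    proof (rule eventually_at_top_linorderI[of T])
      fix t assume "T \<le> t"
      then have "f t - g t \<le> c" unfolding c_def by (intro cSup_upper bdd) auto
      then show "f t - g t < y" using y by simp
    qed
  qed
  from tendsto_add[OF this g0] have "(f \<longlongrightarrow> c) at_top" by simp
  then show thesis by (rule that)
qed

text \<open>At half the positive zero \<open>L\<close> of the force \<open>w powr p - A * w\<close>
  the force is not 0, so eventually \<open>x\<close> can no longer cross \<open>L / 2\<close>. On
  either side the force controls the distance to the zero on that side. The lemma serves at both
  ends of the half-line, at infinity with \<open>A = - lam\<close>.\<close>

lemma power_force_dichotomy:
  fixes x :: "real \<Rightarrow> real" and A p :: real
  assumes A: "A > 0" and p: "p > 1" and cont: "continuous_on {T0..} x" and pos: "\<And>t. t \<ge> T0 \<Longrightarrow> x t > 0"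
    and force: "((\<lambda>t. x t powr p - A * x t) \<longlongrightarrow> 0) at_top"
  shows "(x \<longlongrightarrow> 0) at_top \<or> (x \<longlongrightarrow> A powr (1 / (p - 1))) at_top"
proof -
  define L where "L = A powr (1 / (p - 1))"
  have L: "L > 0" "L powr (p - 1) = A" using A p by (auto simp: L_def powr_powr)
  define g where "g w = w powr p - A * w" for w
  have g0: "((\<lambda>t. g (x t)) \<longlongrightarrow> 0) at_top" using force by (simp add: g_def)
  have g_eq: "g w = w * (w powr (p - 1) - A)" if "w > 0" for w
    using powr_mult_base[of w "p - 1"] that by (simp add: g_def algebra_simps)
  \<comment> \<open>The least value of \<open>A - w powr (p - 1)\<close> for
    \<open>0 < w \<le> L / 2\<close>; below \<open>L / 2\<close> it gives
    \<open>x * k \<le> \<bar>g x\<bar>\<close>.\<close>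
  define k where "k = A - (L / 2) powr (p - 1)"
  have k: "k > 0" using powr_less_mono2[of "p - 1" "L / 2" L] L p by (simp add: k_def)
  have gL: "g (L / 2) = - (L / 2 * k)" using L by (simp add: g_eq k_def algebra_simps)
  have "\<forall>\<^sub>F t in at_top. \<bar>g (x t)\<bar> < L / 2 * k \<and> t \<ge> T0"
    using tendstoD[OF g0 mult_pos_pos[OF half_gt_zero[OF L(1)] k]] eventually_ge_at_top[of T0]
    by eventually_elim (auto simp: dist_real_def)
  then obtain T where T: "\<And>t. t \<ge> T \<Longrightarrow> \<bar>g (x t)\<bar> < L / 2 * k \<and> t \<ge> T0"
    unfolding eventually_at_top_linorder by blast
  have x: "x t > 0" if "t \<ge> T" for t using T[OF that] pos by simp
  have ne: "x t \<noteq> L / 2" if "t \<ge> T" for t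
  proof
    assume eq: "x t = L / 2"
    have "\<bar>g (x t)\<bar> = L / 2 * k" unfolding eq gL using k L by simp
    then show False using T[OF that] by simp
  qed
  have cont': "continuous_on {T..t} x" for t
    by (rule continuous_on_subset[OF cont]) (use T[of T] in auto)
  show ?thesis
  proof (cases "x T < L / 2")
    case True
    have less: "x t < L / 2" if t: "t \<ge> T" for t
    proof (rule ccontr)
      assume "\<not> x t < L / 2"
      then obtain s where "T \<le> s" "s \<le> t" "x s = L / 2"
        using IVT'[of x T "L / 2" t] True t cont' by auto
      then show False using ne by blast
    qed
    have "(x \<longlongrightarrow> 0) at_top"
    proof (rule Lim_null_comparison)
      have "((\<lambda>t. \<bar>g (x t)\<bar> / k) \<longlongrightarrow> \<bar>0\<bar> / k) at_top" using k by (intro tendsto_intros g0) auto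
      then show "((\<lambda>t. \<bar>g (x t)\<bar> / k) \<longlongrightarrow> 0) at_top" by simp
      show "\<forall>\<^sub>F t in at_top. norm (x t) \<le> \<bar>g (x t)\<bar> / k"
        using eventually_ge_at_top[of T]
      proof eventually_elim
        case (elim t)
        have "x t powr (p - 1) \<le> (L / 2) powr (p - 1)"
          using x[OF elim] less[OF elim] p by (intro powr_mono2) auto
        then have "x t * k \<le> x t * (A - x t powr (p - 1))"
          using x[OF elim] by (intro mult_left_mono) (auto simp: k_def)
        also have "\<dots> = - g (x t)" using x[OF elim] by (simp add: g_eq algebra_simps)
        finally have "x t * k \<le> \<bar>g (x t)\<bar>" by linarith
        then show ?case using x[OF elim] k by (simp add: pos_le_divide_eq)
      qed
    qed
    then show ?thesis ..
  next
    case False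
    have gt: "x t > L / 2" if t: "t \<ge> T" for t
    proof (rule ccontr)
      assume "\<not> x t > L / 2"
      then obtain s where "T \<le> s" "s \<le> t" "x s = L / 2"
        using IVT2'[of x t "L / 2" T] False t cont' by auto
      then show False using ne by blast
    qed
    have "((\<lambda>t. x t powr (p - 1) - A) \<longlongrightarrow> 0) at_top"
    proof (rule Lim_null_comparison)
      have "((\<lambda>t. \<bar>g (x t)\<bar> / (L / 2)) \<longlongrightarrow> \<bar>0\<bar> / (L / 2)) at_top" using L by (intro tendsto_intros g0) auto
      then show "((\<lambda>t. \<bar>g (x t)\<bar> / (L / 2)) \<longlongrightarrow> 0) at_top" by simp
      show "\<forall>\<^sub>F t in at_top. norm (x t powr (p - 1) - A) \<le> \<bar>g (x t)\<bar> / (L / 2)"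
        using eventually_ge_at_top[of T]
      proof eventually_elim
        case (elim t)
        have "L / 2 * \<bar>x t powr (p - 1) - A\<bar> \<le> x t * \<bar>x t powr (p - 1) - A\<bar>"
          using gt[OF elim] by (intro mult_right_mono) auto
        also have "\<dots> = \<bar>g (x t)\<bar>" using x[OF elim] by (simp add: g_eq abs_mult)
        finally show ?case using L by (simp add: pos_le_divide_eq mult.commute)
      qed
    qed
    then have "((\<lambda>t. x t powr (p - 1)) \<longlongrightarrow> A) at_top" by (simp add: LIM_zero_iff)
    then have "((\<lambda>t. (x t powr (p - 1)) powr (1 / (p - 1))) \<longlongrightarrow> A powr (1 / (p - 1))) at_top"
      using A by (intro tendsto_intros) auto
    then have "(x \<longlongrightarrow> A powr (1 / (p - 1))) at_top"
    proof (rule Lim_transform_eventually)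
      show "\<forall>\<^sub>F t in at_top. (x t powr (p - 1)) powr (1 / (p - 1)) = x t"
        using eventually_ge_at_top[of T] by eventually_elim (use p x in \<open>simp add: powr_powr less_imp_le\<close>)
    qed
    then show ?thesis ..
  qed
qed

text \<open>The threshold \<open>N\<close> is needed because the \<open>n\<close>-th approximant
  solves its equation only on its own interval, which contains \<open>S\<close> from some index
  on.\<close>

lemma has_derivative_locally_uniform_limit:
  fixes f f' :: "nat \<Rightarrow> real \<Rightarrow> real"
  assumes t: "t \<in> S" and S: "open S" "convex S"
    and der: "\<And>n s. n \<ge> N \<Longrightarrow> s \<in> S \<Longrightarrow> (f n has_real_derivative f' n s) (at s)"
    and le: "\<And>n s. n \<ge> N \<Longrightarrow> s \<in> S \<Longrightarrow> \<bar>f' n s - g' s\<bar> \<le> \<epsilon> n" and \<epsilon>: "\<epsilon> \<longlonglongrightarrow> 0"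
    and lim: "\<And>s. s \<in> S \<Longrightarrow> (\<lambda>n. f n s) \<longlonglongrightarrow> g s"
  shows "(g has_real_derivative g' t) (at t)"
proof -
  have "\<exists>h. \<forall>s\<in>S. (\<lambda>n. f (n + N) s) \<longlonglongrightarrow> h s \<and> (h has_derivative (*) (g' s)) (at s within S)"
  proof (rule has_derivative_sequence[where f' = "\<lambda>n s. (*) (f' (n + N) s)"])
    show "(f (n + N) has_derivative (*) (f' (n + N) s)) (at s within S)" if "s \<in> S" for n s
      using der[of "n + N" s] that by (simp add: has_field_derivative_def has_derivative_at_withinI)
    show "\<forall>\<^sub>F n in sequentially. \<forall>s\<in>S. \<forall>h. norm (f' (n + N) s * h - g' s * h) \<le> e * norm h" if "e > 0" for e
    proof -
      have "\<forall>\<^sub>F n in sequentially. \<epsilon> (n + N) < e"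
        using LIMSEQ_ignore_initial_segment[OF \<epsilon>] that by (rule order_tendstoD(2))
      then show ?thesis
      proof eventually_elim
        case (elim n)
        show ?case
        proof (intro ballI allI)
          fix s h assume "s \<in> S"
          then have "\<bar>f' (n + N) s - g' s\<bar> * \<bar>h\<bar> \<le> e * \<bar>h\<bar>"
            using le[of "n + N" s] elim by (intro mult_right_mono) auto
          then show "norm (f' (n + N) s * h - g' s * h) \<le> e * norm h"
            by (simp add: abs_mult flip: left_diff_distrib)
        qed
      qed
    qed
    show "(\<lambda>n. f (n + N) t) \<longlonglongrightarrow> g t" using LIMSEQ_ignore_initial_segment[OF lim[OF t]] .
  qed (use S t in auto)
  then obtain h where h: "\<And>s. s \<in> S \<Longrightarrow> (\<lambda>n. f (n + N) s) \<longlonglongrightarrow> h s"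
    "\<And>s. s \<in> S \<Longrightarrow> (h has_derivative (*) (g' s)) (at s within S)" by blast
  have "h s = g s" if "s \<in> S" for s
    using LIMSEQ_unique[OF h(1)[OF that] LIMSEQ_ignore_initial_segment[OF lim[OF that]]] .
  moreover have "(h has_derivative (*) (g' t)) (at t)" using h(2)[OF t] at_within_open[OF t S(1)] by simp
  ultimately show ?thesis
    unfolding has_field_derivative_def
    by (rule has_derivative_transform_within_open[OF _ S(1) t, rotated]) auto
qed

subsection \<open>Global solutions of Lipschitz equations\<close>

text \<open>The exponential weight makes the integral operator a contraction on the whole interval.\<close>

lemma picard_lindelof_lipschitz:
  fixes F :: "real \<Rightarrow> 'a::banach \<Rightarrow> 'a"
  assumes ab: "a \<le> b"
    and cont: "continuous_on ({a..b} \<times> UNIV) (\<lambda>(t, x). F t x)"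
    and lip: "\<And>t x y. t \<in> {a..b} \<Longrightarrow> norm (F t x - F t y) \<le> K * norm (x - y)"
  obtains x where "x a = x0"
    "\<And>t. t \<in> {a..b} \<Longrightarrow> (x has_vector_derivative F t (x t)) (at t within {a..b})"
proof -
  \<comment> \<open>Large enough for the contraction factor
    \<open>\<bar>K\<bar> / \<kappa> \<le> 1 / 2\<close>, and positive also for
    \<open>K = 0\<close>.\<close>
  define \<kappa> where "\<kappa> = 2 * \<bar>K\<bar> + 1"
  have \<kappa>: "\<kappa> > 0" "\<bar>K\<bar> / \<kappa> \<le> 1/2" by (auto simp: \<kappa>_def field_simps)
  \<comment> \<open>Clamping the time to \<open>{a..b}\<close> makes the candidates functions on the
    whole line, as \<open>bcontfun\<close> demands.\<close>
  define c where "c = (\<lambda>t. max a (min b t))"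
  have c: "c t \<in> {a..b}" for t using ab by (auto simp: c_def)
  have c_id: "c t = t" if "t \<in> {a..b}" for t using that by (auto simp: c_def)
  have cont_c: "continuous_on UNIV c" unfolding c_def by (intro continuous_intros)
  \<comment> \<open>A point \<open>g\<close> of \<open>bcontfun\<close> stands for a candidate
    solution divided by the weight \<open>exp (\<kappa> * (s - a))\<close>.\<close>
  define f where "f = (\<lambda>g s. F s (exp (\<kappa> * (s - a)) *\<^sub>R apply_bcontfun g s))"
  have cont_f: "continuous_on {a..b} (f g)" for g
  proof -
    have "continuous_on {a..b} (\<lambda>s. (s, exp (\<kappa> * (s - a)) *\<^sub>R apply_bcontfun g s))"
      by (intro continuous_intros continuous_on_apply_bcontfun)
    from continuous_on_compose2[OF cont this] show ?thesis by (auto simp: f_def)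
  qed
  define I where "I = (\<lambda>g t. integral {a..t} (f g))"
  have cont_I: "continuous_on {a..b} (I g)" for g
    unfolding I_def using indefinite_integral_continuous_1[OF integrable_continuous_real[OF cont_f]] .
  define T0 where "T0 = (\<lambda>g t. exp (- \<kappa> * (c t - a)) *\<^sub>R (x0 + I g (c t)))"
  have T0: "T0 g \<in> bcontfun" for g
  proof -
    have "continuous_on {a..b} (\<lambda>t. exp (- \<kappa> * (t - a)) *\<^sub>R (x0 + I g t))"
      by (intro continuous_intros cont_I)
    then have comp: "compact ((\<lambda>t. exp (- \<kappa> * (t - a)) *\<^sub>R (x0 + I g t)) ` {a..b})"
      and "continuous_on UNIV (T0 g)"
      using continuous_on_compose2[OF _ cont_c image_subsetI[OF c],
          of "\<lambda>t. exp (- \<kappa> * (t - a)) *\<^sub>R (x0 + I g t)"]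
      by (auto intro!: compact_continuous_image simp: T0_def)
    moreover have "range (T0 g) \<subseteq> (\<lambda>t. exp (- \<kappa> * (t - a)) *\<^sub>R (x0 + I g t)) ` {a..b}"
      using c by (auto simp: T0_def)
    then have "bounded (range (T0 g))" using compact_imp_bounded[OF comp] bounded_subset by blast
    ultimately show ?thesis by (simp add: bcontfun_def)
  qed
  define \<Phi> where "\<Phi> = (\<lambda>g. Bcontfun (T0 g))"
  have \<Phi>: "apply_bcontfun (\<Phi> g) t = T0 g t" for g t
    unfolding \<Phi>_def using T0 by (simp add: Bcontfun_inverse)
  have "dist (\<Phi> g) (\<Phi> h) \<le> (1/2) * dist g h" for g h
  proof (rule dist_bound)
    fix t
    define \<tau> where "\<tau> = c t"
    have \<tau>: "\<tau> \<in> {a..b}" "{a..\<tau>} \<subseteq> {a..b}" using c[of t] by (auto simp: \<tau>_def)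
    have int: "f g' integrable_on {a..\<tau>}" for g'
      using cont_f \<tau> continuous_on_subset integrable_continuous_real by blast
    have E: "((\<lambda>s. \<bar>K\<bar> * dist g h * exp (\<kappa> * (s - a))) has_integral
        \<bar>K\<bar> * dist g h * (exp (\<kappa> * (\<tau> - a)) / \<kappa>) - \<bar>K\<bar> * dist g h * (exp (\<kappa> * (a - a)) / \<kappa>)) {a..\<tau>}"
      using \<tau> \<kappa> by (intro fundamental_theorem_of_calculus)
        (auto intro!: derivative_eq_intros simp flip: has_real_derivative_iff_has_vector_derivative)
    have "norm (I g \<tau> - I h \<tau>) = norm (integral {a..\<tau>} (\<lambda>s. f g s - f h s))"
      unfolding I_def using int by (simp add: integral_diff)
    also have "\<dots> \<le> integral {a..\<tau>} (\<lambda>s. \<bar>K\<bar> * dist g h * exp (\<kappa> * (s - a)))"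
    proof (rule integral_norm_bound_integral)
      show "(\<lambda>s. f g s - f h s) integrable_on {a..\<tau>}" using int by (intro integrable_diff)
      show "(\<lambda>s. \<bar>K\<bar> * dist g h * exp (\<kappa> * (s - a))) integrable_on {a..\<tau>}" using E by blast
      fix s assume s: "s \<in> {a..\<tau>}"
      have "norm (f g s - f h s) \<le> K * norm (exp (\<kappa> * (s - a)) *\<^sub>R apply_bcontfun g s - exp (\<kappa> * (s - a)) *\<^sub>R apply_bcontfun h s)"
        unfolding f_def using s \<tau> by (intro lip) auto
      also have "\<dots> = K * (exp (\<kappa> * (s - a)) * dist (apply_bcontfun g s) (apply_bcontfun h s))"
        by (simp add: dist_norm flip: scaleR_diff_right)
      also have "\<dots> \<le> \<bar>K\<bar> * (exp (\<kappa> * (s - a)) * dist g h)"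
        by (intro mult_mono dist_bounded) auto
      finally show "norm (f g s - f h s) \<le> \<bar>K\<bar> * dist g h * exp (\<kappa> * (s - a))" by (simp add: mult_ac)
    qed
    also have "\<dots> = \<bar>K\<bar> / \<kappa> * dist g h * (exp (\<kappa> * (\<tau> - a)) - 1)"
      unfolding integral_unique[OF E] by (simp add: algebra_simps)
    also have "\<dots> \<le> 1/2 * dist g h * exp (\<kappa> * (\<tau> - a))"
      using \<kappa> \<tau> by (intro mult_mono) auto
    finally have *: "norm (I g \<tau> - I h \<tau>) \<le> 1/2 * dist g h * exp (\<kappa> * (\<tau> - a))" .
    have "dist (apply_bcontfun (\<Phi> g) t) (apply_bcontfun (\<Phi> h) t) = exp (- \<kappa> * (\<tau> - a)) * norm (I g \<tau> - I h \<tau>)"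
      unfolding \<Phi> T0_def \<tau>_def dist_norm by (simp flip: scaleR_diff_right)
    also have "\<dots> \<le> exp (- \<kappa> * (\<tau> - a)) * (1/2 * dist g h * exp (\<kappa> * (\<tau> - a)))"
      using * by (intro mult_left_mono) auto
    also have "\<dots> = 1/2 * dist g h" by (simp add: mult_ac flip: exp_add)
    finally show "dist (apply_bcontfun (\<Phi> g) t) (apply_bcontfun (\<Phi> h) t) \<le> 1/2 * dist g h" .
  qed
  then obtain g where g: "\<Phi> g = g"
    using banach_fix_type[of "1/2" \<Phi>] by auto
  define x where "x = (\<lambda>t. exp (\<kappa> * (t - a)) *\<^sub>R apply_bcontfun g t)"
  have x: "x t = x0 + I g t" if "t \<in> {a..b}" for t
    using \<Phi>[of g t] that by (simp add: x_def g T0_def c_id flip: exp_add)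
  have fx: "f g s = F s (x s)" for s by (simp add: f_def x_def)
  show ?thesis
  proof
    show "x a = x0" using x[of a] ab by (simp add: I_def)
    fix t assume t: "t \<in> {a..b}"
    have "((\<lambda>t. x0 + I g t) has_vector_derivative 0 + f g t) (at t within {a..b})"
      unfolding I_def using t
      by (intro has_vector_derivative_add has_vector_derivative_const integral_has_vector_derivative cont_f)
    then show "(x has_vector_derivative F t (x t)) (at t within {a..b})"
      using t x fx by (auto intro: has_vector_derivative_transform)
  qed
qed

subsection \<open>The Emden--Fowler variables and the energy\<close>

lemma powr_diff_le:
  fixes u v M p :: real
  assumes "0 \<le> u" "u \<le> v" "v \<le> M" "p > 1"
  shows "v powr p - u powr p \<le> p * M powr (p - 1) * (v - u)"
proof (cases "u = v")
  case False
  then have uv: "u < v" using assms by simp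
  have "\<exists>l z. u < z \<and> z < v \<and> DERIV (\<lambda>x. x powr p) z :> l \<and> v powr p - u powr p = (v - u) * l"
  proof (rule MVT[OF uv])
    show "continuous_on {u..v} (\<lambda>x. x powr p)"
      using assms by (intro continuous_on_powr' continuous_intros) auto
    show "(\<lambda>x. x powr p) differentiable (at x)" if "u < x" "x < v" for x
      using has_real_derivative_powr[of x p] that assms real_differentiable_def by auto
  qed
  then obtain l z where z: "u < z" "z < v" "DERIV (\<lambda>x. x powr p) z :> l" "v powr p - u powr p = (v - u) * l"
    by blast
  have "l = p * z powr (p - 1)"
    using DERIV_unique[OF z(3) has_real_derivative_powr] z assms by simp
  also have "\<dots> \<le> p * M powr (p - 1)" using z assms by (intro mult_left_mono powr_mono2) auto
  finally show ?thesis using z(4) uv by (simp add: mult.commute mult_right_mono)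
qed auto

lemma abs_powr_diff_le:
  fixes u v M p :: real
  assumes "0 \<le> u" "u \<le> M" "0 \<le> v" "v \<le> M" "p > 1"
  shows "\<bar>v powr p - u powr p\<bar> \<le> p * M powr (p - 1) * \<bar>v - u\<bar>"
proof (cases "u \<le> v")
  case True
  then show ?thesis using powr_diff_le[of u v M p] powr_mono2[of p u v] assms by auto
next
  case False
  then show ?thesis using powr_diff_le[of v u M p] powr_mono2[of p v u] assms by auto
qed

text \<open>In the variable \<open>t = ln (tanh (r / 2)) < 0\<close>, for which \<open>dt = dr / sinh r\<close>, these are
  \<open>sinh r\<close> and \<open>cosh r\<close>.\<close>

definition sh :: "real \<Rightarrow> real" where "sh t = - 1 / sinh t"
definition ch :: "real \<Rightarrow> real" where "ch t = - cosh t / sinh t"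

lemma sh_pos: "t < 0 \<Longrightarrow> sh t > 0"
  by (simp add: sh_def divide_neg_neg)

lemma ch_sq: "t < 0 \<Longrightarrow> (ch t)^2 = 1 + (sh t)^2"
  using cosh_square_eq[of t] by (simp add: ch_def sh_def power_divide field_simps)

lemma ch_pos: "t < 0 \<Longrightarrow> ch t > 0"
  by (simp add: ch_def divide_pos_neg)

lemma ch_eq: "t < 0 \<Longrightarrow> ch t = sqrt (1 + (sh t)^2)"
  using ch_sq[of t] ch_pos[of t] by (simp add: real_sqrt_unique less_imp_le)

lemma ch_ge_1: "t < 0 \<Longrightarrow> ch t \<ge> 1"
  by (simp add: ch_eq)

lemma ch_le: "t < 0 \<Longrightarrow> ch t \<le> 1 + sh t"
proof (rule power2_le_imp_le)
  assume t: "t < 0"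
  have "(1 + sh t)^2 = 1 + (sh t)^2 + 2 * sh t" by (simp add: power2_sum)
  then show "(ch t)^2 \<le> (1 + sh t)^2" using ch_sq[OF t] sh_pos[OF t] by linarith
  show "1 + sh t \<ge> 0" using sh_pos[OF t] by linarith
qed

lemma sh_mono:
  assumes "s \<le> t" "t < 0" shows "sh s \<le> sh t"
proof -
  have "sinh s \<le> sinh t" "sinh t < 0" using assms by auto
  then have "1 / (- sinh s) \<le> 1 / (- sinh t)" by (intro frac_le) auto
  then show ?thesis by (simp add: sh_def)
qed

lemma sh_deriv [derivative_intros]:
  assumes "t < 0" shows "(sh has_real_derivative sh t * ch t) (at t within X)"
proof -
  have "((\<lambda>t. - 1 / sinh t) has_real_derivative cosh t / (sinh t)^2) (at t within X)"
    using assms by (auto intro!: derivative_eq_intros simp: power2_eq_square)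
  then show ?thesis by (simp add: sh_def[abs_def] ch_def power2_eq_square)
qed

lemma ch_deriv [derivative_intros]:
  assumes "t < 0" shows "(ch has_real_derivative (sh t)^2) (at t within X)"
proof -
  have "((\<lambda>t. - cosh t / sinh t) has_real_derivative (cosh t * cosh t - sinh t * sinh t) / (sinh t)^2) (at t within X)"
    using assms by (auto intro!: derivative_eq_intros simp: power2_eq_square diff_divide_distrib)
  then show ?thesis using cosh_square_eq[of t]
    by (simp add: sh_def ch_def[abs_def] power2_eq_square)
qed

lemma sh_powr_deriv [derivative_intros]:
  assumes "t < 0" shows "((\<lambda>t. sh t powr k) has_real_derivative k * ch t * sh t powr k) (at t within X)"
proof -
  have "((\<lambda>t. sh t powr k) has_real_derivative k * sh t powr (k - 1) * (sh t * ch t)) (at t within X)"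
    using assms sh_pos[OF assms]
    by (intro DERIV_chain2[of "\<lambda>z. z powr k"] has_real_derivative_powr sh_deriv) auto
  then show ?thesis using sh_pos[OF assms] by (simp add: powr_diff mult_ac)
qed

lemma continuous_on_sh [continuous_intros]: "X \<subseteq> {..<0} \<Longrightarrow> continuous_on X sh"
  unfolding sh_def by (intro continuous_intros) auto

lemma continuous_on_ch [continuous_intros]: "X \<subseteq> {..<0} \<Longrightarrow> continuous_on X ch"
  unfolding ch_def by (intro continuous_intros) auto

lemma sh_tendsto_0: "(sh \<longlongrightarrow> 0) at_bot"
  unfolding sh_def using sinh_real_at_bot by (rule tendsto_divide_0[OF tendsto_const filterlim_at_bot_imp_at_infinity])

lemma ch_tendsto_1: "(ch \<longlongrightarrow> 1) at_bot"
proof (rule Lim_transform_eventually)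
  show "((\<lambda>t. sqrt (1 + (sh t)^2)) \<longlongrightarrow> 1) at_bot"
    using sh_tendsto_0 by (auto intro!: tendsto_eq_intros)
  show "\<forall>\<^sub>F t in at_bot. sqrt (1 + (sh t)^2) = ch t"
    using eventually_gt_at_bot[of 0] eventually_at_bot_linorder by (metis (mono_tags, lifting) ch_eq eventually_at_bot_dense)
qed

text \<open>Here \<open>2 \<nu> = N - 2\<close> and \<open>m = 2 / (p - 1)\<close>, so that \<open>m < \<nu>\<close> says that \<open>p\<close> is supercritical and
  \<open>lam_le\<close> that \<open>lam \<le> N (N - 2) / 4\<close>.  For \<open>u = sh^(- m) W\<close> the radial equation becomes the system
  \<open>W' = X\<close>, \<open>X' = rhs t W X\<close>.\<close>

locale hyperbolic_lane_emden =
  fixes \<nu> m p lam :: real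
  assumes m_pos: "0 < m" and m_less: "m < \<nu>" and p_gt: "p > 1" and mp: "m * (p - 1) = 2"
    and lam_le: "lam \<le> \<nu> * (\<nu> + 1)"
begin

text \<open>As \<open>t \<rightarrow> - \<infinity>\<close> the equation becomes
  \<open>W'' + a * W' - A * W + W powr p = 0\<close>. Its positive rest point is \<open>L\<close>,
  and \<open>Q = p * L powr (p - 1) - A\<close> is the restoring force of the linearization there.
  \<open>B\<close> is the coefficient of the non-autonomous part, and \<open>Lam\<close> the
  distance of \<open>lam\<close> to its largest admissible value.\<close>

definition "a = 2 * (\<nu> - m)"
definition "A = m * (2 * \<nu> - m)"
definition "B = m * (2 * \<nu> + 1 - m) - lam"
definition "Lam = \<nu> * (\<nu> + 1) - lam"
definition "L = A powr (1 / (p - 1))"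
definition "Q = (p - 1) * A"

lemma a_pos: "a > 0" using m_less by (simp add: a_def)
lemma A_pos: "A > 0" using m_pos m_less by (simp add: A_def)
lemma Lam_nonneg: "Lam \<ge> 0" using lam_le by (simp add: Lam_def)
lemma L_pos: "L > 0" using A_pos by (simp add: L_def)
lemma Q_pos: "Q > 0" using A_pos p_gt by (simp add: Q_def)
lemma \<nu>_pos: "\<nu> > 0" using m_pos m_less by simp

lemma L_powr: "L powr (p - 1) = A" using A_pos p_gt by (simp add: L_def powr_powr)

lemma powr_p: "w \<ge> 0 \<Longrightarrow> w powr p = w * w powr (p - 1)"
  using powr_mult_base[of w "p - 1"] by (simp add: add.commute)

lemma powr_p1: "w \<ge> 0 \<Longrightarrow> w powr (p + 1) = w^2 * w powr (p - 1)"
  using powr_mult_base[of w "p"] powr_p[of w] by (simp add: add.commute power2_eq_square)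

definition rhs :: "real \<Rightarrow> real \<Rightarrow> real \<Rightarrow> real" where
  "rhs t w x = - a * ch t * x + (A + B * (sh t)^2) * w - w powr p"

definition sol :: "real set \<Rightarrow> (real \<Rightarrow> real) \<Rightarrow> (real \<Rightarrow> real) \<Rightarrow> bool" where
  "sol I w x \<longleftrightarrow> (\<forall>t\<in>I. t < 0 \<and> w t > 0 \<and> (w has_real_derivative x t) (at t) \<and>
     (x has_real_derivative rhs t (w t) (x t)) (at t))"

text \<open>For \<open>y = sh^(\<nu> - m) W\<close> the equation has no first-order term: it reads
  \<open>y'' = (\<nu>^2 + Lam sh^2) y - sh^(- \<kappa>) y^p\<close> with \<open>\<kappa> = \<nu> (p - 1) - 2 > 0\<close>.  The following is the
  energy of this equation, and \<open>bnd\<close> the bound on \<open>W\<close> implied by its negativity.\<close>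

definition energy :: "real \<Rightarrow> real \<Rightarrow> real \<Rightarrow> real" where
  "energy t w x = sh t powr a * ((x + (\<nu> - m) * ch t * w)^2 / 2
     - (\<nu>^2 + Lam * (sh t)^2) * w^2 / 2 + w powr (p + 1) / (p + 1))"

definition bnd :: "real \<Rightarrow> real" where
  "bnd t = ((p + 1) / 2 * (\<nu>^2 + Lam * (sh t)^2)) powr (1 / (p - 1))"

lemma bnd_mono:
  assumes "s \<le> t" "t < 0" shows "bnd s \<le> bnd t"
proof -
  have "(sh s)^2 \<le> (sh t)^2"
    using sh_mono[OF assms] sh_pos[of s] assms by (intro power_mono) auto
  then have "(p + 1) / 2 * (\<nu>^2 + Lam * (sh s)^2) \<le> (p + 1) / 2 * (\<nu>^2 + Lam * (sh t)^2)"
    using Lam_nonneg p_gt by (intro mult_left_mono add_left_mono) auto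
  moreover have "0 \<le> (p + 1) / 2 * (\<nu>^2 + Lam * (sh s)^2)" using Lam_nonneg p_gt by simp
  ultimately show ?thesis unfolding bnd_def using p_gt by (intro powr_mono2) auto
qed

lemma bnd_pos: "bnd t > 0"
proof -
  have "\<nu>^2 + Lam * (sh t)^2 > 0" using \<nu>_pos Lam_nonneg by (intro add_pos_nonneg) auto
  then show ?thesis using p_gt by (simp add: bnd_def)
qed

text \<open>The negative energy divided by \<open>sh t powr a * w^2 / 2\<close>. The first square
  will control the logarithmic derivative at infinity, the second summand the size of
  \<open>w\<close>.\<close>

lemma energy_inequality:
  assumes "t < 0" "w > 0" "energy t w x < 0"
  shows "(x / w + (\<nu> - m) * ch t)^2 + 2 / (p + 1) * w powr (p - 1) < \<nu>^2 + Lam * (sh t)^2"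
proof -
  have "(x + (\<nu> - m) * ch t * w)^2 / 2 - (\<nu>^2 + Lam * (sh t)^2) * w^2 / 2 + w powr (p + 1) / (p + 1) < 0"
    using assms sh_pos[of t] unfolding energy_def by (simp add: mult_less_0_iff)
  moreover have "x + (\<nu> - m) * ch t * w = w * (x / w + (\<nu> - m) * ch t)" using assms by (simp add: field_simps)
  ultimately have *: "(w * (x / w + (\<nu> - m) * ch t))^2 / 2 - (\<nu>^2 + Lam * (sh t)^2) * w^2 / 2
      + w^2 * w powr (p - 1) / (p + 1) < 0"
    using powr_p1[of w] assms by simp
  have "w^2 * ((x / w + (\<nu> - m) * ch t)^2 + 2 / (p + 1) * w powr (p - 1)) < w^2 * (\<nu>^2 + Lam * (sh t)^2)"
  proof -
    have "w^2 * ((x / w + (\<nu> - m) * ch t)^2 + 2 / (p + 1) * w powr (p - 1))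
      = 2 * ((w * (x / w + (\<nu> - m) * ch t))^2 / 2) + 2 * (w^2 * w powr (p - 1) / (p + 1))"
      by (simp only: power_mult_distrib) (simp add: distrib_left)
    then show ?thesis using * by (simp only: mult.commute[of "w^2" "\<nu>^2 + _"])
  qed
  then show ?thesis using assms(2) by (metis mult_less_cancel_left_pos zero_less_power)
qed

lemma less_bnd:
  assumes "t < 0" "w > 0" "energy t w x < 0"
  shows "w < bnd t"
proof -
  have "2 / (p + 1) * w powr (p - 1) < \<nu>^2 + Lam * (sh t)^2"
    using energy_inequality[OF assms] by (smt (verit) zero_le_power2)
  then have "w powr (p - 1) < (p + 1) / 2 * (\<nu>^2 + Lam * (sh t)^2)"
    using p_gt by (simp add: field_simps)
  then have "(w powr (p - 1)) powr (1 / (p - 1)) < bnd t"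
    unfolding bnd_def using p_gt by (intro powr_less_mono2) auto
  then show ?thesis using p_gt assms by (simp add: powr_powr)
qed

text \<open>For \<open>y = sh powr (\<nu> - m) * W\<close> the equation is Newtonian with a
  time-dependent potential, so only the explicit time dependence contributes. The two terms come
  from \<open>Lam * sh^2\<close> and from the factor \<open>sh powr (- \<kappa>)\<close> of the
  nonlinearity; \<open>Lam \<ge> 0\<close> and \<open>m < \<nu>\<close> give them their
  signs.\<close>

lemma energy_deriv:
  assumes t: "t < 0" and w: "w t > 0" and dw: "(w has_real_derivative x t) (at t)"
    and dx: "(x has_real_derivative rhs t (w t) (x t)) (at t)"
  shows "((\<lambda>t. energy t (w t) (x t)) has_real_derivative
    - (sh t powr a * ch t * (Lam * (sh t)^2 * (w t)^2
        + (\<nu> - m) * (p - 1) / (p + 1) * (w t) powr (p + 1)))) (at t)"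
proof -
  define y where "y = (\<lambda>t. x t + (\<nu> - m) * ch t * w t)"
  define q where "q = w t powr (p - 1)"
  define V where "V = \<nu>^2 + Lam * (sh t)^2"
  have wp [simp]: "w t powr p = w t * q" "w t powr (p + 1) = (w t)^2 * q"
    using powr_p powr_p1 w by (auto simp: q_def)
  have ch2: "ch t * ch t = 1 + (sh t)^2" using ch_sq[OF t] by (simp add: power2_eq_square)
  \<comment> \<open>This rests on \<open>(\<nu> - m)^2 + A = \<nu>^2\<close> and
    \<open>(\<nu> - m)^2 + (\<nu> - m) + B = Lam\<close>.\<close>
  have dy: "(y has_real_derivative (- (\<nu> - m) * ch t * y t + V * w t - w t * q)) (at t)"
  proof -
    have "(y has_real_derivative (rhs t (w t) (x t) + (\<nu> - m) * ((sh t)^2 * w t + ch t * x t))) (at t)"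
      unfolding y_def using t by (auto intro!: derivative_eq_intros dw dx simp: algebra_simps)
    moreover have "rhs t (w t) (x t) + (\<nu> - m) * ((sh t)^2 * w t + ch t * x t)
      = - (\<nu> - m) * ch t * y t + V * w t - w t * q"
    proof -
      have "(\<nu> - m) * ch t * y t = (\<nu> - m) * ch t * x t + (\<nu> - m)^2 * (1 + (sh t)^2) * w t"
        unfolding y_def ch2[symmetric] by (simp add: power2_eq_square algebra_simps)
      then show ?thesis
        unfolding rhs_def a_def A_def B_def V_def Lam_def by (simp add: power2_eq_square algebra_simps)
    qed
    ultimately show ?thesis by simp
  qed
  have x: "x t = y t - (\<nu> - m) * ch t * w t" by (simp add: y_def)
  have D: "((\<lambda>t. energy t (w t) (x t)) has_real_derivative
     a * ch t * sh t powr a * ((y t)^2 / 2 - V * (w t)^2 / 2 + (w t)^2 * q / (p + 1))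
     + sh t powr a * (y t * (- (\<nu> - m) * ch t * y t + V * w t - w t * q)
       - (Lam * (2 * sh t * (sh t * ch t)) * (w t)^2 + V * (2 * w t * x t)) / 2 + w t * q * x t)) (at t)"
  proof -
    have en: "energy t (w t) (x t) = sh t powr a * ((y t)^2 / 2 - (\<nu>^2 + Lam * (sh t)^2) * (w t)^2 / 2
        + w t powr (p + 1) / (p + 1))" for t
      by (simp add: energy_def y_def)
    have 1: "((\<lambda>t. w t powr (p + 1)) has_real_derivative (p + 1) * (w t * q) * x t) (at t)"
      using DERIV_chain2[OF has_real_derivative_powr[OF w, of "p + 1"] dw] by simp
    have 2: "((\<lambda>t. w t powr (p + 1) / (p + 1)) has_real_derivative w t * q * x t) (at t)"
      using DERIV_cdivide[OF 1, of "p + 1"] p_gt by (simp add: mult.assoc)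
    have 3: "((\<lambda>t. \<nu>^2 + Lam * (sh t)^2) has_real_derivative Lam * (2 * sh t * (sh t * ch t))) (at t)"
      using t by (auto intro!: derivative_eq_intros)
    have 4: "((\<lambda>t. (w t)^2) has_real_derivative 2 * w t * x t) (at t)"
      using dw by (auto intro!: derivative_eq_intros)
    have 5: "((\<lambda>t. (y t)^2 / 2) has_real_derivative y t * (- (\<nu> - m) * ch t * y t + V * w t - w t * q)) (at t)"
      using dy by (auto intro!: derivative_eq_intros)
    have 6: "((\<lambda>t. (\<nu>^2 + Lam * (sh t)^2) * (w t)^2 / 2) has_real_derivative
       (Lam * (2 * sh t * (sh t * ch t)) * (w t)^2 + V * (2 * w t * x t)) / 2) (at t)"
      using DERIV_cdivide[OF DERIV_mult[OF 3 4], of 2] by (simp add: V_def add.commute mult.commute)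
    show ?thesis
      unfolding en by (rule DERIV_cong[OF DERIV_mult[OF sh_powr_deriv[OF t, of a] DERIV_add[OF DERIV_diff[OF 5 6] 2]]])
        (simp add: V_def mult.commute)
  qed
  have E: "a * ch t * ((y t)^2 / 2 - V * (w t)^2 / 2 + (w t)^2 * q / (p + 1))
     + (y t * (- (\<nu> - m) * ch t * y t + V * w t - w t * q)
       - (Lam * (2 * sh t * (sh t * ch t)) * (w t)^2 + V * (2 * w t * x t)) / 2 + w t * q * x t)
     = - (ch t * (Lam * (sh t)^2 * (w t)^2 + (\<nu> - m) * (p - 1) / (p + 1) * ((w t)^2 * q)))"
  proof -
    define k where "k = 1 / (p + 1)"
    have k: "(\<nu> - m) * (p - 1) / (p + 1) = (\<nu> - m) * (1 - 2 * k)" "(w t)^2 * q / (p + 1) = (w t)^2 * q * k"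
      using p_gt by (auto simp: k_def field_simps)
    show ?thesis unfolding k x a_def
      by (simp add: power2_eq_square algebra_simps add_divide_distrib diff_divide_distrib)
  qed
  have gen: "a * ch t * P * e + P * d = - (P * k)" if "a * ch t * e + d = - k" for P e d k
    using that by algebra
  show ?thesis
    by (rule DERIV_cong[OF D]) (use gen[OF E, of "sh t powr a"] in \<open>simp only: wp mult.assoc\<close>)
qed

lemma energy_continuous_on:
  assumes "I \<subseteq> {..<0}" "continuous_on I w" "continuous_on I x" "\<And>t. t \<in> I \<Longrightarrow> w t \<ge> 0"
  shows "continuous_on I (\<lambda>t. energy t (w t) (x t))"
proof -
  have "\<forall>t\<in>I. sh t \<noteq> 0" using sh_pos assms(1) by (force simp: subset_eq)
  then show ?thesis
    unfolding energy_def using assms p_gt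
    by (intro continuous_intros continuous_on_powr') auto
qed

text \<open>The equation and positivity are asked for on the open interval only, so that the
  estimate still reaches a time at which \<open>w\<close> might have become 0.\<close>

lemma energy_nonincreasing:
  assumes "t0 \<le> t1" "t1 < 0" and cont: "continuous_on {t0..t1} w" "continuous_on {t0..t1} x"
    and sol: "sol {t0<..<t1} w x" and nonneg: "w t0 \<ge> 0" "w t1 \<ge> 0"
  shows "energy t1 (w t1) (x t1) \<le> energy t0 (w t0) (x t0)"
proof (rule DERIV_nonpos_imp_decreasing_open[OF assms(1)])
  show "continuous_on {t0..t1} (\<lambda>t. energy t (w t) (x t))"
  proof (rule energy_continuous_on)
    show "w t \<ge> 0" if "t \<in> {t0..t1}" for t
      using that sol nonneg by (cases "t = t0 \<or> t = t1") (auto simp: sol_def less_le)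
  qed (use assms in auto)
  fix t assume "t0 < t" "t < t1"
  then have t: "t < 0" "w t > 0" "(w has_real_derivative x t) (at t)"
    "(x has_real_derivative rhs t (w t) (x t)) (at t)"
    using sol by (auto simp: sol_def)
  have "0 \<le> sh t powr a * ch t * (Lam * (sh t)^2 * (w t)^2 + (\<nu> - m) * (p - 1) / (p + 1) * w t powr (p + 1))"
    using t ch_pos[of t] Lam_nonneg m_less p_gt by (intro mult_nonneg_nonneg add_nonneg_nonneg divide_nonneg_nonneg) auto
  then show "\<exists>y. ((\<lambda>t. energy t (w t) (x t)) has_real_derivative y) (at t) \<and> y \<le> 0"
    using energy_deriv[OF t] by force
qed

text \<open>The nonlinearity is truncated at the a priori bound \<open>bnd t1\<close>, which the energy keeps the
  solution from ever reaching.\<close>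

lemma ivp_exists:
  assumes t01: "t0 < t1" "t1 < 0" and w0: "w0 > 0" and en: "energy t0 w0 x0 < 0"
  obtains w x where "w t0 = w0" "x t0 = x0" "continuous_on {t0..t1} w" "continuous_on {t0..t1} x"
    "sol {t0<..<t1} w x" "\<And>t. t \<in> {t0..t1} \<Longrightarrow> w t > 0 \<and> energy t (w t) (x t) < 0"
proof -
  \<comment> \<open>As \<open>bnd\<close> is nondecreasing, its value at \<open>t1\<close> dominates
    it on the whole interval.\<close>
  define M where "M = bnd t1"
  have M: "M > 0" by (simp add: M_def bnd_pos)
  define f where "f = (\<lambda>z. (max 0 (min M z)) powr p)"
  have f_cont: "continuous_on UNIV f"
    unfolding f_def using p_gt by (intro continuous_on_powr' continuous_intros) auto
  have f_lip: "\<bar>f z - f y\<bar> \<le> p * M powr (p - 1) * \<bar>z - y\<bar>" for z y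
  proof -
    have "\<bar>f z - f y\<bar> \<le> p * M powr (p - 1) * \<bar>max 0 (min M z) - max 0 (min M y)\<bar>"
      unfolding f_def using M p_gt by (intro abs_powr_diff_le) auto
    also have "\<dots> \<le> p * M powr (p - 1) * \<bar>z - y\<bar>" using p_gt by (intro mult_left_mono) auto
    finally show ?thesis .
  qed
  define F where "F = (\<lambda>t (u :: real \<times> real). (snd u, - a * ch t * snd u + (A + B * (sh t)^2) * fst u - f (fst u)))"
  define K where "K = 1 + a * ch t1 + \<bar>A\<bar> + \<bar>B\<bar> * (sh t1)^2 + p * M powr (p - 1)"
  obtain u where u: "u t0 = (w0, x0)"
    "\<And>t. t \<in> {t0..t1} \<Longrightarrow> (u has_vector_derivative F t (u t)) (at t within {t0..t1})"
  proof (rule picard_lindelof_lipschitz[of t0 t1 F K "(w0, x0)"])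
    have f': "continuous_on S (\<lambda>x. f (fst (snd x)))" for S :: "(real \<times> real \<times> real) set"
      by (rule continuous_on_compose2[OF f_cont]) (auto intro!: continuous_intros)
    have "continuous_on ({t0..t1} \<times> UNIV) (\<lambda>x::real \<times> real \<times> real. ch (fst x))"
         "continuous_on ({t0..t1} \<times> UNIV) (\<lambda>x::real \<times> real \<times> real. sh (fst x))"
      using t01 by (auto intro!: continuous_on_compose2[OF continuous_on_ch[of "{..<0}"]]
         continuous_on_compose2[OF continuous_on_sh[of "{..<0}"]] continuous_intros)
    then show "continuous_on ({t0..t1} \<times> UNIV) (\<lambda>(t, x). F t x)"
      unfolding F_def split_beta by (intro continuous_intros f')
    fix t and y z :: "real \<times> real" assume t: "t \<in> {t0..t1}"
    obtain y1 y2 z1 z2 where yz: "y = (y1, y2)" "z = (z1, z2)" by (cases y, cases z)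
    have n: "\<bar>y1 - z1\<bar> \<le> norm (y - z)" "\<bar>y2 - z2\<bar> \<le> norm (y - z)"
      using norm_fst_le[of "y1 - z1" "y2 - z2"] norm_snd_le[of "y2 - z2" "y1 - z1"] by (auto simp: yz)
    have c: "0 \<le> ch t" "ch t \<le> ch t1" "(sh t)^2 \<le> (sh t1)^2"
    proof -
      show "(sh t)^2 \<le> (sh t1)^2" using sh_mono[of t t1] sh_pos[of t] t t01 by (intro power_mono) auto
      then show "ch t \<le> ch t1" "0 \<le> ch t" using t t01 by (auto simp: ch_eq)
    qed
    have "norm (F t y - F t z) \<le> \<bar>y2 - z2\<bar> + \<bar>- a * ch t * (y2 - z2) + (A + B * (sh t)^2) * (y1 - z1) - (f y1 - f z1)\<bar>"
      unfolding F_def yz by (rule order_trans[OF _ norm_Pair_le[THEN order_trans]]) (auto simp: algebra_simps)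
    also have "\<bar>- a * ch t * (y2 - z2) + (A + B * (sh t)^2) * (y1 - z1) - (f y1 - f z1)\<bar>
      \<le> \<bar>- a * ch t * (y2 - z2)\<bar> + \<bar>(A + B * (sh t)^2) * (y1 - z1)\<bar> + \<bar>f y1 - f z1\<bar>" by linarith
    also have "\<bar>- a * ch t * (y2 - z2)\<bar> \<le> a * ch t1 * norm (y - z)"
      unfolding abs_mult using c n a_pos by (intro mult_mono) auto
    also have "\<bar>(A + B * (sh t)^2) * (y1 - z1)\<bar> \<le> (\<bar>A\<bar> + \<bar>B\<bar> * (sh t1)^2) * norm (y - z)"
    proof -
      have "\<bar>A + B * (sh t)^2\<bar> \<le> \<bar>A\<bar> + \<bar>B * (sh t)^2\<bar>" by (rule abs_triangle_ineq)
      also have "\<bar>B * (sh t)^2\<bar> \<le> \<bar>B\<bar> * (sh t1)^2" unfolding abs_mult using c by (intro mult_left_mono) auto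
      finally show ?thesis unfolding abs_mult using n by (intro mult_mono) auto
    qed
    also have "\<bar>f y1 - f z1\<bar> \<le> p * M powr (p - 1) * norm (y - z)"
      using f_lip[of y1 z1] n(1) p_gt by (meson mult_left_mono mult_nonneg_nonneg order_trans powr_ge_zero less_imp_le zero_less_one)
    finally show "norm (F t y - F t z) \<le> K * norm (y - z)" using n(2) by (simp add: K_def algebra_simps)
  qed (use t01 in auto)
  define w x where "w = (\<lambda>t. fst (u t))" and "x = (\<lambda>t. snd (u t))"
  have dw: "(w has_real_derivative x t) (at t within {t0..t1})"
    and dx: "(x has_real_derivative (- a * ch t * x t + (A + B * (sh t)^2) * w t - f (w t))) (at t within {t0..t1})"
    if "t \<in> {t0..t1}" for t
    using bounded_linear.has_vector_derivative[OF bounded_linear_fst u(2)[OF that]]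
      bounded_linear.has_vector_derivative[OF bounded_linear_snd u(2)[OF that]]
    by (simp_all add: F_def w_def x_def has_real_derivative_iff_has_vector_derivative)
  have cw: "continuous_on {t0..t1} w" and cx: "continuous_on {t0..t1} x"
    using dw dx DERIV_continuous unfolding continuous_on_eq_continuous_within by blast+
  have sol: "sol {t0<..<t} w x" if t: "t \<le> t1" "\<forall>s\<in>{t0..<t}. 0 < w s \<and> w s < M" for t
    unfolding sol_def
  proof (intro ballI conjI)
    fix s assume s: "s \<in> {t0<..<t}"
    then have int: "s \<in> interior {t0..t1}" using t by simp
    show "s < 0" "w s > 0" using s t t01 by auto
    show "(w has_real_derivative x s) (at s)"
      using dw[of s] s t at_within_interior[OF int] by simp
    have "f (w s) = w s powr p" using t s by (simp add: f_def less_imp_le)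
    then show "(x has_real_derivative rhs s (w s) (x s)) (at s)"
      using dx[of s] s t at_within_interior[OF int] by (simp add: rhs_def)
  qed
  have wM0: "w t0 > 0" "w t0 < M" "energy t0 (w t0) (x t0) < 0"
    using w0 en u(1) less_bnd[OF _ w0 en] bnd_mono[of t0 t1] t01 by (auto simp: w_def x_def M_def)
  have E: "energy t (w t) (x t) < 0" if t: "t0 < t" "t \<le> t1" "\<forall>s\<in>{t0..<t}. 0 < w s \<and> w s < M" "w t \<ge> 0" for t
  proof -
    have "energy t (w t) (x t) \<le> energy t0 (w t0) (x t0)"
      using t t01 sol[OF t(2,3)] less_imp_le[OF wM0(1)] cw cx by (intro energy_nonincreasing) (auto elim: continuous_on_subset)
    then show ?thesis using wM0 by simp
  qed
  have range: "0 < w t \<and> w t < M" if "t \<in> {t0..t1}" for t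
  proof -
    \<comment> \<open>An exit through \<open>M\<close> contradicts \<open>less_bnd\<close>. An exit
      through 0 is impossible because \<open>0 powr (p + 1) = 0\<close>, so that the energy there is
      \<open>sh t powr a * x^2 / 2 \<ge> 0\<close>.\<close>
    have "max (- w t) (w t - M) < 0"
    proof (rule continuous_first_exit[of t0 t1 "\<lambda>t. max (- w t) (w t - M)"])
      show "continuous_on {t0..t1} (\<lambda>t. max (- w t) (w t - M))" by (intro continuous_intros cw)
      show "max (- w t0) (w t0 - M) < 0" using wM0 by simp
      fix t assume t: "t0 < t" "t \<le> t1" and "\<forall>s\<in>{t0..<t}. max (- w s) (w s - M) < 0"
      then have before: "\<forall>s\<in>{t0..<t}. 0 < w s \<and> w s < M" by auto
      show "max (- w t) (w t - M) \<noteq> 0"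
      proof
        assume eq: "max (- w t) (w t - M) = 0"
        then have "w t \<ge> 0" by linarith
        then have e: "energy t (w t) (x t) < 0" using E t before by simp
        show False
        proof (cases "w t = 0")
          case True
          then show False using e sh_pos[of t] t01 t by (simp add: energy_def mult_less_0_iff)
        next
          case False
          then show False using less_bnd[of t "w t" "x t"] e \<open>w t \<ge> 0\<close> t t01 bnd_mono[of t t1] eq
            by (auto simp: M_def max_def split: if_splits)
        qed
      qed
    qed (use that in auto)
    then show ?thesis by simp
  qed
  show ?thesis
  proof
    show "w t0 = w0" "x t0 = x0" using u(1) by (auto simp: w_def x_def)
    show "sol {t0<..<t1} w x" using range by (intro sol) auto
    show "w t > 0 \<and> energy t (w t) (x t) < 0" if "t \<in> {t0..t1}" for t
      using range[OF that] E[of t] wM0 that range by (cases "t = t0") (auto simp: less_le)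
  qed (rule cw cx)+
qed

subsection \<open>The Lyapunov function near the singularity\<close>

text \<open>The function \<open>z powr p - p * A * z\<close> has derivative
  \<open>p * (z powr (p - 1) - A)\<close>, which vanishes at \<open>L\<close> and hence is of order
  \<open>\<rho>\<close> on the \<open>\<rho>\<close>-ball around it. The form with two points is
  what a difference of two solutions needs.\<close>

lemma powr_linearization:
  obtains K where "K > 0"
    "\<And>\<rho> u v. \<rho> \<le> L / 2 \<Longrightarrow> \<bar>u - L\<bar> \<le> \<rho> \<Longrightarrow> \<bar>v - L\<bar> \<le> \<rho> \<Longrightarrow>
       \<bar>u powr p - v powr p - p * A * (u - v)\<bar> \<le> K * \<rho> * \<bar>u - v\<bar>"
proof -
  define I where "I = {L / 2..3 * L / 2}"
  have I: "z > 0" if "z \<in> I" for z using that L_pos by (auto simp: I_def)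
  have "continuous_on I (\<lambda>z. (p - 1) * z powr (p - 1 - 1))"
    using I by (intro continuous_intros) force
  then have "compact ((\<lambda>z. (p - 1) * z powr (p - 1 - 1)) ` I)"
    by (rule compact_continuous_image) (simp add: I_def)
  then obtain k where k: "k > 0" "\<And>z. z \<in> I \<Longrightarrow> \<bar>(p - 1) * z powr (p - 1 - 1)\<bar> \<le> k"
    using bounded_pos[of "(\<lambda>z. (p - 1) * z powr (p - 1 - 1)) ` I"] compact_imp_bounded by auto
  have inner: "\<bar>z powr (p - 1) - A\<bar> \<le> k * \<bar>z - L\<bar>" if z: "z \<in> I" for z
  proof -
    have "norm (z powr (p - 1) - L powr (p - 1)) \<le> k * norm (z - L)"
    proof (rule field_differentiable_bound[of I "\<lambda>z. z powr (p - 1)" "\<lambda>z. (p - 1) * z powr (p - 1 - 1)"])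
      show "((\<lambda>z. z powr (p - 1)) has_field_derivative (p - 1) * z powr (p - 1 - 1)) (at z within I)"
        if "z \<in> I" for z
        using has_real_derivative_powr[OF I[OF that]] by (rule has_field_derivative_at_within)
      show "norm ((p - 1) * z powr (p - 1 - 1)) \<le> k" if "z \<in> I" for z
        using k(2)[OF that] by simp
    qed (use z L_pos in \<open>auto simp: I_def\<close>)
    then show ?thesis by (simp add: L_powr)
  qed
  show ?thesis
  proof
    show "p * k > 0" using k p_gt by simp
    fix \<rho> u v :: real assume \<rho>: "\<rho> \<le> L / 2" and u: "\<bar>u - L\<bar> \<le> \<rho>" and v: "\<bar>v - L\<bar> \<le> \<rho>"
    have sub: "z \<in> I" if "z \<in> {L - \<rho>..L + \<rho>}" for z using that \<rho> by (auto simp: I_def)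
    have "norm ((u powr p - p * A * u) - (v powr p - p * A * v)) \<le> p * k * \<rho> * norm (u - v)"
    proof (rule field_differentiable_bound[of "{L - \<rho>..L + \<rho>}" "\<lambda>z. z powr p - p * A * z"
          "\<lambda>z. p * (z powr (p - 1) - A)"])
      fix z assume z: "z \<in> {L - \<rho>..L + \<rho>}"
      have "((\<lambda>z. z powr p - p * A * z) has_real_derivative p * z powr (p - 1) - p * A) (at z)"
        using I[OF sub[OF z]] by (auto intro!: derivative_eq_intros)
      then show "((\<lambda>z. z powr p - p * A * z) has_field_derivative p * (z powr (p - 1) - A)) (at z within {L - \<rho>..L + \<rho>})"
        by (simp add: right_diff_distrib has_field_derivative_at_within)
      have "\<bar>z powr (p - 1) - A\<bar> \<le> k * \<bar>z - L\<bar>" using inner sub z by blast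
      also have "\<dots> \<le> k * \<rho>" using z k by (intro mult_left_mono) auto
      finally show "norm (p * (z powr (p - 1) - A)) \<le> p * k * \<rho>" using p_gt by (simp add: abs_mult)
    qed (use u v in auto)
    then show "\<bar>u powr p - v powr p - p * A * (u - v)\<bar> \<le> p * k * \<rho> * \<bar>u - v\<bar>"
      by (simp add: algebra_simps)
  qed
qed

text \<open>\<open>V\<close> is the energy of the linearization \<open>d'' + a d' + Q d = 0\<close> at \<open>L\<close>; the cross term with the
  small factor \<open>\<sigma>\<close> makes it a strict Lyapunov function.\<close>

definition "\<sigma> = min (sqrt Q / 2) (a / (4 * (1 + 4 * a^2 / Q)))"
definition "\<eta> = min (a / 4) (\<sigma> * Q / (4 + 8 * \<sigma>))"
definition "\<delta> = min a \<sigma> / 2"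
definition "K\<^sub>V = 2 / a + 2 * \<sigma> / Q"
definition "V d x = x^2 / 2 + Q * d^2 / 2 + \<sigma> * d * x" for d x :: real

lemma \<sigma>_pos: "\<sigma> > 0" using Q_pos a_pos by (simp add: \<sigma>_def add_pos_pos)
lemma \<eta>_pos: "\<eta> > 0" using Q_pos a_pos \<sigma>_pos by (simp add: \<eta>_def)
lemma \<delta>_pos: "\<delta> > 0" using a_pos \<sigma>_pos by (simp add: \<delta>_def)
lemma KV_pos: "K\<^sub>V > 0" using Q_pos a_pos \<sigma>_pos by (simp add: K\<^sub>V_def add_pos_pos)

text \<open>By \<open>\<sigma> \<le> sqrt Q / 2\<close> the cross term takes at most half of the
  diagonal part of \<open>V\<close>, which makes \<open>V\<close> comparable to
  \<open>x^2 + Q * d^2\<close>.\<close>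

lemma \<sigma>_cross: "\<bar>\<sigma> * d * x\<bar> \<le> (x^2 + Q * d^2) / 4"
proof -
  have "2 * (2 * \<sigma>) * \<bar>d * x\<bar> \<le> 2 * sqrt Q * \<bar>d * x\<bar>"
    by (intro mult_right_mono) (auto simp: \<sigma>_def)
  also have "\<dots> = 2 * (sqrt Q * \<bar>d\<bar>) * \<bar>x\<bar>" by (simp add: abs_mult)
  also have "\<dots> \<le> (sqrt Q * \<bar>d\<bar>)^2 + \<bar>x\<bar>^2" by (rule sum_squares_bound)
  also have "\<dots> = x^2 + Q * d^2" using Q_pos by (simp add: power_mult_distrib)
  finally show ?thesis using \<sigma>_pos by (simp add: abs_mult mult.assoc)
qed

lemma V_lower: "V d x \<ge> (x^2 + Q * d^2) / 4"
  using abs_le_D2[OF \<sigma>_cross[of d x]] unfolding V_def by (simp add: field_simps)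

lemma V_upper: "V d x \<le> x^2 + Q * d^2"
proof -
  have "x^2 + Q * d^2 \<ge> 0" using Q_pos by simp
  then show ?thesis using abs_le_D1[OF \<sigma>_cross[of d x]] unfolding V_def by (simp add: field_simps)
qed

lemma V_nonneg: "V d x \<ge> 0"
  by (rule order_trans[OF _ V_lower]) (simp add: Q_pos less_imp_le)

text \<open>The left side is the derivative of \<open>V\<close> along \<open>d' = x\<close>,
  \<open>x' = - a * c * x - Q * d + r\<close>. Two budgets are spent exactly. Of
  \<open>a * x^2\<close>, a quarter goes to the cross terms (the second entry of the minimum in
  \<open>\<sigma>\<close>), an eighth to \<open>e\<close>, an eighth to \<open>\<eta>\<close>, and
  half to \<open>\<delta> * V\<close>; of \<open>\<sigma> * Q * d^2\<close>, the same fractions in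
  the same order. The entries of \<open>\<eta>\<close> and \<open>\<delta>\<close> are read off from
  these shares, and \<open>K\<^sub>V\<close> collects the factors of \<open>e^2\<close>.\<close>

lemma V_dissipation:
  assumes c: "1 \<le> c" "c \<le> 2" and err: "\<bar>r\<bar> \<le> \<eta> * \<bar>d\<bar> + e"
  shows "x * (- a * c * x - Q * d + r) + Q * d * x + \<sigma> * (x * x + d * (- a * c * x - Q * d + r))
    \<le> - \<delta> * V d x + K\<^sub>V * e^2"
proof -
  note pos = a_pos Q_pos \<sigma>_pos \<eta>_pos \<delta>_pos
  have 1: "- (a * c * x^2) \<le> - (a * x^2)" using c pos by (simp add: mult_right_mono)
  have 2: "- (\<sigma> * a * c * d * x) \<le> \<sigma> * Q / 4 * d^2 + (a / 4 - \<sigma>) * x^2"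
  proof -
    have "- (a * c * d * x) \<le> a * c * \<bar>d * x\<bar>" using pos c
      by (smt (verit) mult.assoc mult_left_mono mult_minus_right mult_nonneg_nonneg abs_ge_minus_self)
    also have "\<dots> \<le> a * 2 * \<bar>d * x\<bar>" using pos c by (intro mult_right_mono mult_left_mono) auto
    also have "\<dots> = 2 * ((sqrt Q / 2) * \<bar>d\<bar>) * ((2 * a / sqrt Q) * \<bar>x\<bar>)" using pos by (simp add: abs_mult)
    also have "\<dots> \<le> ((sqrt Q / 2) * \<bar>d\<bar>)^2 + ((2 * a / sqrt Q) * \<bar>x\<bar>)^2" by (rule sum_squares_bound)
    also have "\<dots> = Q / 4 * d^2 + 4 * a^2 / Q * x^2" using pos by (simp add: power_mult_distrib power_divide)
    finally have "\<sigma> * (- (a * c * d * x)) \<le> \<sigma> * (Q / 4 * d^2 + 4 * a^2 / Q * x^2)" using pos by (intro mult_left_mono) auto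
    moreover have "\<sigma> * (4 * a^2 / Q) \<le> a / 4 - \<sigma>"
    proof -
      have mult_divide_cancel: "a / (4 * k) * k = a / 4" if "k > 0" for k using that by simp
      have h: "1 + 4 * a^2 / Q > 0" using pos by (intro add_pos_nonneg) auto
      have "\<sigma> \<le> a / (4 * (1 + 4 * a^2 / Q))" by (simp add: \<sigma>_def)
      then have "\<sigma> * (1 + 4 * a^2 / Q) \<le> a / (4 * (1 + 4 * a^2 / Q)) * (1 + 4 * a^2 / Q)"
        using h by (intro mult_right_mono) auto
      also have "\<dots> = a / 4" using h mult_divide_cancel[of "1 + 4 * a^2 / Q"] by blast
      finally show ?thesis by (simp add: distrib_left)
    qed
    then have "\<sigma> * (4 * a^2 / Q) * x^2 \<le> (a / 4 - \<sigma>) * x^2" by (rule mult_right_mono) simp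
    ultimately show ?thesis by (simp add: distrib_left mult.assoc)
  qed
  have 3: "x * r + \<sigma> * d * r \<le> (\<bar>x\<bar> + \<sigma> * \<bar>d\<bar>) * (\<eta> * \<bar>d\<bar> + e)"
  proof -
    have "x * r + \<sigma> * d * r = (x + \<sigma> * d) * r" by (simp add: distrib_right)
    also have "\<dots> \<le> \<bar>x + \<sigma> * d\<bar> * \<bar>r\<bar>" by (metis abs_ge_self abs_mult)
    also have "\<dots> \<le> (\<bar>x\<bar> + \<sigma> * \<bar>d\<bar>) * (\<eta> * \<bar>d\<bar> + e)"
      using err pos abs_triangle_ineq[of x "\<sigma> * d"] by (intro mult_mono) (auto simp: abs_mult)
    finally show ?thesis .
  qed
  have 4: "\<bar>x\<bar> * e \<le> a / 8 * x^2 + 2 / a * e^2"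
  proof -
    have "2 * ((sqrt a / 2) * \<bar>x\<bar> / sqrt 2) * (sqrt 2 * e / sqrt a) \<le> ((sqrt a / 2) * \<bar>x\<bar> / sqrt 2)^2 + (sqrt 2 * e / sqrt a)^2"
      by (rule sum_squares_bound)
    then show ?thesis using pos by (simp add: power_mult_distrib power_divide)
  qed
  have 5: "\<bar>d\<bar> * e \<le> Q / 8 * d^2 + 2 / Q * e^2"
  proof -
    have "2 * ((sqrt Q / 2) * \<bar>d\<bar> / sqrt 2) * (sqrt 2 * e / sqrt Q) \<le> ((sqrt Q / 2) * \<bar>d\<bar> / sqrt 2)^2 + (sqrt 2 * e / sqrt Q)^2"
      by (rule sum_squares_bound)
    then show ?thesis using pos by (simp add: power_mult_distrib power_divide)
  qed
  have 6: "\<eta> * (\<bar>x\<bar> * \<bar>d\<bar>) + \<sigma> * \<eta> * d^2 \<le> a / 8 * x^2 + \<sigma> * Q / 8 * d^2"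
  proof -
    have "2 * \<bar>x\<bar> * \<bar>d\<bar> \<le> \<bar>x\<bar>^2 + \<bar>d\<bar>^2" by (rule sum_squares_bound)
    then have "\<eta> * (\<bar>x\<bar> * \<bar>d\<bar>) \<le> \<eta> * (x^2 / 2 + d^2 / 2)" using pos by (intro mult_left_mono) auto
    moreover have "\<eta> / 2 * x^2 \<le> a / 8 * x^2" by (intro mult_right_mono) (auto simp: \<eta>_def)
    moreover have "(\<eta> / 2 + \<sigma> * \<eta>) * d^2 \<le> \<sigma> * Q / 8 * d^2"
    proof (intro mult_right_mono)
      have "\<eta> * (4 + 8 * \<sigma>) \<le> \<sigma> * Q / (4 + 8 * \<sigma>) * (4 + 8 * \<sigma>)"
        using pos by (intro mult_right_mono) (auto simp: \<eta>_def)
      also have "\<dots> = \<sigma> * Q" using pos by simp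
      finally show "\<eta> / 2 + \<sigma> * \<eta> \<le> \<sigma> * Q / 8" by (simp add: algebra_simps)
    qed simp
    ultimately show ?thesis by (simp add: algebra_simps)
  qed
  have 7: "\<delta> * V d x \<le> a / 2 * x^2 + \<sigma> * Q / 2 * d^2"
  proof -
    have "\<delta> * V d x \<le> \<delta> * (x^2 + Q * d^2)" using V_upper pos by (intro mult_left_mono) auto
    also have "\<dots> = \<delta> * x^2 + \<delta> * (Q * d^2)" by (simp add: distrib_left)
    also have "\<dots> \<le> a / 2 * x^2 + \<sigma> / 2 * (Q * d^2)"
      using pos by (intro add_mono mult_right_mono) (auto simp: \<delta>_def)
    finally show ?thesis by simp
  qed
  have 8: "(\<bar>x\<bar> + \<sigma> * \<bar>d\<bar>) * (\<eta> * \<bar>d\<bar> + e)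
    = \<eta> * (\<bar>x\<bar> * \<bar>d\<bar>) + \<sigma> * \<eta> * d^2 + \<bar>x\<bar> * e + \<sigma> * (\<bar>d\<bar> * e)"
    by (simp add: algebra_simps power2_eq_square)
  have 9: "\<sigma> * (\<bar>d\<bar> * e) \<le> \<sigma> * (Q / 8 * d^2 + 2 / Q * e^2)" using 5 pos by (intro mult_left_mono) auto
  have 10: "\<sigma> * (Q / 8 * d^2 + 2 / Q * e^2) = \<sigma> * Q / 8 * d^2 + 2 * \<sigma> / Q * e^2" by (simp add: distrib_left)
  have 11: "K\<^sub>V * e^2 = 2 / a * e^2 + 2 * \<sigma> / Q * e^2" by (simp add: K\<^sub>V_def distrib_right)
  have 12: "x * (- a * c * x - Q * d + r) + Q * d * x + \<sigma> * (x * x + d * (- a * c * x - Q * d + r))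
     = - (a * c * x^2) + - (\<sigma> * a * c * d * x) + (x * r + \<sigma> * d * r) + \<sigma> * x^2 - \<sigma> * Q * d^2"
    by (simp add: algebra_simps power2_eq_square)
  have 13: "(a / 4 - \<sigma>) * x^2 = a / 4 * x^2 - \<sigma> * x^2" by (simp add: left_diff_distrib)
  have 14: "a / 8 * x^2 = a * x^2 / 8" "a / 4 * x^2 = a * x^2 / 4" "a / 2 * x^2 = a * x^2 / 2"
    "\<sigma> * Q / 8 * d^2 = \<sigma> * Q * d^2 / 8" "\<sigma> * Q / 4 * d^2 = \<sigma> * Q * d^2 / 4" "\<sigma> * Q / 2 * d^2 = \<sigma> * Q * d^2 / 2"
    by simp_all
  have 15: "- \<delta> * V d x = - (\<delta> * V d x)" by simp
  show ?thesis unfolding 12 11 15 using 1 2[unfolded 13 14] 3[unfolded 8] 4[unfolded 14] 9[unfolded 10 14] 6[unfolded 14] 7[unfolded 14] by argo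
qed

lemma V_deriv:
  assumes "(f has_real_derivative f') (at t)" "(g has_real_derivative g') (at t)"
  shows "((\<lambda>t. V (f t) (g t)) has_real_derivative
    g t * g' + Q * f t * f' + \<sigma> * (f' * g t + f t * g')) (at t)"
  unfolding V_def using assms by (auto intro!: derivative_eq_intros simp: algebra_simps)

text \<open>The second function may solve the equation up to a residual \<open>r\<close>. With
  \<open>r = 0\<close> this compares two solutions, for convergence and uniqueness; with the
  residual of \<open>wapp\<close> it compares a solution with the expansion.\<close>

lemma lyapunov_local:
  obtains \<rho> T where "0 < \<rho>" "\<rho> \<le> L / 2" "T < 0"
    "\<And>t w1 x1 w2 x2 r e. t \<le> T \<Longrightarrow> \<bar>w1 t - L\<bar> \<le> \<rho> \<Longrightarrow> \<bar>w2 t - L\<bar> \<le> \<rho> \<Longrightarrow>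
      (w1 has_real_derivative x1 t) (at t) \<Longrightarrow> (x1 has_real_derivative rhs t (w1 t) (x1 t)) (at t) \<Longrightarrow>
      (w2 has_real_derivative x2 t) (at t) \<Longrightarrow> (x2 has_real_derivative rhs t (w2 t) (x2 t) + r) (at t) \<Longrightarrow>
      \<bar>r\<bar> \<le> e \<Longrightarrow>
      \<exists>y. ((\<lambda>t. V (w1 t - w2 t) (x1 t - x2 t)) has_real_derivative y) (at t) \<and>
        y \<le> - \<delta> * V (w1 t - w2 t) (x1 t - x2 t) + K\<^sub>V * e^2"
proof -
  obtain K where K: "K > 0"
    "\<And>\<rho> u v. \<rho> \<le> L / 2 \<Longrightarrow> \<bar>u - L\<bar> \<le> \<rho> \<Longrightarrow> \<bar>v - L\<bar> \<le> \<rho> \<Longrightarrow>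
       \<bar>u powr p - v powr p - p * A * (u - v)\<bar> \<le> K * \<rho> * \<bar>u - v\<bar>"
    using powr_linearization by blast
  \<comment> \<open>Half of the tolerance \<open>\<eta>\<close> of \<open>V_dissipation\<close> is
    reserved for the nonlinearity, the other half for \<open>B * sh^2\<close>, which is made small
    by the choice of \<open>T\<close>.\<close>
  define \<rho> where "\<rho> = min (L / 2) (\<eta> / (2 * K))"
  have \<rho>: "\<rho> > 0" "\<rho> \<le> L / 2" "K * \<rho> \<le> \<eta> / 2"
    using K(1) L_pos \<eta>_pos mult_left_mono[of \<rho> "\<eta> / (2 * K)" K] by (auto simp: \<rho>_def)
  have "((\<lambda>t. \<bar>B\<bar> * (sh t)^2) \<longlongrightarrow> \<bar>B\<bar> * 0^2) at_bot" by (intro tendsto_intros sh_tendsto_0)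
  then have "\<forall>\<^sub>F t in at_bot. \<bar>B\<bar> * (sh t)^2 < \<eta> / 2"
    using \<eta>_pos by (intro order_tendstoD(2)) auto
  moreover have "\<forall>\<^sub>F t in at_bot. ch t < 2" using ch_tendsto_1 by (intro order_tendstoD(2)) auto
  ultimately have "\<forall>\<^sub>F t in at_bot. \<bar>B\<bar> * (sh t)^2 < \<eta> / 2 \<and> ch t < 2 \<and> t < 0"
    using eventually_gt_at_bot[of "0::real"] eventually_at_bot_dense by (intro eventually_conj) (auto simp: eventually_at_bot_dense)
  then obtain T where T: "\<And>t. t \<le> T \<Longrightarrow> \<bar>B\<bar> * (sh t)^2 < \<eta> / 2 \<and> ch t < 2 \<and> t < 0"
    unfolding eventually_at_bot_linorder by blast
  show ?thesis
  proof
    show "0 < \<rho>" "\<rho> \<le> L / 2" "T < 0" using \<rho> T[of T] by auto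
    fix t w1 x1 w2 x2 and r e :: real
    assume t: "t \<le> T" and w: "\<bar>w1 t - L\<bar> \<le> \<rho>" "\<bar>w2 t - L\<bar> \<le> \<rho>"
      and d: "(w1 has_real_derivative x1 t) (at t)" "(x1 has_real_derivative rhs t (w1 t) (x1 t)) (at t)"
        "(w2 has_real_derivative x2 t) (at t)" "(x2 has_real_derivative rhs t (w2 t) (x2 t) + r) (at t)"
      and r: "\<bar>r\<bar> \<le> e"
    define d x where "d = w1 t - w2 t" and "x = x1 t - x2 t"
    define g where "g = B * (sh t)^2 * d - (w1 t powr p - w2 t powr p - p * A * d) - r"
    have "\<bar>g\<bar> \<le> \<bar>B * (sh t)^2 * d\<bar> + \<bar>w1 t powr p - w2 t powr p - p * A * d\<bar> + \<bar>r\<bar>"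
      unfolding g_def by linarith
    also have "\<bar>B * (sh t)^2 * d\<bar> \<le> \<eta> / 2 * \<bar>d\<bar>"
      unfolding abs_mult using T[OF t] by (intro mult_right_mono) auto
    also have "\<bar>w1 t powr p - w2 t powr p - p * A * d\<bar> \<le> K * \<rho> * \<bar>d\<bar>"
      unfolding d_def using K(2) \<rho> w by blast
    also have "K * \<rho> * \<bar>d\<bar> \<le> \<eta> / 2 * \<bar>d\<bar>" using \<rho> by (intro mult_right_mono) auto
    finally have g: "\<bar>g\<bar> \<le> \<eta> * \<bar>d\<bar> + e" using r by linarith
    have x': "rhs t (w1 t) (x1 t) - (rhs t (w2 t) (x2 t) + r) = - a * ch t * x - Q * d + g"
      unfolding rhs_def g_def x_def d_def Q_def by (simp add: algebra_simps)
    have 1: "((\<lambda>t. w1 t - w2 t) has_real_derivative x) (at t)"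
      unfolding x_def by (intro DERIV_diff d)
    have 2: "((\<lambda>t. x1 t - x2 t) has_real_derivative - a * ch t * x - Q * d + g) (at t)"
      unfolding x'[symmetric] by (intro DERIV_diff d)
    have "((\<lambda>t. V (w1 t - w2 t) (x1 t - x2 t)) has_real_derivative
       x * (- a * ch t * x - Q * d + g) + Q * d * x + \<sigma> * (x * x + d * (- a * ch t * x - Q * d + g))) (at t)"
      using V_deriv[OF 1 2] by (simp add: d_def x_def)
    then show "\<exists>y. ((\<lambda>t. V (w1 t - w2 t) (x1 t - x2 t)) has_real_derivative y) (at t) \<and>
        y \<le> - \<delta> * V (w1 t - w2 t) (x1 t - x2 t) + K\<^sub>V * e^2"
      using V_dissipation[OF _ _ g, of "ch t" x] ch_ge_1[of t] T[OF t]
      by (intro exI conjI) (auto simp: d_def x_def)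
  qed
qed

text \<open>The coefficient \<open>c2\<close> cancels the residual of order \<open>sh^2\<close> of \<open>wapp\<close>.\<close>

definition "c2 = B * L / (8 * \<nu> - 6 * m + 4)"
definition "wapp t = L + c2 * (sh t)^2"
definition "xapp t = 2 * c2 * (sh t)^2 * ch t"

text \<open>On a term that behaves like \<open>exp (2 * t)\<close>, the second derivative, the
  damping and the linearized force act with the factors \<open>4\<close>, \<open>2 * a\<close> and
  \<open>Q\<close>; \<open>B * L\<close> is the source of that order.\<close>

lemma c2_eq: "c2 * (4 + 2 * a + Q) = B * L"
proof -
  have "Q = m * (p - 1) * (2 * \<nu> - m)" by (simp add: Q_def A_def)
  then have D: "4 + 2 * a + Q = 8 * \<nu> - 6 * m + 4" by (simp add: mp a_def)
  moreover have "8 * \<nu> - 6 * m + 4 > 0" using m_less m_pos by simp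
  ultimately show ?thesis unfolding D c2_def by simp
qed

lemma wapp_deriv: "t < 0 \<Longrightarrow> (wapp has_real_derivative xapp t) (at t)"
  unfolding wapp_def[abs_def] xapp_def by (auto intro!: derivative_eq_intros simp: power2_eq_square)

lemma xapp_deriv:
  assumes "t < 0"
  shows "(xapp has_real_derivative 2 * c2 * (2 * (sh t)^2 * (ch t)^2 + (sh t)^4)) (at t)"
  unfolding xapp_def[abs_def] using assms
  by (auto intro!: derivative_eq_intros simp: power2_eq_square power4_eq_xxxx algebra_simps)

lemma sh_power_tendsto_0: "n > 0 \<Longrightarrow> ((\<lambda>t. k * (sh t)^n) \<longlongrightarrow> 0) at_bot"
  using tendsto_mult[OF tendsto_const[of k] tendsto_power[OF sh_tendsto_0, of n]] by (simp add: power_0_left)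

lemma wapp_tendsto: "(wapp \<longlongrightarrow> L) at_bot"
  using tendsto_add[OF tendsto_const[of L] sh_power_tendsto_0[of 2 c2]] by (simp add: wapp_def[abs_def])

lemma xapp_tendsto: "(xapp \<longlongrightarrow> 0) at_bot"
  using tendsto_mult[OF sh_power_tendsto_0[of 2 "2 * c2"] ch_tendsto_1] by (simp add: xapp_def[abs_def])

lemma eventually_at_bot_neg: "\<forall>\<^sub>F t in at_bot. t < (0::real)"
  by (auto simp: eventually_at_bot_dense)

lemma wapp_residual:
  obtains C T where "C > 0" "T < 0"
    "\<And>t. t \<le> T \<Longrightarrow> \<exists>r. \<bar>r\<bar> \<le> C * (sh t)^4 \<and> (xapp has_real_derivative rhs t (wapp t) (xapp t) + r) (at t)"
proof -
  obtain K where K: "K > 0"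
    "\<And>\<rho> u v. \<rho> \<le> L / 2 \<Longrightarrow> \<bar>u - L\<bar> \<le> \<rho> \<Longrightarrow> \<bar>v - L\<bar> \<le> \<rho> \<Longrightarrow>
       \<bar>u powr p - v powr p - p * A * (u - v)\<bar> \<le> K * \<rho> * \<bar>u - v\<bar>"
    using powr_linearization by blast
  have "\<forall>\<^sub>F t in at_bot. \<bar>c2\<bar> * (sh t)^2 < L / 2"
    using sh_power_tendsto_0[of 2 "\<bar>c2\<bar>"] L_pos by (intro order_tendstoD(2)) auto
  with eventually_at_bot_neg have "\<forall>\<^sub>F t in at_bot. \<bar>c2\<bar> * (sh t)^2 < L / 2 \<and> t < 0" by eventually_elim auto
  then obtain T where T: "\<And>t. t \<le> T \<Longrightarrow> \<bar>c2\<bar> * (sh t)^2 < L / 2 \<and> t < 0"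
    unfolding eventually_at_bot_linorder by blast
  \<comment> \<open>The coefficient of \<open>s^4\<close> in the residual, plus the linearization
    error at distance \<open>\<bar>c2\<bar> * s^2\<close> from \<open>L\<close>; the summand 1 makes
    \<open>C\<close> positive.\<close>
  define C where "C = \<bar>6 * c2 + 2 * a * c2 - B * c2\<bar> + K * c2^2 + 1"
  show ?thesis
  proof
    show "C > 0" "T < 0" using T[of T] K by (auto simp: C_def add_nonneg_pos)
    fix t assume t: "t \<le> T"
    then have t0: "t < 0" using T by simp
    define s where "s = sh t"
    define r where "r = 2 * c2 * (2 * (sh t)^2 * (ch t)^2 + (sh t)^4) - rhs t (wapp t) (xapp t)"
    define R where "R = wapp t powr p - L powr p - p * A * (wapp t - L)"
    have R: "\<bar>R\<bar> \<le> K * c2^2 * s^4"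
    proof -
      have "\<bar>R\<bar> \<le> K * (\<bar>c2\<bar> * (sh t)^2) * \<bar>wapp t - L\<bar>"
        unfolding R_def using T[OF t] L_pos by (intro K(2)) (auto simp: wapp_def abs_mult)
      also have "\<dots> = K * c2^2 * s^4"
        by (simp add: wapp_def abs_mult s_def power2_eq_square power4_eq_xxxx)
      finally show ?thesis .
    qed
    have "r = s^2 * (c2 * (4 + 2 * a + Q) - B * L) + (6 * c2 + 2 * a * c2 - B * c2) * s^4 + R"
    proof -
      have Lp: "L powr p = A * L" using powr_p[of L] L_pos L_powr by simp
      have c: "(ch t)^2 = 1 + s^2" using ch_sq[OF t0] by (simp add: s_def)
      have x: "- a * ch t * xapp t = - (2 * a * c2 * s^2 * (1 + s^2))"
        unfolding c[symmetric] by (simp add: xapp_def s_def power2_eq_square)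
      show ?thesis
        unfolding r_def rhs_def x R_def wapp_def Lp Q_def c
        by (simp add: s_def[symmetric] power2_eq_square power4_eq_xxxx algebra_simps)
    qed
    then have "r = (6 * c2 + 2 * a * c2 - B * c2) * s^4 + R" using c2_eq by simp
    then have "\<bar>r\<bar> \<le> \<bar>(6 * c2 + 2 * a * c2 - B * c2) * s^4\<bar> + K * c2^2 * s^4"
      using R by linarith
    also have "\<dots> \<le> C * s^4" unfolding abs_mult C_def distrib_right by simp
    finally show "\<exists>r. \<bar>r\<bar> \<le> C * (sh t)^4 \<and> (xapp has_real_derivative rhs t (wapp t) (xapp t) + r) (at t)"
      using xapp_deriv[OF t0] by (intro exI[of _ r]) (simp add: s_def r_def)
  qed
qed

text \<open>The energy itself tends to 0 with \<open>sh powr a\<close>, so the sign must come from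
  the bracket. By \<open>(\<nu> - m)^2 = \<nu>^2 - A\<close> its limit is
  \<open>L^2 * A * (1 / (p + 1) - 1 / 2) < 0\<close>.\<close>

lemma wapp_energy: "\<forall>\<^sub>F t in at_bot. energy t (wapp t) (xapp t) < 0"
proof -
  let ?e = "\<lambda>t. (xapp t + (\<nu> - m) * ch t * wapp t)^2 / 2 - (\<nu>^2 + Lam * (sh t)^2) * (wapp t)^2 / 2
      + wapp t powr (p + 1) / (p + 1)"
  have "(?e \<longlongrightarrow> (0 + (\<nu> - m) * 1 * L)^2 / 2 - (\<nu>^2 + 0) * L^2 / 2 + L powr (p + 1) / (p + 1)) at_bot"
    using L_pos p_gt by (intro tendsto_intros wapp_tendsto xapp_tendsto ch_tendsto_1 sh_power_tendsto_0) auto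
  moreover have "(0 + (\<nu> - m) * 1 * L)^2 / 2 - (\<nu>^2 + 0) * L^2 / 2 + L powr (p + 1) / (p + 1) < 0"
  proof -
    have "L powr (p + 1) = L^2 * A" using powr_p1[of L] L_pos L_powr by simp
    moreover have "(\<nu> - m)^2 = \<nu>^2 - A" by (simp add: A_def power2_eq_square algebra_simps)
    then have "(0 + (\<nu> - m) * 1 * L)^2 = (\<nu>^2 - A) * L^2" by (simp add: power_mult_distrib)
    ultimately have "(0 + (\<nu> - m) * 1 * L)^2 / 2 - (\<nu>^2 + 0) * L^2 / 2 + L powr (p + 1) / (p + 1)
       = L^2 * A * (1 / (p + 1) - 1 / 2)"
      by (simp add: algebra_simps diff_divide_distrib)
    also have "1 / (p + 1) - 1 / 2 < 0" using p_gt by (simp add: field_simps)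
    then have "L^2 * A * (1 / (p + 1) - 1 / 2) < 0" using L_pos A_pos by (intro mult_pos_neg) auto
    finally show ?thesis .
  qed
  ultimately have "\<forall>\<^sub>F t in at_bot. ?e t < 0" by (rule order_tendstoD(2))
  with eventually_at_bot_neg show ?thesis
    by eventually_elim (unfold energy_def, intro mult_pos_neg, auto dest: sh_pos)
qed

subsection \<open>Existence of the singular profile\<close>

text \<open>The solutions start exactly on the expansion at \<open>t0\<close>. The constants
  \<open>C\<close>, \<open>\<rho>\<close> and \<open>T\<close> do not depend on \<open>t0\<close>,
  which allows \<open>t0 \<rightarrow> - \<infinity>\<close>.\<close>

lemma approximants:
  obtains C \<rho> T where "C > 0" "T < 0"
    "\<And>t w1 x1 w2 x2. t \<le> T \<Longrightarrow> \<bar>w1 t - L\<bar> \<le> \<rho> \<Longrightarrow> \<bar>w2 t - L\<bar> \<le> \<rho> \<Longrightarrow>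
      (w1 has_real_derivative x1 t) (at t) \<Longrightarrow> (x1 has_real_derivative rhs t (w1 t) (x1 t)) (at t) \<Longrightarrow>
      (w2 has_real_derivative x2 t) (at t) \<Longrightarrow> (x2 has_real_derivative rhs t (w2 t) (x2 t)) (at t) \<Longrightarrow>
      \<exists>y. ((\<lambda>t. V (w1 t - w2 t) (x1 t - x2 t)) has_real_derivative y) (at t) \<and> y \<le> 0"
    "\<And>t w. t \<le> T \<Longrightarrow> \<bar>w - wapp t\<bar> \<le> C * (sh t)^4 \<Longrightarrow> \<bar>w - L\<bar> \<le> \<rho>"
    "\<rho> \<le> L / 2"
    "\<And>t0 t1. t0 < T \<Longrightarrow> T < t1 \<Longrightarrow> t1 < 0 \<Longrightarrow> \<exists>w x. continuous_on {t0..t1} w \<and> continuous_on {t0..t1} x \<and>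
        sol {t0<..<t1} w x \<and> (\<forall>t\<in>{t0..t1}. w t > 0 \<and> energy t (w t) (x t) < 0) \<and>
        (\<forall>t\<in>{t0..T}. \<bar>w t - wapp t\<bar> \<le> C * (sh t)^4 \<and> \<bar>x t - xapp t\<bar> \<le> C * (sh t)^4)"
proof (rule lyapunov_local)
  fix \<rho> T1 assume \<rho>: "0 < \<rho>" "\<rho> \<le> L / 2" and "T1 < 0" and lyap:
    "\<And>t w1 x1 w2 x2 r e. t \<le> T1 \<Longrightarrow> \<bar>w1 t - L\<bar> \<le> \<rho> \<Longrightarrow> \<bar>w2 t - L\<bar> \<le> \<rho> \<Longrightarrow>
      (w1 has_real_derivative x1 t) (at t) \<Longrightarrow> (x1 has_real_derivative rhs t (w1 t) (x1 t)) (at t) \<Longrightarrow>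
      (w2 has_real_derivative x2 t) (at t) \<Longrightarrow> (x2 has_real_derivative rhs t (w2 t) (x2 t) + r) (at t) \<Longrightarrow>
      \<bar>r\<bar> \<le> e \<Longrightarrow>
      \<exists>y. ((\<lambda>t. V (w1 t - w2 t) (x1 t - x2 t)) has_real_derivative y) (at t) \<and>
        y \<le> - \<delta> * V (w1 t - w2 t) (x1 t - x2 t) + K\<^sub>V * e^2"
  obtain C1 T2 where C1: "C1 > 0" and "T2 < 0" and res:
    "\<And>t. t \<le> T2 \<Longrightarrow> \<exists>r. \<bar>r\<bar> \<le> C1 * (sh t)^4 \<and> (xapp has_real_derivative rhs t (wapp t) (xapp t) + r) (at t)"
    using wapp_residual by blast
  \<comment> \<open>With this constant \<open>K * sh^8\<close> is a barrier for \<open>V\<close>: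
    its derivative \<open>8 * K * ch * sh^8\<close> is at least the source
    \<open>K\<^sub>V * (C1 * sh^4)^2\<close>.\<close>
  define K where "K = K\<^sub>V * C1^2 / 8"
  have K: "K > 0" using KV_pos C1 by (simp add: K_def)
  \<comment> \<open>Sum of the bounds for both components that follow from
    \<open>V \<le> K * sh^8\<close> by \<open>V_lower\<close>.\<close>
  define C where "C = 2 * sqrt K + 2 * sqrt (K / Q)"
  have C: "C > 0" using K Q_pos by (simp add: C_def add_pos_pos)
  have "\<forall>\<^sub>F t in at_bot. \<bar>wapp t - L\<bar> < \<rho> / 2"
    using tendstoD[OF wapp_tendsto, of "\<rho> / 2"] \<rho> by (simp add: dist_real_def)
  moreover have "\<forall>\<^sub>F t in at_bot. C * (sh t)^4 < \<rho> / 2"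
    using sh_power_tendsto_0[of 4 C] \<rho> by (intro order_tendstoD(2)) auto
  ultimately have "\<forall>\<^sub>F t in at_bot. \<bar>wapp t - L\<bar> < \<rho> / 2 \<and> C * (sh t)^4 < \<rho> / 2 \<and> energy t (wapp t) (xapp t) < 0
     \<and> t < 0 \<and> t \<le> T1 \<and> t \<le> T2"
    using wapp_energy eventually_at_bot_neg eventually_le_at_bot[of T1] eventually_le_at_bot[of T2]
    by eventually_elim auto
  then obtain T where T: "\<And>t. t \<le> T \<Longrightarrow> \<bar>wapp t - L\<bar> < \<rho> / 2 \<and> C * (sh t)^4 < \<rho> / 2 \<and>
      energy t (wapp t) (xapp t) < 0 \<and> t < 0 \<and> t \<le> T1 \<and> t \<le> T2"
    unfolding eventually_at_bot_linorder by blast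
  have near: "\<bar>w - L\<bar> \<le> \<rho>" if "t \<le> T" "\<bar>w - wapp t\<bar> \<le> C * (sh t)^4" for t w
    using T[OF that(1)] that(2) by linarith
  have close: "\<bar>d\<bar> \<le> C * s^4 \<and> \<bar>x\<bar> \<le> C * s^4" if V: "V d x \<le> K * s^8" for d x s :: real
  proof -
    define P where "P = s^4"
    have P: "P \<ge> 0" "s^8 = P^2" by (auto simp: P_def simp flip: power_mult)
    have "(x^2 + Q * d^2) / 4 \<le> K * P^2" using V V_lower[of x d] unfolding P(2) by linarith
    then have xd: "x^2 + Q * d^2 \<le> 4 * (K * P^2)" by simp
    have "Q * d^2 \<ge> 0" using Q_pos by simp
    then have "x^2 \<le> 4 * (K * P^2)" using xd by linarith
    also have "\<dots> = (2 * sqrt K * P)^2" using K by (simp add: power_mult_distrib)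
    finally have x: "\<bar>x\<bar> \<le> 2 * sqrt K * P" using P K by (subst (asm) power2_le_iff_abs_le) auto
    have "Q * d^2 \<le> 4 * (K * P^2)" using xd zero_le_power2[of x] by linarith
    then have "d^2 \<le> 4 * (K * P^2) / Q" using Q_pos by (simp add: pos_le_divide_eq mult.commute)
    also have "\<dots> = (2 * sqrt (K / Q) * P)^2" using K Q_pos by (simp add: power_mult_distrib)
    finally have "\<bar>d\<bar> \<le> 2 * sqrt (K / Q) * P" using P K Q_pos by (subst (asm) power2_le_iff_abs_le) auto
    with x have "\<bar>x\<bar> \<le> 2 * sqrt K * s^4" "\<bar>d\<bar> \<le> 2 * sqrt (K / Q) * s^4" by (simp_all add: P_def)
    moreover have "2 * sqrt K * s^4 \<le> C * s^4" "2 * sqrt (K / Q) * s^4 \<le> C * s^4"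
      using K Q_pos by (auto simp: C_def intro!: mult_right_mono)
    ultimately show ?thesis by linarith
  qed
  show thesis
  proof (rule that)
    show "C > 0" "T < 0" "\<rho> \<le> L / 2" using C T[of T] \<rho> by auto
    show "\<exists>y. ((\<lambda>t. V (w1 t - w2 t) (x1 t - x2 t)) has_real_derivative y) (at t) \<and> y \<le> 0"
      if prems: "t \<le> T" "\<bar>w1 t - L\<bar> \<le> \<rho>" "\<bar>w2 t - L\<bar> \<le> \<rho>"
      "(w1 has_real_derivative x1 t) (at t)" "(x1 has_real_derivative rhs t (w1 t) (x1 t)) (at t)"
      "(w2 has_real_derivative x2 t) (at t)" "(x2 has_real_derivative rhs t (w2 t) (x2 t)) (at t)"
      for t w1 x1 w2 x2
    proof -
      obtain y where y: "((\<lambda>t. V (w1 t - w2 t) (x1 t - x2 t)) has_real_derivative y) (at t)"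
         "y \<le> - \<delta> * V (w1 t - w2 t) (x1 t - x2 t) + K\<^sub>V * 0^2"
        using lyap[of t w1 w2 x1 x2 0 0] prems T[OF prems(1)] by auto
      have "0 \<le> \<delta> * V (w1 t - w2 t) (x1 t - x2 t)" using \<delta>_pos V_nonneg by simp
      then show ?thesis using y by auto
    qed
    show "\<bar>w - L\<bar> \<le> \<rho>" if "t \<le> T" "\<bar>w - wapp t\<bar> \<le> C * (sh t)^4" for t w using near[OF that] .
    fix t0 t1 assume t01: "t0 < T" "T < t1" "t1 < 0"
    have w0: "wapp t0 > 0" using conjunct1[OF T[OF less_imp_le[OF t01(1)]]] \<rho> L_pos by linarith
    obtain w x where wx: "w t0 = wapp t0" "x t0 = xapp t0"
      "continuous_on {t0..t1} w" "continuous_on {t0..t1} x"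
      "sol {t0<..<t1} w x" "\<And>t. t \<in> {t0..t1} \<Longrightarrow> w t > 0 \<and> energy t (w t) (x t) < 0"
      using ivp_exists[of t0 t1 "wapp t0" "xapp t0"] T[of t0] t01 w0 by auto
    have capp: "continuous_on {t0..t1} wapp" "continuous_on {t0..t1} xapp"
      unfolding wapp_def xapp_def using t01 by (auto intro!: continuous_intros)
    have csh: "continuous_on {t0..t1} sh" using t01 by (intro continuous_on_sh) auto
    have bound: "V (w t - wapp t) (x t - xapp t) \<le> K * (sh t)^8"
      if t: "t0 \<le> t" "t \<le> T" and nr: "\<And>s. t0 < s \<Longrightarrow> s < t \<Longrightarrow> \<bar>w s - L\<bar> \<le> \<rho>" for t
    proof -
      let ?G = "\<lambda>t. V (w t - wapp t) (x t - xapp t) - K * (sh t)^8"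
      have "?G t \<le> ?G t0"
      proof (rule DERIV_nonpos_imp_decreasing_open[OF t(1)])
        have "continuous_on {t0..t1} ?G"
          unfolding V_def by (intro continuous_intros wx capp csh) auto
        then show "continuous_on {t0..t} ?G" by (rule continuous_on_subset) (use t t01 in auto)
        fix s assume s: "t0 < s" "s < t"
        then have sT: "s \<le> T" "s < 0" using t T[of s] by auto
        obtain r where r: "\<bar>r\<bar> \<le> C1 * (sh s)^4" "(xapp has_real_derivative rhs s (wapp s) (xapp s) + r) (at s)"
          using res[of s] T[of s] sT by auto
        have ws: "(w has_real_derivative x s) (at s)" "(x has_real_derivative rhs s (w s) (x s)) (at s)"
          using wx(5) s t t01 by (auto simp: sol_def)
        obtain y where y: "((\<lambda>t. V (w t - wapp t) (x t - xapp t)) has_real_derivative y) (at s)"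
           "y \<le> - \<delta> * V (w s - wapp s) (x s - xapp s) + K\<^sub>V * (C1 * (sh s)^4)^2"
          using lyap[of s w wapp x xapp r "C1 * (sh s)^4"] sT T[of s] nr[OF s] ws r wapp_deriv[of s] \<rho> by auto
        have d8: "((\<lambda>t. K * (sh t)^8) has_real_derivative K * (8 * ch s * (sh s)^8)) (at s)"
        proof -
          have "(sh s)^8 = sh s * (sh s)^7" by (simp flip: power_Suc)
          then show ?thesis
            by (intro DERIV_cong[OF DERIV_cmult[OF DERIV_power[OF sh_deriv[OF sT(2)], of 8]]]) simp
        qed
        have "y - K * (8 * ch s * (sh s)^8) \<le> 0"
        proof -
          have "0 \<le> \<delta> * V (w s - wapp s) (x s - xapp s)" using \<delta>_pos V_nonneg by simp
          moreover have "K\<^sub>V * (C1 * (sh s)^4)^2 = 8 * K * (sh s)^8"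
            by (simp add: K_def power_mult_distrib flip: power_mult)
          moreover have "K * (8 * 1 * (sh s)^8) \<le> K * (8 * ch s * (sh s)^8)"
            using K ch_ge_1[OF sT(2)] by (intro mult_left_mono mult_right_mono) auto
          ultimately show ?thesis using y(2) by simp
        qed
        then show "\<exists>y. (?G has_real_derivative y) (at s) \<and> y \<le> 0"
          using DERIV_diff[OF y(1) d8] by blast
      qed
      also have "?G t0 \<le> 0" using K by (simp add: wx V_def)
      finally show ?thesis by simp
    qed
    \<comment> \<open>Bootstrap: while the solution is within \<open>\<rho> / 2\<close> of
      \<open>wapp\<close>, the barrier applies and gives the distance \<open>C * sh^4\<close>, which
      is strictly below \<open>\<rho> / 2\<close>.\<close>
    have within: "\<bar>w t - wapp t\<bar> < \<rho> / 2" if t: "t0 \<le> t" "t \<le> T" for t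
    proof -
      have "\<bar>w t - wapp t\<bar> - \<rho> / 2 < 0"
      proof (rule continuous_first_exit[of t0 T "\<lambda>t. \<bar>w t - wapp t\<bar> - \<rho> / 2"])
        show "continuous_on {t0..T} (\<lambda>t. \<bar>w t - wapp t\<bar> - \<rho> / 2)"
          using t01 by (intro continuous_intros continuous_on_subset[OF wx(3)] continuous_on_subset[OF capp(1)]) auto
        show "\<bar>w t0 - wapp t0\<bar> - \<rho> / 2 < 0" using wx \<rho> by simp
        fix t assume t: "t0 < t" "t \<le> T" "\<forall>s\<in>{t0..<t}. \<bar>w s - wapp s\<bar> - \<rho> / 2 < 0"
        have "V (w t - wapp t) (x t - xapp t) \<le> K * (sh t)^8"
        proof (rule bound)
          fix s assume s: "t0 < s" "s < t"
          then have "\<bar>w s - wapp s\<bar> < \<rho> / 2" "\<bar>wapp s - L\<bar> < \<rho> / 2" using t T[of s] by auto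
          then show "\<bar>w s - L\<bar> \<le> \<rho>" by linarith
        qed (use t in auto)
        then show "\<bar>w t - wapp t\<bar> - \<rho> / 2 \<noteq> 0" using close[of _ _ "sh t"] T[OF t(2)] by fastforce
      qed (use t in auto)
      then show ?thesis by simp
    qed
    have "\<bar>w t - wapp t\<bar> \<le> C * (sh t)^4 \<and> \<bar>x t - xapp t\<bar> \<le> C * (sh t)^4" if t: "t \<in> {t0..T}" for t
    proof (intro close bound)
      fix s assume s: "t0 < s" "s < t"
      then have "\<bar>w s - wapp s\<bar> < \<rho> / 2" "\<bar>wapp s - L\<bar> < \<rho> / 2" using t T[of s] within[of s] by auto
      then show "\<bar>w s - L\<bar> \<le> \<rho>" by linarith
    qed (use t in auto)
    then show "\<exists>w x. continuous_on {t0..t1} w \<and> continuous_on {t0..t1} x \<and>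
        sol {t0<..<t1} w x \<and> (\<forall>t\<in>{t0..t1}. w t > 0 \<and> energy t (w t) (x t) < 0) \<and>
        (\<forall>t\<in>{t0..T}. \<bar>w t - wapp t\<bar> \<le> C * (sh t)^4 \<and> \<bar>x t - xapp t\<bar> \<le> C * (sh t)^4)"
      using wx by blast
  qed
qed

text \<open>Beyond the neighbourhood of \<open>L\<close> nothing contracts, and a growth estimate
  must do. One \<open>G\<close> has to serve all pairs of solutions bounded by \<open>M\<close> on
  intervals ending before \<open>b\<close>; the damping term has a good sign and is dropped.\<close>

lemma gronwall_difference:
  assumes M: "M > 0" and b: "b < 0"
  obtains G where "\<And>s0 t w1 x1 w2 x2.
     continuous_on {s0..t} w1 \<Longrightarrow> continuous_on {s0..t} x1 \<Longrightarrow> continuous_on {s0..t} w2 \<Longrightarrow> continuous_on {s0..t} x2 \<Longrightarrow>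
     sol {s0<..<t} w1 x1 \<Longrightarrow> sol {s0<..<t} w2 x2 \<Longrightarrow> s0 \<le> t \<Longrightarrow> t \<le> b \<Longrightarrow>
     (\<And>s. s \<in> {s0<..<t} \<Longrightarrow> w1 s \<le> M \<and> w2 s \<le> M) \<Longrightarrow>
     (w1 t - w2 t)^2 + (x1 t - x2 t)^2 \<le> ((w1 s0 - w2 s0)^2 + (x1 s0 - x2 s0)^2) * exp (G * (t - s0))"
proof
  define G where "G = 1 + \<bar>A\<bar> + \<bar>B\<bar> * (sh b)^2 + p * M powr (p - 1)"
  fix s0 t w1 x1 w2 x2
  assume c: "continuous_on {s0..t} w1" "continuous_on {s0..t} x1" "continuous_on {s0..t} w2" "continuous_on {s0..t} x2"
    and s1: "sol {s0<..<t} w1 x1" and s2: "sol {s0<..<t} w2 x2" and t: "s0 \<le> t" "t \<le> b"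
    and le: "\<And>s. s \<in> {s0<..<t} \<Longrightarrow> w1 s \<le> M \<and> w2 s \<le> M"
  define D where "D = (\<lambda>t. (w1 t - w2 t)^2 + (x1 t - x2 t)^2)"
  have "exp (- G * t) * D t \<le> exp (- G * s0) * D s0"
  proof (rule DERIV_nonpos_imp_decreasing_open[OF t(1), of "\<lambda>t. exp (- G * t) * D t"])
    show "continuous_on {s0..t} (\<lambda>t. exp (- G * t) * D t)" unfolding D_def by (intro continuous_intros c)
    fix s assume s: "s0 < s" "s < t"
    then have s0: "s < 0" using t b by simp
    define d x where "d = w1 s - w2 s" and "x = x1 s - x2 s"
    have h: "w1 s > 0" "(w1 has_real_derivative x1 s) (at s)" "(x1 has_real_derivative rhs s (w1 s) (x1 s)) (at s)"
        "w2 s > 0" "(w2 has_real_derivative x2 s) (at s)" "(x2 has_real_derivative rhs s (w2 s) (x2 s)) (at s)"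
      using s1 s2 s by (auto simp: sol_def)
    have dd: "((\<lambda>t. w1 t - w2 t) has_real_derivative x) (at s)"
         "((\<lambda>t. x1 t - x2 t) has_real_derivative rhs s (w1 s) (x1 s) - rhs s (w2 s) (x2 s)) (at s)"
      using DERIV_diff[OF h(2) h(5)] DERIV_diff[OF h(3) h(6)] by (simp_all add: x_def)
    define x' where "x' = rhs s (w1 s) (x1 s) - rhs s (w2 s) (x2 s)"
    have dD: "(D has_real_derivative 2 * d * x + 2 * x * x') (at s)"
      unfolding D_def
      by (rule DERIV_cong[OF DERIV_add[OF DERIV_power[OF dd(1), of 2] DERIV_power[OF dd(2), of 2]]])
        (simp add: d_def x_def x'_def algebra_simps)
    have "((\<lambda>t. exp (- G * t) * D t) has_real_derivative exp (- G * s) * (2 * d * x + 2 * x * x' - G * D s)) (at s)"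
      by (rule DERIV_cong[OF DERIV_mult[OF _ dD]]) (auto intro!: derivative_eq_intros simp: algebra_simps)
    moreover have "2 * d * x + 2 * x * x' \<le> G * D s"
    proof -
      define P where "P = w1 s powr p - w2 s powr p"
      have P: "\<bar>P\<bar> \<le> p * M powr (p - 1) * \<bar>d\<bar>"
        unfolding P_def d_def using h le[of s] s p_gt by (intro abs_powr_diff_le) auto
      have x': "x' = - a * ch s * x + (A + B * (sh s)^2) * d - P"
        by (simp add: x'_def rhs_def x_def d_def P_def algebra_simps)
      have AB: "\<bar>A + B * (sh s)^2\<bar> \<le> \<bar>A\<bar> + \<bar>B\<bar> * (sh b)^2"
      proof -
        have "\<bar>A + B * (sh s)^2\<bar> \<le> \<bar>A\<bar> + \<bar>B * (sh s)^2\<bar>" by (rule abs_triangle_ineq)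
        also have "\<bar>B * (sh s)^2\<bar> \<le> \<bar>B\<bar> * (sh b)^2"
          unfolding abs_mult using sh_mono[of s b] sh_pos[of s] s t b by (intro mult_left_mono) (auto intro: power_mono)
        finally show ?thesis by simp
      qed
      have "x * x' = - (a * ch s * x^2) + x * ((A + B * (sh s)^2) * d - P)"
        by (simp add: x' power2_eq_square algebra_simps)
      moreover have "a * ch s * x^2 \<ge> 0" using a_pos ch_pos[OF s0] by simp
      moreover have "x * ((A + B * (sh s)^2) * d - P) \<le> \<bar>x\<bar> * ((G - 1) * \<bar>d\<bar>)"
      proof -
        have "\<bar>(A + B * (sh s)^2) * d - P\<bar> \<le> \<bar>A + B * (sh s)^2\<bar> * \<bar>d\<bar> + \<bar>P\<bar>"
          unfolding abs_mult[symmetric] by (rule abs_triangle_ineq4)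
        also have "\<dots> \<le> (\<bar>A\<bar> + \<bar>B\<bar> * (sh b)^2) * \<bar>d\<bar> + p * M powr (p - 1) * \<bar>d\<bar>"
          using AB P by (intro add_mono mult_right_mono) auto
        also have "\<dots> = (G - 1) * \<bar>d\<bar>" by (simp add: G_def algebra_simps)
        finally have "\<bar>x\<bar> * \<bar>(A + B * (sh s)^2) * d - P\<bar> \<le> \<bar>x\<bar> * ((G - 1) * \<bar>d\<bar>)" by (intro mult_left_mono) auto
        then show ?thesis using abs_ge_self[of "x * ((A + B * (sh s)^2) * d - P)"] unfolding abs_mult by linarith
      qed
      moreover have "\<bar>x\<bar> * ((G - 1) * \<bar>d\<bar>) = G * (\<bar>x\<bar> * \<bar>d\<bar>) - \<bar>x\<bar> * \<bar>d\<bar>" by (simp add: algebra_simps)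
      moreover have "d * x \<le> \<bar>x\<bar> * \<bar>d\<bar>" using abs_ge_self[of "x * d"] by (simp add: abs_mult mult.commute)
      ultimately have "2 * (d * x) + 2 * (x * x') \<le> 2 * (G * (\<bar>x\<bar> * \<bar>d\<bar>))" by linarith
      then have "2 * d * x + 2 * x * x' \<le> G * (2 * \<bar>x\<bar> * \<bar>d\<bar>)" by (simp add: mult_ac)
      also have "\<dots> \<le> G * D s"
      proof (intro mult_left_mono)
        show "2 * \<bar>x\<bar> * \<bar>d\<bar> \<le> D s" using sum_squares_bound[of "\<bar>x\<bar>" "\<bar>d\<bar>"] by (simp add: D_def d_def x_def)
        show "G \<ge> 0" using p_gt by (simp add: G_def)
      qed
      finally show ?thesis .
    qed
    then have "exp (- G * s) * (2 * d * x + 2 * x * x' - G * D s) \<le> 0" by (intro mult_nonneg_nonpos) auto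
    ultimately show "\<exists>y. ((\<lambda>t. exp (- G * t) * D t) has_real_derivative y) (at s) \<and> y \<le> 0" by blast
  qed
  then have "exp (G * t) * (exp (- G * t) * D t) \<le> exp (G * t) * (exp (- G * s0) * D s0)"
    by (intro mult_left_mono) auto
  also have "exp (G * t) * (exp (- G * t) * D t) = D t" by (simp add: exp_minus)
  also have "exp (G * t) * (exp (- G * s0) * D s0) = D s0 * exp (G * (t - s0))"
    by (simp add: right_diff_distrib exp_diff exp_minus divide_inverse)
  finally show "(w1 t - w2 t)^2 + (x1 t - x2 t)^2 \<le> ((w1 s0 - w2 s0)^2 + (x1 s0 - x2 s0)^2) * exp (G * (t - s0))"
    by (simp add: D_def)
qed

lemma rhs_lipschitz:
  assumes "t < 0" "0 \<le> w1" "w1 \<le> M" "0 \<le> w2" "w2 \<le> M"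
  shows "\<bar>rhs t w1 x1 - rhs t w2 x2\<bar> \<le> a * ch t * \<bar>x1 - x2\<bar> + (\<bar>A + B * (sh t)^2\<bar> + p * M powr (p - 1)) * \<bar>w1 - w2\<bar>"
proof -
  have "rhs t w1 x1 - rhs t w2 x2
     = - (a * ch t * (x1 - x2)) + (A + B * (sh t)^2) * (w1 - w2) - (w1 powr p - w2 powr p)"
    by (simp add: rhs_def algebra_simps)
  also have "\<bar>\<dots>\<bar> \<le> \<bar>a * ch t * (x1 - x2)\<bar> + \<bar>(A + B * (sh t)^2) * (w1 - w2)\<bar> + \<bar>w1 powr p - w2 powr p\<bar>"
    by linarith
  also have "\<bar>w1 powr p - w2 powr p\<bar> \<le> p * M powr (p - 1) * \<bar>w1 - w2\<bar>"
    using assms p_gt by (intro abs_powr_diff_le) auto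
  finally show ?thesis
    using a_pos ch_pos[OF assms(1)] unfolding abs_mult by (simp add: distrib_right[of "\<bar>_\<bar>"])
qed

lemma energy_decreasing:
  assumes sol: "sol {s..t} w x" and st: "s < t"
  shows "energy t (w t) (x t) < energy s (w s) (x s)"
proof (rule DERIV_neg_imp_decreasing[OF st, of "\<lambda>t. energy t (w t) (x t)"])
  fix s' assume "s \<le> s'" "s' \<le> t"
  then have s: "s' < 0" "w s' > 0" "(w has_real_derivative x s') (at s')"
    "(x has_real_derivative rhs s' (w s') (x s')) (at s')"
    using sol by (auto simp: sol_def)
  have "0 < sh s' powr a * ch s' * (Lam * (sh s')^2 * (w s')^2 + (\<nu> - m) * (p - 1) / (p + 1) * w s' powr (p + 1))"
    using s ch_pos[of s'] sh_pos[of s'] Lam_nonneg m_less p_gt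
    by (intro mult_pos_pos add_nonneg_pos divide_pos_pos mult_nonneg_nonneg) auto
  then show "\<exists>y. ((\<lambda>t. energy t (w t) (x t)) has_real_derivative y) (at s') \<and> y < 0"
    using energy_deriv[OF s] by force
qed

text \<open>A limit of approximants keeps only the weak inequality; comparing with the time
  \<open>t - 1\<close> restores the strict one.\<close>

lemma energy_neg_of_nonpos:
  assumes sol: "sol {..<0} w x" and le: "\<And>t. t < 0 \<Longrightarrow> energy t (w t) (x t) \<le> 0" and t: "t < 0"
  shows "energy t (w t) (x t) < 0"
proof -
  have "energy t (w t) (x t) < energy (t - 1) (w (t - 1)) (x (t - 1))"
    using sol t by (intro energy_decreasing) (auto simp: sol_def)
  also have "\<dots> \<le> 0" using le t by simp
  finally show ?thesis .
qed

theorem singular_profile_exists: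
  obtains W X C T where "C > 0" "T < 0" "sol {..<0} W X"
    "\<And>t. t < 0 \<Longrightarrow> energy t (W t) (X t) < 0"
    "\<And>t. t \<le> T \<Longrightarrow> \<bar>W t - wapp t\<bar> \<le> C * (sh t)^4"
proof (rule approximants)
  fix C \<rho> T
  assume C: "C > 0" and T: "T < 0" and
    lyap: "\<And>t w1 x1 w2 x2. t \<le> T \<Longrightarrow> \<bar>w1 t - L\<bar> \<le> \<rho> \<Longrightarrow> \<bar>w2 t - L\<bar> \<le> \<rho> \<Longrightarrow>
      (w1 has_real_derivative x1 t) (at t) \<Longrightarrow> (x1 has_real_derivative rhs t (w1 t) (x1 t)) (at t) \<Longrightarrow>
      (w2 has_real_derivative x2 t) (at t) \<Longrightarrow> (x2 has_real_derivative rhs t (w2 t) (x2 t)) (at t) \<Longrightarrow>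
      \<exists>y. ((\<lambda>t. V (w1 t - w2 t) (x1 t - x2 t)) has_real_derivative y) (at t) \<and> y \<le> 0" and
    near: "\<And>t w. t \<le> T \<Longrightarrow> \<bar>w - wapp t\<bar> \<le> C * (sh t)^4 \<Longrightarrow> \<bar>w - L\<bar> \<le> \<rho>" and \<rho>: "\<rho> \<le> L / 2" and
    ex: "\<And>t0 t1. t0 < T \<Longrightarrow> T < t1 \<Longrightarrow> t1 < 0 \<Longrightarrow> \<exists>w x. continuous_on {t0..t1} w \<and> continuous_on {t0..t1} x \<and>
        sol {t0<..<t1} w x \<and> (\<forall>t\<in>{t0..t1}. w t > 0 \<and> energy t (w t) (x t) < 0) \<and>
        (\<forall>t\<in>{t0..T}. \<bar>w t - wapp t\<bar> \<le> C * (sh t)^4 \<and> \<bar>x t - xapp t\<bar> \<le> C * (sh t)^4)"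
  \<comment> \<open>This makes \<open>{- k n..- 1 / k n}\<close> a neighbourhood of \<open>T\<close>
    for every \<open>n\<close>; the intervals increase to the whole negative half-line.\<close>
  obtain N0 :: nat where N0: "real N0 > max (- T) (- 1 / T)" using reals_Archimedean2 by blast
  define k where "k = (\<lambda>n. real (n + N0))"
  have k: "- k n < T" "T < - 1 / k n" "- 1 / k n < 0" "k n > 0" for n
  proof -
    have "k n \<ge> real N0" by (simp add: k_def)
    then have kn: "k n > - T" "k n > - 1 / T" using N0 by auto
    then show "- k n < T" "k n > 0" using T by auto
    then show "- 1 / k n < 0" by simp
    show "T < - 1 / k n" using kn T \<open>k n > 0\<close> by (simp add: field_simps)
  qed
  have k_mono: "k n \<le> k l" "- 1 / k n \<le> - 1 / k l" if "n \<le> l" for n l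
  proof -
    show "k n \<le> k l" using that by (simp add: k_def)
    then show "- 1 / k n \<le> - 1 / k l" using k(4)[of n] k(4)[of l] by (simp add: frac_le)
  qed
  have k_lim: "filterlim k at_top sequentially"
    unfolding k_def using filterlim_compose[OF filterlim_real_sequentially filterlim_add_const_nat_at_top] by simp
  define I where "I = (\<lambda>n. {- k n..- 1 / k n})"
  have "\<exists>w x. continuous_on (I n) w \<and> continuous_on (I n) x \<and> sol {- k n<..<- 1 / k n} w x \<and>
        (\<forall>t\<in>I n. w t > 0 \<and> energy t (w t) (x t) < 0) \<and>
        (\<forall>t\<in>{- k n..T}. \<bar>w t - wapp t\<bar> \<le> C * (sh t)^4 \<and> \<bar>x t - xapp t\<bar> \<le> C * (sh t)^4)" for n
    unfolding I_def using ex[of "- k n" "- 1 / k n"] k[of n] by simp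
  then obtain w x where
     cw: "\<And>n. continuous_on (I n) (w n)" and cx: "\<And>n. continuous_on (I n) (x n)" and
     sol: "\<And>n. sol {- k n<..<- 1 / k n} (w n) (x n)" and
     pos: "\<And>n t. t \<in> I n \<Longrightarrow> w n t > 0 \<and> energy t (w n t) (x n t) < 0" and
     app: "\<And>n t. t \<in> {- k n..T} \<Longrightarrow> \<bar>w n t - wapp t\<bar> \<le> C * (sh t)^4 \<and> \<bar>x n t - xapp t\<bar> \<le> C * (sh t)^4"
    by metis
  have sub: "{s..t} \<subseteq> I n" "{s..t} \<subseteq> I l" "{s<..<t} \<subseteq> {- k n<..<- 1 / k n}" "{s<..<t} \<subseteq> {- k l<..<- 1 / k l}"
    if "n \<le> l" "- k n \<le> s" "t \<le> - 1 / k n" for n l s t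
    using that k_mono[OF that(1)] by (auto simp: I_def)
  have sol_sub: "sol J w x" if "sol K w x" "J \<subseteq> K" for J K w x using that by (auto simp: sol_def)
  define R where "R = (4 + 4 / Q) * (4 * C^2 * (1 + Q))"
  have R: "R \<ge> 0" using Q_pos by (simp add: R_def)
  \<comment> \<open>At \<open>- k n\<close>, where the later-indexed solution has already been
    running, both are within \<open>C * sh^4\<close> of \<open>wapp\<close>, so \<open>V\<close> of
    their difference is of order \<open>sh^8\<close> there; it does not increase up to
    \<open>T\<close>.\<close>
  have near_cauchy: "(w n t - w l t)^2 + (x n t - x l t)^2 \<le> R * sh (- k n)^8"
    if nl: "n \<le> l" and t: "- k n \<le> t" "t \<le> T" for n l t
  proof -
    let ?V = "\<lambda>t. V (w n t - w l t) (x n t - x l t)"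
    have tn: "t \<le> - 1 / k n" using t k(2)[of n] by simp
    note sb = sub[OF nl order_refl tn]
    have "?V t \<le> ?V (- k n)"
    proof (rule DERIV_nonpos_imp_decreasing_open[OF t(1)])
      show "continuous_on {- k n..t} ?V"
        unfolding V_def using cw[of n] cw[of l] cx[of n] cx[of l] sb
        by (intro continuous_intros) (auto elim: continuous_on_subset)
      fix s assume s: "- k n < s" "s < t"
      then have sT: "s \<le> T" "s \<in> {- k n..T}" "s \<in> {- k l..T}" "s \<in> {- k n<..<- 1 / k n}" "s \<in> {- k l<..<- 1 / k l}"
        using t tn k_mono[OF nl] by auto
      show "\<exists>y. (?V has_real_derivative y) (at s) \<and> y \<le> 0"
        using sol[of n] sol[of l] sT near[OF sT(1)] app[of s n] app[of s l]
        by (intro lyap) (auto simp: sol_def)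
    qed
    also have "?V (- k n) \<le> (x n (- k n) - x l (- k n))^2 + Q * (w n (- k n) - w l (- k n))^2"
      by (rule V_upper)
    also have "\<dots> \<le> (2 * C * sh (- k n)^4)^2 + Q * (2 * C * sh (- k n)^4)^2"
    proof -
      have in0: "- k n \<in> {- k n..T}" "- k n \<in> {- k l..T}" using k(1)[of n] k_mono[OF nl] by auto
      have "\<bar>w n (- k n) - w l (- k n)\<bar> \<le> 2 * C * sh (- k n)^4" "\<bar>x n (- k n) - x l (- k n)\<bar> \<le> 2 * C * sh (- k n)^4"
        using app[OF in0(1)] app[OF in0(2)] by linarith+
      then show ?thesis using Q_pos
        by (intro add_mono mult_left_mono) (auto simp: abs_le_square_iff[symmetric] intro: order_trans[OF _ abs_ge_self])
    qed
    also have "\<dots> = 4 * C^2 * (1 + Q) * sh (- k n)^8"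
      by (simp add: power_mult_distrib algebra_simps flip: power_mult)
    finally have V: "?V t \<le> 4 * C^2 * (1 + Q) * sh (- k n)^8" .
    define d y where "d = w n t - w l t" and "y = x n t - x l t"
    have "(y^2 + Q * d^2) / 4 \<le> V d y" by (rule V_lower)
    then have *: "y^2 + Q * d^2 \<le> 4 * V d y" by simp
    have "y^2 \<le> 4 * V d y" "Q * d^2 \<le> 4 * V d y"
      using * zero_le_power2[of y] mult_nonneg_nonneg[OF less_imp_le[OF Q_pos] zero_le_power2[of d]] by linarith+
    then have "d^2 + y^2 \<le> 4 * V d y / Q + 4 * V d y" using Q_pos by (intro add_mono) (auto simp: pos_le_divide_eq mult.commute)
    also have "\<dots> = (4 + 4 / Q) * V d y" by (simp add: algebra_simps)
    also have "\<dots> \<le> (4 + 4 / Q) * (4 * C^2 * (1 + Q) * sh (- k n)^8)"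
      using V Q_pos by (intro mult_left_mono) (auto simp: d_def y_def)
    finally show ?thesis by (simp add: d_def y_def R_def mult.assoc)
  qed
  \<comment> \<open>From \<open>T\<close> to \<open>b\<close> the bound grows by a factor
    independent of \<open>n\<close> and \<open>l\<close>, because negative energy keeps all
    approximants below \<open>bnd b\<close>.\<close>
  have cauchy: "\<exists>E. \<forall>n l t. n \<le> l \<longrightarrow> b \<le> - 1 / k n \<longrightarrow> - k n \<le> t \<longrightarrow> t \<le> b \<longrightarrow>
      (w n t - w l t)^2 + (x n t - x l t)^2 \<le> E * sh (- k n)^8" if b: "T < b" "b < 0" for b
  proof (rule gronwall_difference[OF bnd_pos[of b] b(2)])
    fix G
    assume G: "\<And>s0 t w1 x1 w2 x2.
     continuous_on {s0..t} w1 \<Longrightarrow> continuous_on {s0..t} x1 \<Longrightarrow> continuous_on {s0..t} w2 \<Longrightarrow> continuous_on {s0..t} x2 \<Longrightarrow>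
     sol {s0<..<t} w1 x1 \<Longrightarrow> sol {s0<..<t} w2 x2 \<Longrightarrow> s0 \<le> t \<Longrightarrow> t \<le> b \<Longrightarrow>
     (\<And>s. s \<in> {s0<..<t} \<Longrightarrow> w1 s \<le> bnd b \<and> w2 s \<le> bnd b) \<Longrightarrow>
     (w1 t - w2 t)^2 + (x1 t - x2 t)^2 \<le> ((w1 s0 - w2 s0)^2 + (x1 s0 - x2 s0)^2) * exp (G * (t - s0))"
    define E where "E = R * exp (\<bar>G\<bar> * (b - T))"
    have E1: "R \<le> E" using R b by (simp add: E_def mult_le_cancel_left1)
    have "(w n t - w l t)^2 + (x n t - x l t)^2 \<le> E * sh (- k n)^8"
      if nl: "n \<le> l" "b \<le> - 1 / k n" "- k n \<le> t" "t \<le> b" for n l t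
    proof (cases "t \<le> T")
      case True
      have "R * sh (- k n)^8 \<le> E * sh (- k n)^8" using E1 by (intro mult_right_mono) auto
      then show ?thesis using near_cauchy[OF nl(1,3) True] by simp
    next
      case False
      have tn: "t \<le> - 1 / k n" using nl by simp
      note sb = sub[OF nl(1) less_imp_le[OF k(1)] tn]
      have "(w n t - w l t)^2 + (x n t - x l t)^2
         \<le> ((w n T - w l T)^2 + (x n T - x l T)^2) * exp (G * (t - T))"
      proof (rule G)
        show "w n s \<le> bnd b \<and> w l s \<le> bnd b" if "s \<in> {T<..<t}" for s
        proof -
          have s: "s < 0" "s \<le> b" "s \<in> I n" "s \<in> I l" using that nl b sb(1,2) by auto
          show ?thesis using less_bnd[OF s(1)] pos[OF s(3)] pos[OF s(4)] bnd_mono[OF s(2) b(2)] by force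
        qed
        show "continuous_on {T..t} (w n)" "continuous_on {T..t} (x n)"
          by (rule continuous_on_subset[OF _ sb(1)], rule cw cx)+
        show "continuous_on {T..t} (w l)" "continuous_on {T..t} (x l)"
          by (rule continuous_on_subset[OF _ sb(2)], rule cw cx)+
        show "sol {T<..<t} (w n) (x n)" "sol {T<..<t} (w l) (x l)"
          using sol_sub[OF sol sb(3)] sol_sub[OF sol sb(4)] by auto
      qed (use False nl in auto)
      also have "\<dots> \<le> (R * sh (- k n)^8) * exp (\<bar>G\<bar> * (b - T))"
      proof (intro mult_mono)
        show "(w n T - w l T)^2 + (x n T - x l T)^2 \<le> R * sh (- k n)^8"
          using near_cauchy[OF nl(1), of T] k(1)[of n] by simp
        have "G * (t - T) \<le> \<bar>G\<bar> * (b - T)" using False nl by (intro mult_mono) auto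
        then show "exp (G * (t - T)) \<le> exp (\<bar>G\<bar> * (b - T))" by simp
      qed (use R in auto)
      finally show ?thesis by (simp add: E_def mult_ac)
    qed
    then show ?thesis by blast
  qed
  have neg_k: "filterlim (\<lambda>n. - k n) at_bot sequentially"
    using k_lim by (simp add: filterlim_uminus_at_top)
  have eps0: "(\<lambda>n. sqrt (E * sh (- k n)^8)) \<longlonglongrightarrow> 0" for E
    using tendsto_real_sqrt[OF filterlim_compose[OF sh_power_tendsto_0[of 8 E] neg_k]] by simp
  define W X where "W = (\<lambda>t. lim (\<lambda>n. w n t))" and "X = (\<lambda>t. lim (\<lambda>n. x n t))"
  have conv: "\<exists>N \<epsilon>. \<epsilon> \<longlonglongrightarrow> 0 \<and> (\<forall>n\<ge>N. \<forall>t\<in>{\<alpha>..b}. {\<alpha>..b} \<subseteq> {- k n<..<- 1 / k n} \<and>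
      \<bar>w n t - W t\<bar> \<le> \<epsilon> n \<and> \<bar>x n t - X t\<bar> \<le> \<epsilon> n) \<and>
      (\<forall>t\<in>{\<alpha>..b}. (\<lambda>n. w n t) \<longlonglongrightarrow> W t \<and> (\<lambda>n. x n t) \<longlonglongrightarrow> X t)" if b: "T < b" "b < 0" and "\<alpha> \<le> b" for \<alpha> b
  proof -
    obtain E where E: "\<And>n l t. n \<le> l \<Longrightarrow> b \<le> - 1 / k n \<Longrightarrow> - k n \<le> t \<Longrightarrow> t \<le> b \<Longrightarrow>
      (w n t - w l t)^2 + (x n t - x l t)^2 \<le> E * sh (- k n)^8" using cauchy[OF b] by blast
    define \<epsilon> where "\<epsilon> = (\<lambda>n. sqrt (E * sh (- k n)^8))"
    have "\<forall>\<^sub>F n in sequentially. k n > max (- \<alpha>) (- 1 / b)"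
      using k_lim unfolding filterlim_at_top_dense by blast
    then obtain N where N: "\<And>n. n \<ge> N \<Longrightarrow> k n > max (- \<alpha>) (- 1 / b)"
      unfolding eventually_sequentially by blast
    have kN: "- k n < \<alpha>" "b < - 1 / k n" if "n \<ge> N" for n
    proof -
      show "- k n < \<alpha>" using N[OF that] by simp
      show "b < - 1 / k n" using N[OF that] b k(4)[of n] by (simp add: field_simps)
    qed
    have le: "\<bar>w n t - w l t\<bar> \<le> \<epsilon> n" "\<bar>x n t - x l t\<bar> \<le> \<epsilon> n" if "N \<le> n" "n \<le> l" "t \<in> {\<alpha>..b}" for n l t
    proof -
      have *: "(w n t - w l t)^2 + (x n t - x l t)^2 \<le> E * sh (- k n)^8"
        using kN[OF that(1)] that by (intro E) auto
      have "(w n t - w l t)^2 \<le> E * sh (- k n)^8" "(x n t - x l t)^2 \<le> E * sh (- k n)^8"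
        using * zero_le_power2[of "w n t - w l t"] zero_le_power2[of "x n t - x l t"] by linarith+
      then show "\<bar>w n t - w l t\<bar> \<le> \<epsilon> n" "\<bar>x n t - x l t\<bar> \<le> \<epsilon> n"
        unfolding \<epsilon>_def by (auto intro!: real_le_rsqrt)
    qed
    have \<epsilon>0: "\<epsilon> \<longlonglongrightarrow> 0" unfolding \<epsilon>_def by (rule eps0)
    have lims: "(\<lambda>n. f n t) \<longlonglongrightarrow> lim (\<lambda>n. f n t) \<and> (\<forall>n\<ge>N. \<bar>f n t - lim (\<lambda>n. f n t)\<bar> \<le> \<epsilon> n)"
      if f: "\<And>n l. N \<le> n \<Longrightarrow> n \<le> l \<Longrightarrow> \<bar>f n t - f l t\<bar> \<le> \<epsilon> n" for f :: "nat \<Rightarrow> real \<Rightarrow> real" and t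
    proof -
      have "Cauchy (\<lambda>n. f n t)"
      proof (rule metric_CauchyI)
        fix e :: real assume "e > 0"
        then have "\<forall>\<^sub>F n in sequentially. \<epsilon> n < e / 2" using \<epsilon>0 by (intro order_tendstoD(2)) auto
        then obtain N' where N': "\<And>n. n \<ge> N' \<Longrightarrow> \<epsilon> n < e / 2" unfolding eventually_sequentially by blast
        define n where "n = max N N'"
        have "dist (f i t) (f j t) < e" if "i \<ge> n" "j \<ge> n" for i j
          using f[of n i] f[of n j] N'[of n] that by (auto simp: n_def dist_real_def)
        then show "\<exists>M. \<forall>i\<ge>M. \<forall>j\<ge>M. dist (f i t) (f j t) < e" by blast
      qed
      then have lim: "(\<lambda>n. f n t) \<longlonglongrightarrow> lim (\<lambda>n. f n t)"
        using Cauchy_convergent_iff convergent_LIMSEQ_iff by blast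
      moreover have "\<bar>f n t - lim (\<lambda>n. f n t)\<bar> \<le> \<epsilon> n" if "n \<ge> N" for n
      proof (rule tendsto_upperbound)
        show "(\<lambda>l. \<bar>f n t - f l t\<bar>) \<longlonglongrightarrow> \<bar>f n t - lim (\<lambda>n. f n t)\<bar>" by (intro tendsto_intros lim)
        show "\<forall>\<^sub>F l in sequentially. \<bar>f n t - f l t\<bar> \<le> \<epsilon> n"
          using f[OF that] by (auto simp: eventually_sequentially)
      qed simp
      ultimately show ?thesis by blast
    qed
    have ints: "{\<alpha>..b} \<subseteq> {- k n<..<- 1 / k n}" if "n \<ge> N" for n using kN[OF that] by auto
    have "(\<lambda>n. w n t) \<longlonglongrightarrow> W t \<and> (\<forall>n\<ge>N. \<bar>w n t - W t\<bar> \<le> \<epsilon> n)" if "t \<in> {\<alpha>..b}" for t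
      unfolding W_def using le(1) that by (intro lims) auto
    moreover have "(\<lambda>n. x n t) \<longlonglongrightarrow> X t \<and> (\<forall>n\<ge>N. \<bar>x n t - X t\<bar> \<le> \<epsilon> n)" if "t \<in> {\<alpha>..b}" for t
      unfolding X_def using le(2) that by (intro lims) auto
    ultimately show ?thesis using \<epsilon>0 ints by blast
  qed
  have point: "(\<lambda>n. w n t) \<longlonglongrightarrow> W t" "(\<lambda>n. x n t) \<longlonglongrightarrow> X t" "\<forall>\<^sub>F n in sequentially. t \<in> I n"
    if "t < 0" for t
  proof -
    define \<alpha> b where "\<alpha> = min t (T / 2)" and "b = max t (T / 2)"
    have b: "T < b" "b < 0" "\<alpha> \<le> b" "t \<in> {\<alpha>..b}" using that T by (auto simp: \<alpha>_def b_def)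
    obtain N where *: "\<forall>n\<ge>N. {\<alpha>..b} \<subseteq> {- k n<..<- 1 / k n}"
       "\<forall>s\<in>{\<alpha>..b}. (\<lambda>n. w n s) \<longlonglongrightarrow> W s \<and> (\<lambda>n. x n s) \<longlonglongrightarrow> X s"
      using conv[OF b(1-3)] b(4) by blast
    show "(\<lambda>n. w n t) \<longlonglongrightarrow> W t" "(\<lambda>n. x n t) \<longlonglongrightarrow> X t" using *(2) b(4) by auto
    show "\<forall>\<^sub>F n in sequentially. t \<in> I n"
    proof (rule eventually_sequentiallyI[of N])
      fix n assume "N \<le> n"
      then have "t \<in> {- k n<..<- 1 / k n}" using *(1) b(4) by blast
      then show "t \<in> I n" by (simp add: I_def)
    qed
  qed
  have W_bounds: "0 \<le> W t" "W t \<le> bnd t" "energy t (W t) (X t) \<le> 0" if t: "t < 0" for t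
  proof -
    note lims = point[OF t]
    have ev: "\<forall>\<^sub>F n in sequentially. 0 \<le> w n t \<and> w n t \<le> bnd t \<and> energy t (w n t) (x n t) \<le> 0"
      using lims(3) by eventually_elim (use pos less_bnd[OF t] in \<open>force intro: less_imp_le\<close>)
    show "0 \<le> W t" "W t \<le> bnd t"
      using ev by (auto intro: tendsto_lowerbound[OF lims(1)] tendsto_upperbound[OF lims(1)] elim: eventually_mono)
    have "(\<lambda>n. energy t (w n t) (x n t)) \<longlonglongrightarrow> energy t (W t) (X t)"
      unfolding energy_def using p_gt ev by (intro tendsto_intros lims) (auto elim: eventually_mono)
    then show "energy t (W t) (X t) \<le> 0"
      by (rule tendsto_upperbound) (use ev in \<open>auto elim: eventually_mono\<close>)
  qed
  have der: "(W has_real_derivative X t) (at t)" "(X has_real_derivative rhs t (W t) (X t)) (at t)"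
    if t: "t < 0" for t
  proof -
    define b where "b = max (t / 2) (T / 2)"
    have b: "T < b" "b < 0" "t < b" "t - 1 \<le> b" using t T by (auto simp: b_def max_def)
    obtain N \<epsilon> where \<epsilon>: "\<epsilon> \<longlonglongrightarrow> 0" and conv': "\<And>n s. n \<ge> N \<Longrightarrow> s \<in> {t - 1..b} \<Longrightarrow> {t - 1..b} \<subseteq> {- k n<..<- 1 / k n} \<and>
      \<bar>w n s - W s\<bar> \<le> \<epsilon> n \<and> \<bar>x n s - X s\<bar> \<le> \<epsilon> n"
      using conv[OF b(1,2,4)] by blast
    define S where "S = {t - 1<..<b}"
    have S: "t \<in> S" "open S" "convex S" using b by (auto simp: S_def)
    have Sneg: "s < 0" if "s \<in> S" for s using that b by (auto simp: S_def)
    have sol': "(w n has_real_derivative x n s) (at s)" "(x n has_real_derivative rhs s (w n s) (x n s)) (at s)"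
      "s \<in> I n" "s < 0" "s \<le> b" "\<bar>w n s - W s\<bar> \<le> \<epsilon> n" "\<bar>x n s - X s\<bar> \<le> \<epsilon> n"
      if "n \<ge> N" "s \<in> S" for n s
    proof -
      have s: "s \<in> {t - 1..b}" using that by (auto simp: S_def)
      then have "s \<in> {- k n<..<- 1 / k n}" using conv'[OF that(1) s] by blast
      then show "(w n has_real_derivative x n s) (at s)" "(x n has_real_derivative rhs s (w n s) (x n s)) (at s)"
        "s \<in> I n" using sol[of n] by (auto simp: sol_def I_def)
      show "s < 0" "s \<le> b" "\<bar>w n s - W s\<bar> \<le> \<epsilon> n" "\<bar>x n s - X s\<bar> \<le> \<epsilon> n" using conv'[OF that(1) s] s b by auto
    qed
    show "(W has_real_derivative X t) (at t)"
      by (rule has_derivative_locally_uniform_limit[OF S, of N w x X \<epsilon>]) (use sol' \<epsilon> point Sneg in auto)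
    define H where "H = a * (1 + sh b) + (\<bar>A\<bar> + \<bar>B\<bar> * (sh b)^2 + p * bnd b powr (p - 1))"
    show "(X has_real_derivative rhs t (W t) (X t)) (at t)"
    \<comment> \<open>On \<open>S\<close> all values lie in \<open>{0..bnd b}\<close>, where
      \<open>rhs\<close> is Lipschitz; thus uniform convergence of \<open>w\<close> and
      \<open>x\<close> carries over to the right-hand sides.\<close>
    proof (rule has_derivative_locally_uniform_limit[OF S, of N x "\<lambda>n s. rhs s (w n s) (x n s)" "\<lambda>s. rhs s (W s) (X s)" "\<lambda>n. H * \<epsilon> n"])
      show "(\<lambda>n. H * \<epsilon> n) \<longlonglongrightarrow> 0" using tendsto_mult_right_zero[OF \<epsilon>] .
      fix n s assume ns: "n \<ge> N" "s \<in> S"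
      note so = sol'[OF ns]
      have wM: "0 \<le> w n s" "w n s \<le> bnd b" "0 \<le> W s" "W s \<le> bnd b"
        using pos[OF so(3)] less_bnd[OF so(4)] bnd_mono[OF so(5) b(2)] W_bounds[OF so(4)] by force+
      have shs: "sh s \<le> sh b" "0 < sh s" using sh_mono[OF so(5) b(2)] sh_pos[OF so(4)] by auto
      have "\<bar>rhs s (w n s) (x n s) - rhs s (W s) (X s)\<bar>
         \<le> a * ch s * \<bar>x n s - X s\<bar> + (\<bar>A + B * (sh s)^2\<bar> + p * bnd b powr (p - 1)) * \<bar>w n s - W s\<bar>"
        using so(4) wM by (intro rhs_lipschitz) auto
      also have "\<dots> \<le> a * (1 + sh b) * \<epsilon> n + (\<bar>A\<bar> + \<bar>B\<bar> * (sh b)^2 + p * bnd b powr (p - 1)) * \<epsilon> n"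
      proof (intro add_mono mult_mono)
        have "\<bar>A + B * (sh s)^2\<bar> \<le> \<bar>A\<bar> + \<bar>B * (sh s)^2\<bar>" by (rule abs_triangle_ineq)
        also have "\<bar>B * (sh s)^2\<bar> \<le> \<bar>B\<bar> * (sh b)^2"
          unfolding abs_mult using shs by (intro mult_left_mono) (auto intro: power_mono)
        finally show "\<bar>A + B * (sh s)^2\<bar> \<le> \<bar>A\<bar> + \<bar>B\<bar> * (sh b)^2" by simp
        show "ch s \<le> 1 + sh b" using ch_le[OF so(4)] shs by simp
      qed (use so a_pos shs p_gt ch_pos[OF so(4)] in auto)
      also have "\<dots> = H * \<epsilon> n" by (simp add: H_def algebra_simps)
      finally show "\<bar>rhs s (w n s) (x n s) - rhs s (W s) (X s)\<bar> \<le> H * \<epsilon> n" .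
    qed (use sol' point Sneg in auto)
  qed
  have W_app: "\<bar>W t - wapp t\<bar> \<le> C * (sh t)^4" if t: "t \<le> T" for t
  proof (rule tendsto_upperbound)
    show "(\<lambda>n. \<bar>w n t - wapp t\<bar>) \<longlonglongrightarrow> \<bar>W t - wapp t\<bar>"
      using t T by (intro tendsto_intros point) auto
    show "\<forall>\<^sub>F n in sequentially. \<bar>w n t - wapp t\<bar> \<le> C * (sh t)^4"
      using point(3)[of t] t T by (auto elim!: eventually_mono simp: I_def app)
  qed simp
  \<comment> \<open>Up to \<open>T\<close> positivity of the limit comes from closeness to
    \<open>L\<close>, as \<open>\<rho> \<le> L / 2\<close>; beyond \<open>T\<close> it comes from
    the energy, which would be nonnegative at a zero of \<open>W\<close>.\<close>
  have W_early: "W t > 0" if "t \<le> T" for t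
    using near[OF that W_app[OF that]] \<rho> L_pos by linarith
  have early: "energy t (W t) (X t) < 0" if "t \<le> T" for t
  proof -
    have "energy t (W t) (X t) < energy (t - 1) (W (t - 1)) (X (t - 1))"
      using that T W_early der by (intro energy_decreasing) (auto simp: sol_def)
    also have "\<dots> \<le> 0" using W_bounds(3)[of "t - 1"] that T by simp
    finally show ?thesis .
  qed
  have Wpos: "W b > 0" if b: "b < 0" for b
  proof (cases "b \<le> T")
    case False
    have cont: "continuous_on {T..b} W" "continuous_on {T..b} X"
      by (rule DERIV_atLeastAtMost_imp_continuous_on, rule exI, rule der, use b in linarith)+
    have "- W b < 0"
    proof (rule continuous_first_exit[of T b "\<lambda>t. - W t"])
      show "continuous_on {T..b} (\<lambda>t. - W t)" by (intro continuous_intros cont)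
      show "- W T < 0" using W_early by simp
      fix t assume t: "T < t" "t \<le> b" "\<forall>s\<in>{T..<t}. - W s < 0"
      have "energy t (W t) (X t) \<le> energy T (W T) (X T)"
        using t b W_bounds[of t] W_bounds[of T] T der
        by (intro energy_nonincreasing) (auto simp: sol_def intro: continuous_on_subset[OF cont(1)] continuous_on_subset[OF cont(2)])
      then have "energy t (W t) (X t) < 0" using early[of T] by simp
      then show "- W t \<noteq> 0" using sh_pos[of t] t b by (auto simp: energy_def mult_less_0_iff)
    qed (use False in auto)
    then show ?thesis by simp
  qed (use W_early in auto)
  have sol: "sol {..<0} W X" using der Wpos by (auto simp: sol_def)
  show thesis
  proof (rule that[OF C T sol])
    show "energy t (W t) (X t) < 0" if "t < 0" for t
      using energy_neg_of_nonpos[OF sol W_bounds(3) that] by blast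
    show "\<bar>W t - wapp t\<bar> \<le> C * (sh t)^4" if "t \<le> T" for t using W_app[OF that] .
  qed
qed

subsection \<open>Uniqueness and classification of singular profiles\<close>

lemma profile_unique:
  assumes sol1: "sol {..<0} W1 X1" and lim1: "(W1 \<longlongrightarrow> L) at_bot" "(X1 \<longlongrightarrow> 0) at_bot"
    and sol2: "sol {..<0} W2 X2" and lim2: "(W2 \<longlongrightarrow> L) at_bot" "(X2 \<longlongrightarrow> 0) at_bot"
    and t: "t < 0"
  shows "W1 t = W2 t"
proof (rule lyapunov_local)
  fix \<rho> T1 assume \<rho>: "0 < \<rho>" and lyap: "\<And>t w1 x1 w2 x2 r e. t \<le> T1 \<Longrightarrow> \<bar>w1 t - L\<bar> \<le> \<rho> \<Longrightarrow> \<bar>w2 t - L\<bar> \<le> \<rho> \<Longrightarrow>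
      (w1 has_real_derivative x1 t) (at t) \<Longrightarrow> (x1 has_real_derivative rhs t (w1 t) (x1 t)) (at t) \<Longrightarrow>
      (w2 has_real_derivative x2 t) (at t) \<Longrightarrow> (x2 has_real_derivative rhs t (w2 t) (x2 t) + r) (at t) \<Longrightarrow>
      \<bar>r\<bar> \<le> e \<Longrightarrow>
      \<exists>y. ((\<lambda>t. V (w1 t - w2 t) (x1 t - x2 t)) has_real_derivative y) (at t) \<and>
        y \<le> - \<delta> * V (w1 t - w2 t) (x1 t - x2 t) + K\<^sub>V * e^2"
  have der: "(W1 has_real_derivative X1 s) (at s)" "(X1 has_real_derivative rhs s (W1 s) (X1 s)) (at s)"
    "(W2 has_real_derivative X2 s) (at s)" "(X2 has_real_derivative rhs s (W2 s) (X2 s)) (at s)" if "s < 0" for s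
    using sol1 sol2 that by (auto simp: sol_def)
  have "\<forall>\<^sub>F s in at_bot. \<bar>W1 s - L\<bar> < \<rho> \<and> \<bar>W2 s - L\<bar> < \<rho> \<and> \<bar>X1 s\<bar> < 1 \<and> \<bar>X2 s\<bar> < 1 \<and> s \<le> T1 \<and> s < 0"
    using tendstoD[OF lim1(1) \<rho>] tendstoD[OF lim2(1) \<rho>] tendstoD[OF lim1(2) zero_less_one]
      tendstoD[OF lim2(2) zero_less_one] eventually_le_at_bot[of T1] eventually_at_bot_neg
    by eventually_elim (auto simp: dist_real_def)
  then obtain T where T: "\<And>s. s \<le> T \<Longrightarrow> \<bar>W1 s - L\<bar> < \<rho> \<and> \<bar>W2 s - L\<bar> < \<rho> \<and> \<bar>X1 s\<bar> < 1 \<and> \<bar>X2 s\<bar> < 1 \<and> s \<le> T1 \<and> s < 0"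
    unfolding eventually_at_bot_linorder by blast
  let ?V = "\<lambda>s. V (W1 s - W2 s) (X1 s - X2 s)"
  have "\<forall>s. \<exists>y. s \<le> T \<longrightarrow> (?V has_real_derivative y) (at s) \<and> y \<le> - \<delta> * ?V s"
  proof
    fix s
    show "\<exists>y. s \<le> T \<longrightarrow> (?V has_real_derivative y) (at s) \<and> y \<le> - \<delta> * ?V s"
    proof (cases "s \<le> T")
      case True
      then show ?thesis using lyap[of s W1 W2 X1 X2 0 0] der[of s] T[OF True] by auto
    qed auto
  qed
  then obtain D' where D': "\<And>s. s \<le> T \<Longrightarrow> (?V has_real_derivative D' s) (at s) \<and> D' s \<le> - \<delta> * ?V s"
    by metis
  have zero: "W1 s = W2 s \<and> X1 s = X2 s" if s: "s \<le> T" for s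
  proof -
    \<comment> \<open>\<open>V\<close> of the difference decays at rate \<open>\<delta>\<close>
      forward in time and is bounded back to \<open>- \<infinity>\<close>.\<close>
    have "?V s \<le> 0"
    proof (rule nonpos_of_decay_at_bot[of T ?V D' \<delta> "2^2 + Q * (2 * \<rho>)^2"])
      show "?V s \<le> 2^2 + Q * (2 * \<rho>)^2" if s: "s \<le> T" for s
      proof -
        have "?V s \<le> (X1 s - X2 s)^2 + Q * (W1 s - W2 s)^2" by (rule V_upper)
        also have "\<dots> \<le> 2^2 + Q * (2 * \<rho>)^2"
        proof (intro add_mono mult_left_mono)
          have b: "\<bar>X1 s - X2 s\<bar> \<le> 2" "\<bar>W1 s - W2 s\<bar> \<le> 2 * \<rho>" using T[OF s] by linarith+
          show "(X1 s - X2 s)^2 \<le> 2^2" by (rule iffD2[OF power2_le_iff_abs_le]) (use b in auto)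
          show "(W1 s - W2 s)^2 \<le> (2 * \<rho>)^2" by (rule iffD2[OF power2_le_iff_abs_le]) (use b \<rho> in auto)
        qed (use Q_pos in auto)
        finally show ?thesis .
      qed
    qed (use D' \<delta>_pos s in auto)
    then have "((X1 s - X2 s)^2 + Q * (W1 s - W2 s)^2) / 4 \<le> 0"
      by (rule order_trans[OF V_lower])
    then have *: "(X1 s - X2 s)^2 + Q * (W1 s - W2 s)^2 \<le> 0" by simp
    have "Q * (W1 s - W2 s)^2 \<ge> 0" using Q_pos by simp
    then have "(X1 s - X2 s)^2 = 0" "Q * (W1 s - W2 s)^2 = 0"
      using * zero_le_power2[of "X1 s - X2 s"] by linarith+
    then show ?thesis using Q_pos by auto
  qed
  show "W1 t = W2 t"
  proof (cases "t \<le> T")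
    case False
    have cont: "continuous_on {T..t} W1" "continuous_on {T..t} W2" "continuous_on {T..t} X1" "continuous_on {T..t} X2"
      by (rule DERIV_atLeastAtMost_imp_continuous_on, rule exI, rule der, use t in linarith)+
    have "compact (W1 ` {T..t} \<union> W2 ` {T..t})"
      using cont by (intro compact_Un compact_continuous_image) auto
    then obtain M where M: "M > 0" "\<And>y. y \<in> W1 ` {T..t} \<union> W2 ` {T..t} \<Longrightarrow> norm y \<le> M"
      using compact_imp_bounded bounded_pos by metis
    show ?thesis
    proof (rule gronwall_difference[OF M(1) t])
      fix G
      assume G: "\<And>s0 t' w1 x1 w2 x2.
     continuous_on {s0..t'} w1 \<Longrightarrow> continuous_on {s0..t'} x1 \<Longrightarrow> continuous_on {s0..t'} w2 \<Longrightarrow> continuous_on {s0..t'} x2 \<Longrightarrow>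
     sol {s0<..<t'} w1 x1 \<Longrightarrow> sol {s0<..<t'} w2 x2 \<Longrightarrow> s0 \<le> t' \<Longrightarrow> t' \<le> t \<Longrightarrow>
     (\<And>s. s \<in> {s0<..<t'} \<Longrightarrow> w1 s \<le> M \<and> w2 s \<le> M) \<Longrightarrow>
     (w1 t' - w2 t')^2 + (x1 t' - x2 t')^2 \<le> ((w1 s0 - w2 s0)^2 + (x1 s0 - x2 s0)^2) * exp (G * (t' - s0))"
      have "(W1 t - W2 t)^2 + (X1 t - X2 t)^2 \<le> ((W1 T - W2 T)^2 + (X1 T - X2 T)^2) * exp (G * (t - T))"
      proof (rule G)
        show "W1 s \<le> M \<and> W2 s \<le> M" if "s \<in> {T<..<t}" for s
          using M(2)[of "W1 s"] M(2)[of "W2 s"] that by (auto simp: abs_le_iff)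
        show "sol {T<..<t} W1 X1" "sol {T<..<t} W2 X2" using sol1 sol2 t by (auto simp: sol_def)
      qed (use cont False in auto)
      also have "\<dots> = 0" using zero[of T] by simp
      finally have "(W1 t - W2 t)^2 \<le> 0" using zero_le_power2[of "X1 t - X2 t"] by linarith
      then show ?thesis by simp
    qed
  qed (use zero in auto)
qed

end

section \<open>Convergence of an arbitrary singular profile to the rest point\<close>

locale singular_profile = hyperbolic_lane_emden +
  fixes W X :: "real \<Rightarrow> real"
  assumes sol: "sol {..<0} W X"
    and sing: "filterlim (\<lambda>t. sh t powr (- m) * W t) at_top at_bot"
begin

lemma der: "t < 0 \<Longrightarrow> (W has_real_derivative X t) (at t)"
    "t < 0 \<Longrightarrow> (X has_real_derivative rhs t (W t) (X t)) (at t)"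
  and W_pos: "t < 0 \<Longrightarrow> W t > 0"
  using sol by (auto simp: sol_def)

text \<open>\<open>v\<close> is the solution \<open>u\<close> in the variable \<open>t\<close>,
  \<open>v'\<close> its derivative in \<open>t\<close>, and \<open>q\<close> the coefficient that
  the nonlinearity contributes in
  \<open>v'' + 2 * \<nu> * ch * v' + (lam * sh^2 + q) * v = 0\<close>.\<close>

definition "v t = sh t powr (- m) * W t"
definition "v' t = sh t powr (- m) * (X t - m * ch t * W t)"
definition "q t = W t powr (p - 1)"

lemma v_pos: "t < 0 \<Longrightarrow> v t > 0" using sh_pos[of t] W_pos[of t] by (simp add: v_def)

lemma v_deriv: "t < 0 \<Longrightarrow> (v has_real_derivative v' t) (at t)"
  unfolding v_def[abs_def] v'_def
  by (rule DERIV_cong[OF DERIV_mult[OF sh_powr_deriv der(1)]]) (auto simp: algebra_simps)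

lemma v'_deriv:
  assumes t: "t < 0"
  shows "(v' has_real_derivative (- 2 * \<nu> * ch t * v' t - (lam * (sh t)^2 + q t) * v t)) (at t)"
proof -
  have 1: "((\<lambda>t. X t - m * ch t * W t) has_real_derivative rhs t (W t) (X t) - (m * (sh t)^2 * W t + m * ch t * X t)) (at t)"
    using t by (auto intro!: derivative_eq_intros der simp: algebra_simps)
  have c: "ch t * ch t = 1 + (sh t)^2" using ch_sq[OF t] by (simp add: power2_eq_square)
  have 2: "W t powr p = W t * q t" using powr_p W_pos[OF t] by (simp add: q_def)
  have 3: "- m * ch t * (X t - m * ch t * W t) + (rhs t (W t) (X t) - (m * (sh t)^2 * W t + m * ch t * X t))
    = - 2 * \<nu> * ch t * (X t - m * ch t * W t) - (lam * (sh t)^2 + q t) * W t"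
  proof -
    have e: "ch t * (X t - m * ch t * W t) = ch t * X t - m * (1 + (sh t)^2) * W t"
      unfolding c[symmetric] by (simp add: algebra_simps)
    have "- m * (ch t * (X t - m * ch t * W t)) + (rhs t (W t) (X t) - (m * (sh t)^2 * W t + m * ch t * X t))
       = - 2 * \<nu> * (ch t * (X t - m * ch t * W t)) - (lam * (sh t)^2 + q t) * W t"
      unfolding e rhs_def 2 a_def A_def B_def by (simp add: algebra_simps power2_eq_square)
    then show ?thesis by (simp add: mult.assoc)
  qed
  have "- m * ch t * sh t powr (- m) * (X t - m * ch t * W t)
      + (rhs t (W t) (X t) - (m * (sh t)^2 * W t + m * ch t * X t)) * sh t powr (- m)
    = sh t powr (- m) * (- m * ch t * (X t - m * ch t * W t) + (rhs t (W t) (X t) - (m * (sh t)^2 * W t + m * ch t * X t)))"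
    by (simp add: algebra_simps)
  also have "\<dots> = - 2 * \<nu> * ch t * v' t - (lam * (sh t)^2 + q t) * v t"
    unfolding 3 by (simp add: v'_def v_def algebra_simps)
  finally show ?thesis
    unfolding v'_def[abs_def] by (intro DERIV_cong[OF DERIV_mult[OF sh_powr_deriv[OF t] 1]]) (simp add: v'_def[symmetric])
qed

lemma q_eq: "t < 0 \<Longrightarrow> q t = (sh t)^2 * v t powr (p - 1)"
proof -
  assume t: "t < 0"
  have "- (m * (p - 1)) = - 2" using mp by simp
  then have "(sh t powr (- m)) powr (p - 1) = sh t powr (- 2)" by (simp add: powr_powr mult.commute)
  also have "\<dots> = 1 / (sh t)^2" using sh_pos[OF t] by (simp add: powr_minus_divide)
  finally show ?thesis
    using sh_pos[OF t] W_pos[OF t] by (simp add: v_def q_def powr_mult)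
qed

text \<open>Since \<open>v\<close> blows up, eventually
  \<open>v powr (p - 1) \<ge> 2 * \<bar>lam\<bar>\<close>, and \<open>q\<close> dominates the linear
  term. Then \<open>sh powr (2 * \<nu>) * v'\<close> is nonincreasing, so one positive value would
  make \<open>v\<close> nondecreasing on the whole half-line to the left, hence bounded
  there.\<close>

lemma early:
  obtains T where "T < 0" "\<And>t. t \<le> T \<Longrightarrow> ch t \<le> 2 \<and> sh t \<le> 1 \<and> v' t \<le> 0 \<and> lam * (sh t)^2 + q t \<ge> q t / 2"
proof -
  have "\<forall>\<^sub>F t in at_bot. v t > (2 * \<bar>lam\<bar>) powr (1 / (p - 1))"
    using sing unfolding v_def filterlim_at_top_dense by blast
  moreover have "\<forall>\<^sub>F t in at_bot. ch t < 2" "\<forall>\<^sub>F t in at_bot. sh t < 1"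
    using ch_tendsto_1 sh_tendsto_0 by (auto intro: order_tendstoD(2))
  ultimately have "\<forall>\<^sub>F t in at_bot. v t > (2 * \<bar>lam\<bar>) powr (1 / (p - 1)) \<and> ch t < 2 \<and> sh t < 1 \<and> t < 0"
    using eventually_at_bot_neg by eventually_elim auto
  then obtain T where T: "\<And>t. t \<le> T \<Longrightarrow> v t > (2 * \<bar>lam\<bar>) powr (1 / (p - 1)) \<and> ch t < 2 \<and> sh t < 1 \<and> t < 0"
    unfolding eventually_at_bot_linorder by blast
  have q: "lam * (sh t)^2 + q t \<ge> q t / 2" if t: "t \<le> T" for t
  proof -
    have "((2 * \<bar>lam\<bar>) powr (1 / (p - 1))) powr (p - 1) \<le> v t powr (p - 1)"
      using T[OF t] p_gt by (intro powr_mono2) auto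
    then have "2 * \<bar>lam\<bar> \<le> v t powr (p - 1)" using p_gt by (simp add: powr_powr)
    then have "(sh t)^2 * (2 * \<bar>lam\<bar>) \<le> q t" using T[OF t] by (simp add: q_eq mult_left_mono)
    moreover have "- ((sh t)^2 * \<bar>lam\<bar>) \<le> lam * (sh t)^2"
      by (metis abs_ge_minus_self abs_minus_cancel abs_mult abs_power2 minus_le_iff mult.commute)
    ultimately show ?thesis by simp
  qed
  have "v' t \<le> 0" if t: "t \<le> T" for t
  proof (rule ccontr)
    assume "\<not> v' t \<le> 0"
    then have v't: "v' t > 0" by simp
    have up: "v' s \<ge> 0" if s: "s \<le> t" for s
    proof -
      have "sh t powr (2 * \<nu>) * v' t \<le> sh s powr (2 * \<nu>) * v' s"
      proof (rule DERIV_nonpos_imp_nonincreasing[OF s])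
        fix x assume x: "s \<le> x" "x \<le> t"
        then have xT: "x \<le> T" "x < 0" using t T[of x] by auto
        have "((\<lambda>t. sh t powr (2 * \<nu>) * v' t) has_real_derivative
          - (sh x powr (2 * \<nu>) * ((lam * (sh x)^2 + q x) * v x))) (at x)"
          by (rule DERIV_cong[OF DERIV_mult[OF sh_powr_deriv[OF xT(2)] v'_deriv[OF xT(2)]]]) (simp add: algebra_simps)
        moreover have "q x / 2 \<ge> 0" by (simp add: q_def)
        then have "lam * (sh x)^2 + q x \<ge> 0" using q[OF xT(1)] by linarith
        then have "- (sh x powr (2 * \<nu>) * ((lam * (sh x)^2 + q x) * v x)) \<le> 0"
          using v_pos[OF xT(2)] by simp
        ultimately show "\<exists>y. ((\<lambda>t. sh t powr (2 * \<nu>) * v' t) has_real_derivative y) (at x) \<and> y \<le> 0" by blast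
      qed
      moreover have "sh t powr (2 * \<nu>) * v' t > 0" using v't sh_pos[of t] T[OF t] by simp
      ultimately have "sh s powr (2 * \<nu>) * v' s > 0" by linarith
      then show ?thesis by (simp add: zero_less_mult_iff)
    qed
    have "v s \<le> v t" if s: "s \<le> t" for s
    proof (rule DERIV_nonneg_imp_nondecreasing[OF s])
      fix x assume x: "s \<le> x" "x \<le> t"
      then have "x < 0" using t T[of x] by auto
      then show "\<exists>y. (v has_real_derivative y) (at x) \<and> y \<ge> 0" using v_deriv up x by blast
    qed
    moreover have "\<forall>\<^sub>F s in at_bot. v s > v t" using sing unfolding v_def filterlim_at_top_dense by blast
    then obtain s0 where "\<And>s. s \<le> s0 \<Longrightarrow> v s > v t" unfolding eventually_at_bot_linorder by blast
    ultimately show False using linorder_not_less[of "v t" "v (min s0 t)"] by auto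
  qed
  then show ?thesis using that[of T] T[of T] T q by (auto simp: less_imp_le)
qed

text \<open>Integrating \<open>(sh^(2 \<nu>) v')' \<le> - sh^(2 \<nu> + 2) v^p / 2\<close> twice, with \<open>v\<close> nonincreasing.\<close>

lemma W_bounded:
  obtains T M where "T < 0" "M > 0" "\<And>t. t \<le> T \<Longrightarrow> W t \<le> M"
proof (rule early)
  fix T assume T0: "T < 0" and T: "\<And>t. t \<le> T \<Longrightarrow> ch t \<le> 2 \<and> sh t \<le> 1 \<and> v' t \<le> 0 \<and> lam * (sh t)^2 + q t \<ge> q t / 2"
  \<comment> \<open>Chosen so that, with \<open>ch \<le> 2\<close>, the derivative of
    \<open>k * sh powr (2 * \<nu> + 2)\<close> is at most half of
    \<open>sh powr (2 * \<nu> + 2)\<close>, the half being that of \<open>q t / 2\<close> in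
    \<open>early\<close>.\<close>
  define k where "k = 1 / (8 * (\<nu> + 1))"
  have k: "k > 0" "k * (2 * \<nu> + 2) * 2 = 1 / 2" using \<nu>_pos by (auto simp: k_def field_simps)
  have first: "- v' t0 \<ge> k * (sh t0)^2 * v t0 powr p" if t0: "t0 \<le> T" for t0
  proof -
    define P where "P = v t0 powr p"
    have P: "P \<ge> 0" by (simp add: P_def)
    let ?g = "\<lambda>t. - (sh t powr (2 * \<nu>) * v' t) - k * P * sh t powr (2 * \<nu> + 2)"
    let ?g' = "\<lambda>t. sh t powr (2 * \<nu>) * ((lam * (sh t)^2 + q t) * v t) - k * P * ((2 * \<nu> + 2) * ch t * sh t powr (2 * \<nu> + 2))"
    have "0 \<le> ?g t0"
    proof (rule nonneg_of_nondecreasing_at_bot[of t0 ?g ?g' "\<lambda>t. - (k * P * sh t powr (2 * \<nu> + 2))"])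
      fix t assume t: "t \<le> t0"
      then have tT: "t \<le> T" "t < 0" using t0 T0 by auto
      have "((\<lambda>t. - (sh t powr (2 * \<nu>) * v' t)) has_real_derivative
          sh t powr (2 * \<nu>) * ((lam * (sh t)^2 + q t) * v t)) (at t)"
        by (rule DERIV_cong[OF DERIV_minus[OF DERIV_mult[OF sh_powr_deriv[OF tT(2)] v'_deriv[OF tT(2)]]]]) (simp add: algebra_simps)
      from DERIV_diff[OF this DERIV_cmult[OF sh_powr_deriv[OF tT(2)]]]
      show "(?g has_real_derivative ?g' t) (at t)" by simp
      have vv: "v t0 \<le> v t"
      proof (rule DERIV_nonpos_imp_nonincreasing[OF t])
        fix x assume "t \<le> x" "x \<le> t0"
        then have "x \<le> T" "x < 0" using t0 T0 by auto
        then show "\<exists>y. (v has_real_derivative y) (at x) \<and> y \<le> 0" using v_deriv T by blast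
      qed
      have s: "sh t powr (2 * \<nu> + 2) = sh t powr (2 * \<nu>) * (sh t)^2"
        using sh_pos[OF tT(2)] by (simp add: powr_add)
      have "k * P * ((2 * \<nu> + 2) * ch t) \<le> k * P * ((2 * \<nu> + 2) * 2)"
        using T[OF tT(1)] k P \<nu>_pos by (intro mult_left_mono) auto
      also have "\<dots> = P / 2"
      proof -
        have "k * P * ((2 * \<nu> + 2) * 2) = P * (k * (2 * \<nu> + 2) * 2)" by (simp add: algebra_simps)
        then show ?thesis unfolding k(2) by simp
      qed
      also have "\<dots> \<le> v t powr p / 2"
        using vv v_pos[of t0] t0 T0 p_gt by (auto simp: P_def intro!: powr_mono2)
      finally have "sh t powr (2 * \<nu> + 2) * (k * P * ((2 * \<nu> + 2) * ch t)) \<le> sh t powr (2 * \<nu> + 2) * (v t powr p / 2)"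
        by (intro mult_left_mono) auto
      moreover have "sh t powr (2 * \<nu>) * ((lam * (sh t)^2 + q t) * v t) \<ge> sh t powr (2 * \<nu>) * (q t / 2 * v t)"
        using T[OF tT(1)] v_pos[OF tT(2)] by (intro mult_left_mono mult_right_mono) auto
      moreover have "sh t powr (2 * \<nu>) * (q t / 2 * v t) = sh t powr (2 * \<nu> + 2) * (v t powr p / 2)"
        unfolding s using powr_p[of "v t"] v_pos[OF tT(2)] by (simp add: q_eq[OF tT(2)])
      ultimately show "0 \<le> ?g' t" by (simp add: mult_ac)
      show "- (k * P * sh t powr (2 * \<nu> + 2)) \<le> ?g t"
        using T[OF tT(1)] by (simp add: mult_nonneg_nonpos)
    next
      have "((\<lambda>t. - (k * P * sh t powr (2 * \<nu> + 2))) \<longlongrightarrow> - (k * P * 0 powr (2 * \<nu> + 2))) at_bot"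
        using \<nu>_pos
        by (intro tendsto_intros sh_tendsto_0) (auto intro!: eventually_mono[OF eventually_at_bot_neg] less_imp_le sh_pos)
      then show "((\<lambda>t. - (k * P * sh t powr (2 * \<nu> + 2))) \<longlongrightarrow> 0) at_bot" by simp
    qed simp
    moreover have "sh t0 powr (2 * \<nu> + 2) = sh t0 powr (2 * \<nu>) * (sh t0)^2"
      using sh_pos[of t0] t0 T0 by (simp add: powr_add)
    ultimately have "sh t0 powr (2 * \<nu>) * (k * (sh t0)^2 * P) \<le> sh t0 powr (2 * \<nu>) * (- v' t0)"
      by (simp add: algebra_simps)
    then have "k * (sh t0)^2 * P \<le> - v' t0"
      by (rule mult_left_le_imp_le) (use sh_pos[of t0] t0 T0 in simp)
    then show ?thesis by (simp add: P_def)
  qed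
  \<comment> \<open>With \<open>ch \<le> 2\<close> the derivative of \<open>k' * sh^2\<close> is at
    most \<open>(p - 1) * k * sh^2\<close>, the lower bound for that of
    \<open>v powr (1 - p)\<close>. The resulting inequality bounds
    \<open>sh^2 * v powr (p - 1)\<close>, which is \<open>q\<close>.\<close>
  define k' where "k' = (p - 1) * k / 4"
  have k': "k' > 0" using k p_gt by (simp add: k'_def)
  have second: "v t0 powr (1 - p) \<ge> k' * (sh t0)^2" if t0: "t0 \<le> T" for t0
  proof -
    let ?g = "\<lambda>t. v t powr (1 - p) - k' * (sh t)^2"
    let ?g' = "\<lambda>t. (1 - p) * v t powr (- p) * v' t - k' * (2 * sh t * (sh t * ch t))"
    have "0 \<le> ?g t0"
    proof (rule nonneg_of_nondecreasing_at_bot[of T ?g ?g' "\<lambda>t. - k' * (sh t)^2"])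
      fix t assume t: "t \<le> T"
      then have t1: "t < 0" using T0 by simp
      have "((\<lambda>t. v t powr (1 - p)) has_real_derivative (1 - p) * v t powr (- p) * v' t) (at t)"
        using DERIV_chain2[OF has_real_derivative_powr[OF v_pos[OF t1], of "1 - p"] v_deriv[OF t1]] by simp
      moreover have "((\<lambda>t. k' * (sh t)^2) has_real_derivative k' * (2 * sh t * (sh t * ch t))) (at t)"
        using t1 by (auto intro!: derivative_eq_intros)
      ultimately show "(?g has_real_derivative ?g' t) (at t)" by (rule DERIV_diff)
      have "(p - 1) * v t powr (- p) * (k * (sh t)^2 * v t powr p) \<le> (p - 1) * v t powr (- p) * (- v' t)"
        using first[OF t] p_gt by (intro mult_left_mono) auto
      moreover have "v t powr (- p) * v t powr p = 1" using v_pos[OF t1] by (simp flip: powr_add)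
      then have "(p - 1) * v t powr (- p) * (k * (sh t)^2 * v t powr p) = (p - 1) * k * (sh t)^2"
        by (simp add: mult_ac)
      moreover have "k' * (2 * sh t * (sh t * ch t)) \<le> k' * (2 * sh t * (sh t * 2))"
        using T[OF t] k' sh_pos[OF t1] by (intro mult_left_mono) auto
      moreover have "k' * (2 * sh t * (sh t * 2)) = (p - 1) * k * (sh t)^2" by (simp add: k'_def power2_eq_square)
      moreover have "(p - 1) * v t powr (- p) * (- v' t) = (1 - p) * v t powr (- p) * v' t" by (simp add: algebra_simps)
      ultimately show "0 \<le> ?g' t" by linarith
      show "- k' * (sh t)^2 \<le> ?g t" by simp
    qed (use t0 sh_power_tendsto_0[of 2 "- k'"] in auto)
    then show ?thesis by simp
  qed
  show thesis
  proof
    show "T < 0" by fact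
    show "(1 / k') powr (1 / (p - 1)) > 0" using k' by simp
    fix t assume t: "t \<le> T"
    then have t1: "t < 0" using T0 by simp
    have "v t powr (1 - p) * v t powr (p - 1) = 1" using v_pos[OF t1] by (simp flip: powr_add)
    moreover have "k' * (sh t)^2 * v t powr (p - 1) \<le> v t powr (1 - p) * v t powr (p - 1)"
      using second[OF t] by (intro mult_right_mono) auto
    ultimately have "k' * q t \<le> 1" by (simp add: q_eq[OF t1])
    then have "q t \<le> 1 / k'" using k' by (simp add: pos_le_divide_eq mult.commute)
    then have "q t powr (1 / (p - 1)) \<le> (1 / k') powr (1 / (p - 1))"
      using p_gt by (intro powr_mono2) (auto simp: q_def)
    then show "W t \<le> (1 / k') powr (1 / (p - 1))"
      using W_pos[OF t1] p_gt by (simp add: q_def powr_powr)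
  qed
qed

lemma bounded_and_vanishing:
  obtains T M where "T < 0" "M > 0" "\<And>t. t \<le> T \<Longrightarrow> W t \<le> M" "(X \<longlongrightarrow> 0) at_bot"
proof (rule early, rule W_bounded)
  fix T1 T2 M assume T1: "T1 < 0" "\<And>t. t \<le> T1 \<Longrightarrow> ch t \<le> 2 \<and> sh t \<le> 1 \<and> v' t \<le> 0 \<and> lam * (sh t)^2 + q t \<ge> q t / 2"
    and T2: "T2 < 0" and M: "M > 0" "\<And>t. t \<le> T2 \<Longrightarrow> W t \<le> M"
  define T where "T = min T1 T2"
  have T: "t < 0 \<and> ch t \<le> 2 \<and> ch t \<ge> 1 \<and> sh t > 0 \<and> (sh t)^2 \<le> 1 \<and> 0 < W t \<and> W t \<le> M" if "t \<le> T" for t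
    using T1(2)[of t] M(2)[of t] T1(1) T2 that W_pos[of t] sh_pos[of t] ch_ge_1[of t]
    by (auto simp: T_def power_le_one less_imp_le)
  define G where "G = a * M + (\<bar>A\<bar> + \<bar>B\<bar>) * M + M powr p"
  have Wp: "0 \<le> W t powr p \<and> W t powr p \<le> M powr p" if "t \<le> T" for t
    using T[OF that] p_gt by (auto intro!: powr_mono2)
  have AB: "\<bar>(A + B * (sh t)^2) * W t\<bar> \<le> (\<bar>A\<bar> + \<bar>B\<bar>) * M" if "t \<le> T" for t
  proof -
    have "\<bar>A + B * (sh t)^2\<bar> \<le> \<bar>A\<bar> + \<bar>B * (sh t)^2\<bar>" by (rule abs_triangle_ineq)
    also have "\<bar>B * (sh t)^2\<bar> \<le> \<bar>B\<bar> * 1" unfolding abs_mult using T[OF that] by (intro mult_left_mono) auto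
    finally show ?thesis unfolding abs_mult using T[OF that] by (intro mult_mono) auto
  qed
  have aW: "\<bar>a * ch t * W t\<bar> \<le> 2 * a * M" if "t \<le> T" for t
  proof -
    have "a * ch t * W t \<le> a * 2 * M" using T[OF that] a_pos M by (intro mult_mono) auto
    then show ?thesis using T[OF that] a_pos by (simp add: abs_mult)
  qed
  \<comment> \<open>Adding the integrated damping removes \<open>X\<close> from the derivative, so
    \<open>Y'\<close> is bounded by bounds on \<open>W\<close> alone. A mean value of
    \<open>W'\<close> bounds \<open>X\<close> at one time in each unit interval, and
    \<open>Y\<close> carries this to its end.\<close>
  define Y where "Y = (\<lambda>t. X t + a * ch t * W t)"
  have Y: "(Y has_real_derivative (a * (sh t)^2 * W t + (A + B * (sh t)^2) * W t - W t powr p)) (at t)" if "t \<le> T" for t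
    unfolding Y_def using T[OF that]
    by (auto intro!: derivative_eq_intros der simp: rhs_def algebra_simps)
  have Y': "\<bar>a * (sh t)^2 * W t + (A + B * (sh t)^2) * W t - W t powr p\<bar> \<le> G" if "t \<le> T" for t
  proof -
    have "a * (sh t)^2 * W t \<le> a * 1 * M" using T[OF that] a_pos by (intro mult_mono) auto
    moreover have "0 \<le> a * (sh t)^2 * W t" using T[OF that] a_pos by simp
    ultimately show ?thesis using AB[OF that] Wp[OF that] unfolding G_def by linarith
  qed
  define K where "K = M + 2 * a * M + G + 2 * a * M"
  have X: "\<bar>X t\<bar> \<le> K" if t: "t \<le> T" for t
  proof -
    obtain z where z: "t - 1 < z" "z < t" "W t - W (t - 1) = (t - (t - 1)) * X z"
      using MVT2[of "t - 1" t W X] der(1) T[OF t] by auto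
    have "\<bar>X z\<bar> \<le> M" using z T[OF t] T[of "t - 1"] t by auto
    obtain y where y: "z < y" "y < t" "Y t - Y z = (t - z) * (a * (sh y)^2 * W y + (A + B * (sh y)^2) * W y - W y powr p)"
      using MVT2[OF z(2), of Y "\<lambda>y. a * (sh y)^2 * W y + (A + B * (sh y)^2) * W y - W y powr p"] Y t by auto
    have "\<bar>Y t - Y z\<bar> \<le> 1 * G" unfolding y(3) abs_mult using y z t by (intro mult_mono Y') auto
    moreover have "\<bar>Y z\<bar> \<le> M + 2 * a * M" using \<open>\<bar>X z\<bar> \<le> M\<close> aW[of z] z t unfolding Y_def by linarith
    ultimately have "\<bar>Y t\<bar> \<le> M + 2 * a * M + G" by linarith
    then show ?thesis using aW[OF t] unfolding Y_def K_def by linarith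
  qed
  have K0: "K \<ge> 0" using X[of T] by simp
  \<comment> \<open>The term \<open>- \<kappa> * sh^2\<close> in \<open>E\<close> compensates the
    non-autonomous work \<open>B * sh^2 * W * X\<close>, so that \<open>E\<close> is dissipated at
    the rate \<open>a * X^2\<close>.\<close>
  define \<kappa> where "\<kappa> = \<bar>B\<bar> * M * K"
  define E where "E = (\<lambda>t. (X t)^2 / 2 - A * (W t)^2 / 2 + W t powr (p + 1) / (p + 1) - \<kappa> * (sh t)^2)"
  define E' where "E' = (\<lambda>t. - (a * ch t * (X t)^2) + B * (sh t)^2 * W t * X t - 2 * \<kappa> * (sh t)^2 * ch t)"
  have E: "(E has_real_derivative E' t) (at t)" if "t \<le> T" for t
  proof -
    have t: "t < 0" "W t > 0" using T[OF that] by auto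
    have "((\<lambda>t. W t powr (p + 1)) has_real_derivative (p + 1) * (W t powr p) * X t) (at t)"
      using DERIV_chain2[OF has_real_derivative_powr[OF t(2), of "p + 1"] der(1)[OF t(1)]] by simp
    from DERIV_cdivide[OF this, of "p + 1"]
    have 1: "((\<lambda>t. W t powr (p + 1) / (p + 1)) has_real_derivative W t powr p * X t) (at t)"
      using p_gt by (simp add: mult.assoc)
    have 2: "((\<lambda>t. (X t)^2 / 2 - A * (W t)^2 / 2) has_real_derivative X t * rhs t (W t) (X t) - A * W t * X t) (at t)"
      using t by (auto intro!: derivative_eq_intros der simp: algebra_simps)
    have 3: "((\<lambda>t. \<kappa> * (sh t)^2) has_real_derivative \<kappa> * (2 * sh t * (sh t * ch t))) (at t)"
      using t by (auto intro!: derivative_eq_intros)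
    show ?thesis unfolding E_def
      by (rule DERIV_cong[OF DERIV_diff[OF DERIV_add[OF 2 1] 3]])
        (simp add: E'_def rhs_def power2_eq_square algebra_simps)
  qed
  have E'_le: "E' t \<le> - (a * (X t)^2)" if "t \<le> T" for t
  proof -
    have "a * 1 * (X t)^2 \<le> a * ch t * (X t)^2" using T[OF that] a_pos by (intro mult_left_mono mult_right_mono) auto
    moreover have "B * (sh t)^2 * W t * X t \<le> \<kappa> * (sh t)^2"
    proof -
      have "B * W t * X t \<le> \<bar>B * W t * X t\<bar>" by simp
      also have "\<dots> \<le> \<kappa>" unfolding \<kappa>_def abs_mult using T[OF that] X[OF that] by (intro mult_mono) auto
      finally have "B * W t * X t * (sh t)^2 \<le> \<kappa> * (sh t)^2" by (intro mult_right_mono) auto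
      then show ?thesis by (simp add: mult_ac)
    qed
    moreover have "\<kappa> * (sh t)^2 * 1 \<le> \<kappa> * (sh t)^2 * ch t" using T[OF that] K0 M by (intro mult_left_mono) (auto simp: \<kappa>_def)
    moreover have "\<kappa> * (sh t)^2 \<ge> 0" using K0 M by (simp add: \<kappa>_def)
    ultimately show ?thesis unfolding E'_def by linarith
  qed
  have "((\<lambda>t. X (- t)) \<longlongrightarrow> 0) at_top"
  proof (rule tendsto_zero_of_dissipation[of "- T" "\<lambda>t. E (- t)" "\<lambda>t. - E' (- t)" a _ "K^2 / 2 + M powr (p + 1) / (p + 1)" "\<lambda>t. - rhs (- t) (W (- t)) (X (- t))" "2 * a * K + (\<bar>A\<bar> + \<bar>B\<bar>) * M + M powr p"])
    fix t assume "t \<ge> - T"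
    then have t: "- t \<le> T" by simp
    show "((\<lambda>t. E (- t)) has_real_derivative - E' (- t)) (at t)"
      using DERIV_chain2[OF E[OF t] DERIV_minus[OF DERIV_ident]] by simp
    show "a * (X (- t))^2 \<le> - E' (- t)" using E'_le[OF t] by simp
    have "(X (- t))^2 \<le> K^2" by (rule iffD2[OF power2_le_iff_abs_le[OF K0] X[OF t]])
    moreover have "W (- t) powr (p + 1) / (p + 1) \<le> M powr (p + 1) / (p + 1)"
      using T[OF t] p_gt by (intro divide_right_mono powr_mono2) auto
    moreover have "A * (W (- t))^2 \<ge> 0" "\<kappa> * (sh (- t))^2 \<ge> 0" using A_pos K0 M by (auto simp: \<kappa>_def)
    ultimately show "E (- t) \<le> K^2 / 2 + M powr (p + 1) / (p + 1)" unfolding E_def by linarith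
    have "- t < 0" using T[OF t] by simp
    from DERIV_chain2[OF der(2)[OF this] DERIV_minus[OF DERIV_ident]]
    show "((\<lambda>t. X (- t)) has_real_derivative - rhs (- t) (W (- t)) (X (- t))) (at t)" by simp
    have "\<bar>a * ch (- t) * X (- t)\<bar> \<le> a * 2 * K"
      unfolding abs_mult using T[OF t] a_pos X[OF t] by (intro mult_mono) auto
    then show "\<bar>- rhs (- t) (W (- t)) (X (- t))\<bar> \<le> 2 * a * K + (\<bar>A\<bar> + \<bar>B\<bar>) * M + M powr p"
      unfolding rhs_def using AB[OF t] Wp[OF t] by linarith
  qed (use a_pos in auto)
  then have "(X \<longlongrightarrow> 0) at_bot" by (simp add: filterlim_at_bot_mirror)
  then show thesis using that[of T M] T M(1) by auto
qed

lemma force_vanishes: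
  assumes "T < 0" "M > 0" "\<And>t. t \<le> T \<Longrightarrow> W t \<le> M" "(X \<longlongrightarrow> 0) at_bot"
  shows "((\<lambda>t. W t powr p - A * W t) \<longlongrightarrow> 0) at_bot"
proof -
  have "((\<lambda>t. W (- t) powr p - A * W (- t)) \<longlongrightarrow> 0) at_top"
  proof (rule force_tendsto_zero[of "\<lambda>t. W (- t)" "\<lambda>t. - X (- t)"
        "\<lambda>t. - a * ch (- t) * X (- t) + B * (sh (- t))^2 * W (- t)" "\<lambda>w. w powr p - A * w" M])
    have ev: "\<forall>\<^sub>F t in at_top. - t \<le> T"
      using eventually_ge_at_top[of "- T"] by eventually_elim auto
    show "\<forall>\<^sub>F t in at_top. ((\<lambda>t. W (- t)) has_real_derivative - X (- t)) (at t)"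
      using ev
    proof eventually_elim
      case (elim t)
      then have "- t < 0" using assms(1) by linarith
      from DERIV_chain2[OF der(1)[OF this] DERIV_minus[OF DERIV_ident]] show ?case by simp
    qed
    show "\<forall>\<^sub>F t in at_top. ((\<lambda>t. - X (- t)) has_real_derivative
        - a * ch (- t) * X (- t) + B * (sh (- t))^2 * W (- t) - (W (- t) powr p - A * W (- t))) (at t)"
      using ev
    proof eventually_elim
      case (elim t)
      then have "- t < 0" using assms(1) by linarith
      from DERIV_minus[OF DERIV_chain2[OF der(2)[OF this] DERIV_minus[OF DERIV_ident]]]
      show ?case by (simp add: rhs_def algebra_simps)
    qed
    have Xl: "((\<lambda>t. X (- t)) \<longlongrightarrow> 0) at_top" using assms(4) by (simp add: filterlim_at_bot_mirror)
    then show "((\<lambda>t. - X (- t)) \<longlongrightarrow> 0) at_top" using tendsto_minus[OF Xl] by simp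
    have cl: "((\<lambda>t. ch (- t)) \<longlongrightarrow> 1) at_top" "((\<lambda>t. \<bar>B\<bar> * M * (sh (- t))^2) \<longlongrightarrow> 0) at_top"
      using ch_tendsto_1 sh_power_tendsto_0[of 2 "\<bar>B\<bar> * M"] by (simp_all add: filterlim_at_bot_mirror)
    have "((\<lambda>t. B * (sh (- t))^2 * W (- t)) \<longlongrightarrow> 0) at_top"
    proof (rule Lim_null_comparison[OF _ cl(2)])
      show "\<forall>\<^sub>F t in at_top. norm (B * (sh (- t))^2 * W (- t)) \<le> \<bar>B\<bar> * M * (sh (- t))^2"
        using ev
      proof eventually_elim
        case (elim t)
        have "\<bar>B\<bar> * (sh (- t))^2 * W (- t) \<le> \<bar>B\<bar> * (sh (- t))^2 * M"
          using assms(3)[OF elim] by (intro mult_left_mono) auto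
        then show ?case using W_pos[of "- t"] elim assms(1) by (simp add: abs_mult mult_ac)
      qed
    qed
    from tendsto_add[OF tendsto_mult[OF tendsto_mult[OF tendsto_const[of "- a"] cl(1)] Xl] this]
    show "((\<lambda>t. - a * ch (- t) * X (- t) + B * (sh (- t))^2 * W (- t)) \<longlongrightarrow> 0) at_top" by simp
    show "continuous_on {0..M} (\<lambda>w. w powr p - A * w)"
      using p_gt by (intro continuous_intros continuous_on_powr') auto
    show "\<forall>\<^sub>F t in at_top. W (- t) \<in> {0..M}"
      using ev by eventually_elim (use assms W_pos in \<open>force intro: less_imp_le\<close>)
  qed
  then show ?thesis by (simp add: filterlim_at_bot_mirror)
qed

text \<open>If \<open>W\<close> vanished in the limit, the logarithmic derivative \<open>\<phi> = - v' / v\<close> would be integrable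
  near \<open>- \<infinity>\<close>, and \<open>v\<close> bounded.\<close>

lemma not_vanishing: "\<not> (W \<longlongrightarrow> 0) at_bot"
proof
  assume W0: "(W \<longlongrightarrow> 0) at_bot"
  define h where "h t = lam * (sh t)^2 + q t" for t
  have "((\<lambda>t. W t powr (p - 1)) \<longlongrightarrow> 0 powr (p - 1)) at_bot"
    using p_gt W0 by (intro tendsto_intros) (auto intro!: eventually_mono[OF eventually_at_bot_neg] less_imp_le W_pos)
  then have q0: "(q \<longlongrightarrow> 0) at_bot" by (simp add: q_def[abs_def])
  have h0: "(h \<longlongrightarrow> 0) at_bot"
    using tendsto_add[OF sh_power_tendsto_0[of 2 lam] q0] by (simp add: h_def[abs_def])
  obtain T0 where T0: "T0 < 0" "\<And>t. t \<le> T0 \<Longrightarrow> ch t \<le> 2 \<and> sh t \<le> 1 \<and> v' t \<le> 0 \<and> lam * (sh t)^2 + q t \<ge> q t / 2"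
    using early by blast
  have "\<forall>\<^sub>F t in at_bot. h t < min (\<nu>^2) (\<nu> * m / 2)"
    using \<nu>_pos m_pos by (intro order_tendstoD(2)[OF h0]) auto
  moreover have "\<forall>\<^sub>F t in at_bot. ch t < \<nu> / m"
    using m_less m_pos by (intro order_tendstoD(2)[OF ch_tendsto_1]) auto
  ultimately have "\<forall>\<^sub>F t in at_bot. h t < \<nu>^2 \<and> h t < \<nu> * m / 2 \<and> m * ch t < \<nu> \<and> t \<le> T0 \<and> t < 0"
    using eventually_le_at_bot[of T0] eventually_at_bot_neg
    by eventually_elim (use m_pos in \<open>auto simp: field_simps\<close>)
  then obtain T where T: "\<And>t. t \<le> T \<Longrightarrow> h t < \<nu>^2 \<and> h t < \<nu> * m / 2 \<and> m * ch t < \<nu> \<and> t \<le> T0 \<and> t < 0"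
    unfolding eventually_at_bot_linorder by blast
  have Tneg: "t < 0" if "t \<le> T" for t using T[OF that] by simp
  have v'0: "v' t \<le> 0" "sh t \<le> 1" "ch t \<ge> 1" if "t \<le> T" for t
    using T[OF that] T0(2)[of t] ch_ge_1[of t] by auto
  \<comment> \<open>The starting bound \<open>\<phi> \<le> \<nu>\<close>, which tames the quadratic
    Riccati term. If it fails at \<open>t\<close>, monotonicity of
    \<open>exp (\<nu> * t) * (v' + \<nu> * v)\<close> makes it fail on all of \<open>{..t}\<close>.
    There \<open>X \<le> (m * ch - \<nu>) * W \<le> 0\<close>, so \<open>W\<close> is nonincreasing
    and starts from the limit 0, which contradicts \<open>W t > 0\<close>.\<close>
  have v'_ge: "v' t \<ge> - \<nu> * v t" if t: "t \<le> T" for t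
  proof (rule ccontr)
    assume "\<not> v' t \<ge> - \<nu> * v t"
    then have neg: "v' t + \<nu> * v t < 0" by simp
    let ?G = "\<lambda>t. exp (\<nu> * t) * (v' t + \<nu> * v t)"
    have "v' s + \<nu> * v s < 0" if s: "s \<le> t" for s
    proof -
      have "?G s \<le> ?G t"
      proof (rule DERIV_nonneg_imp_nondecreasing[OF s])
        fix x assume x: "s \<le> x" "x \<le> t"
        then have xT: "x \<le> T" using t by simp
        have e: "((\<lambda>t. exp (\<nu> * t)) has_real_derivative \<nu> * exp (\<nu> * x)) (at x)"
          by (auto intro!: derivative_eq_intros)
        have "(?G has_real_derivative exp (\<nu> * x) * (2 * \<nu> * (1 - ch x) * v' x + (\<nu>^2 - h x) * v x)) (at x)"
          by (rule DERIV_cong[OF DERIV_mult[OF e DERIV_add[OF v'_deriv[OF Tneg[OF xT]] DERIV_cmult[OF v_deriv[OF Tneg[OF xT]]]]]])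
            (simp add: h_def power2_eq_square algebra_simps)
        moreover have "2 * \<nu> * (1 - ch x) * v' x + (\<nu>^2 - h x) * v x \<ge> 0"
        proof (intro add_nonneg_nonneg)
          show "2 * \<nu> * (1 - ch x) * v' x \<ge> 0" by (rule mult_nonpos_nonpos[OF mult_nonneg_nonpos]) (use v'0[OF xT] \<nu>_pos in auto)
          show "(\<nu>^2 - h x) * v x \<ge> 0" using T[OF xT] v_pos[OF Tneg[OF xT]] by (intro mult_nonneg_nonneg) auto
        qed
        ultimately show "\<exists>y. (?G has_real_derivative y) (at x) \<and> y \<ge> 0"
          by (meson exp_ge_zero mult_nonneg_nonneg)
      qed
      moreover have "?G t < 0" using neg by (simp add: mult_pos_neg)
      ultimately have "?G s < 0" by linarith
      then show ?thesis by (simp add: mult_less_0_iff)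
    qed
    then have Xneg: "X s \<le> 0" if s: "s \<le> t" for s
    proof -
      have sT: "s \<le> T" using s t by simp
      have "sh s powr (- m) * (X s - m * ch s * W s + \<nu> * W s) < 0"
        using \<open>\<And>s. s \<le> t \<Longrightarrow> v' s + \<nu> * v s < 0\<close>[OF s] by (simp add: v'_def v_def algebra_simps)
      then have "X s - m * ch s * W s + \<nu> * W s < 0" using sh_pos[OF Tneg[OF sT]] by (simp add: mult_less_0_iff)
      then have "X s < (m * ch s - \<nu>) * W s" by (simp add: algebra_simps)
      also have "\<dots> \<le> 0" using T[OF sT] W_pos[OF Tneg[OF sT]] by (intro mult_nonpos_nonneg) auto
      finally show ?thesis by simp
    qed
    have "W t \<le> W s" if s: "s \<le> t" for s
    proof (rule DERIV_nonpos_imp_nonincreasing[OF s])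
      fix x assume "s \<le> x" "x \<le> t"
      then show "\<exists>y. (W has_real_derivative y) (at x) \<and> y \<le> 0"
        using der(1)[of x] Xneg[of x] Tneg[of x] t by auto
    qed
    then have "W t \<le> 0"
      by (intro tendsto_lowerbound[OF W0]) (auto simp: eventually_at_bot_linorder)
    then show False using W_pos[OF Tneg[OF t]] by simp
  qed
  define \<phi> where "\<phi> t = - v' t / v t" for t
  have \<phi>: "0 \<le> \<phi> t" "\<phi> t \<le> \<nu>" if "t \<le> T" for t
    using v'0[OF that] v'_ge[OF that] v_pos[OF Tneg[OF that]] by (auto simp: \<phi>_def field_simps)
  define \<phi>' where "\<phi>' t = - 2 * \<nu> * ch t * \<phi> t + h t + (\<phi> t)^2" for t
  have \<phi>_der: "(\<phi> has_real_derivative \<phi>' t) (at t)" if "t \<le> T" for t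
  proof -
    have vp: "v t \<noteq> 0" using v_pos[OF Tneg[OF that]] by simp
    have "(\<phi> has_real_derivative (- (- 2 * \<nu> * ch t * v' t - h t * v t) * v t - - v' t * v' t) / (v t * v t)) (at t)"
      unfolding \<phi>_def[abs_def] h_def
      by (intro DERIV_divide DERIV_minus v'_deriv v_deriv Tneg[OF that] vp)
    moreover have "(- (- 2 * \<nu> * ch t * v' t - h t * v t) * v t - - v' t * v' t) / (v t * v t) = \<phi>' t"
      using vp by (simp add: \<phi>'_def \<phi>_def power2_eq_square field_simps)
    ultimately show ?thesis by simp
  qed
  have \<phi>'_le: "\<phi>' t \<le> - \<nu> * \<phi> t + h t" if "t \<le> T" for t
  proof -
    have "\<phi> t * \<phi> t \<le> \<nu> * \<phi> t" using \<phi>[OF that] by (intro mult_right_mono) auto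
    moreover have "2 * \<nu> * 1 * \<phi> t \<le> 2 * \<nu> * ch t * \<phi> t"
      using \<phi>[OF that] v'0(3)[OF that] \<nu>_pos by (intro mult_right_mono mult_left_mono) auto
    ultimately show ?thesis by (simp add: \<phi>'_def power2_eq_square)
  qed
  \<comment> \<open>The inequality \<open>\<phi>' \<le> - \<nu> * \<phi> + h\<close> contracts to
    the size \<open>h / \<nu> < m / 2\<close>.\<close>
  have \<phi>_small: "\<phi> t \<le> m / 2" if "t \<le> T" for t
  proof -
    have "\<phi> t - m / 2 \<le> 0"
    proof (rule nonpos_of_decay_at_bot[of T "\<lambda>t. \<phi> t - m / 2" \<phi>' \<nu> \<nu>])
      show "((\<lambda>t. \<phi> t - m / 2) has_real_derivative \<phi>' t) (at t)" if "t \<le> T" for t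
        using DERIV_diff[OF \<phi>_der[OF that] DERIV_const] by simp
      show "\<phi>' t \<le> - \<nu> * (\<phi> t - m / 2)" if "t \<le> T" for t
        using \<phi>'_le[OF that] T[OF that] by (simp add: algebra_simps)
      show "\<phi> t - m / 2 \<le> \<nu>" if "t \<le> T" for t using \<phi>[OF that] m_pos by simp
    qed (use that \<nu>_pos in auto)
    then show ?thesis by simp
  qed
  \<comment> \<open>As \<open>W' / W = m * ch - \<phi>\<close> and
    \<open>\<phi> \<le> m / 2\<close>, \<open>W\<close> vanishes at least like
    \<open>sh powr (m / 4)\<close>. By \<open>m * (p - 1) = 2\<close> this makes \<open>q\<close>,
    and then \<open>h\<close>, of order \<open>sh powr (1 / 2)\<close>.\<close>
  define K0 where "K0 = W T * sh T powr (- (m / 4))"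
  have W_le: "W t \<le> K0 * sh t powr (m / 4)" if t: "t \<le> T" for t
  proof -
    let ?G = "\<lambda>t. sh t powr (- (m / 4)) * W t"
    have "?G t \<le> ?G T"
    proof (rule DERIV_nonneg_imp_nondecreasing[OF t])
      fix x assume x: "t \<le> x" "x \<le> T"
      note x0 = Tneg[OF x(2)]
      have "(?G has_real_derivative sh x powr (- (m / 4)) * (X x - m / 4 * ch x * W x)) (at x)"
        by (rule DERIV_cong[OF DERIV_mult[OF sh_powr_deriv[OF x0] der(1)[OF x0]]]) (simp add: algebra_simps)
      moreover have "X x - m / 4 * ch x * W x \<ge> 0"
      proof -
        have "v' x = - \<phi> x * v x" using v_pos[OF x0] by (simp add: \<phi>_def)
        then have "sh x powr (- m) * (X x - m * ch x * W x + \<phi> x * W x) = 0"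
          by (simp add: v'_def v_def algebra_simps)
        then have "X x - m * ch x * W x + \<phi> x * W x = 0" using sh_pos[OF x0] by simp
        then have "X x = (m * ch x - \<phi> x) * W x" by (simp add: algebra_simps)
        then have "X x - m / 4 * ch x * W x = (3 * m / 4 * ch x - \<phi> x) * W x" by (simp add: algebra_simps)
        moreover have "3 * m / 4 * 1 \<le> 3 * m / 4 * ch x" using v'0(3)[OF x(2)] m_pos by (intro mult_left_mono) auto
        then have "3 * m / 4 * ch x - \<phi> x \<ge> 0" using \<phi>_small[OF x(2)] m_pos by linarith
        then have "(3 * m / 4 * ch x - \<phi> x) * W x \<ge> 0" using W_pos[OF x0] by (intro mult_nonneg_nonneg) auto
        ultimately show ?thesis by simp
      qed
      ultimately show "\<exists>y. (?G has_real_derivative y) (at x) \<and> y \<ge> 0"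
        by (meson mult_nonneg_nonneg powr_ge_zero)
    qed
    then have "sh t powr (m / 4) * (sh t powr (- (m / 4)) * W t) \<le> sh t powr (m / 4) * K0"
      by (intro mult_left_mono) (auto simp: K0_def mult.commute)
    moreover have "sh t powr (m / 4) * (sh t powr (- (m / 4)) * W t) = W t"
      using sh_pos[OF Tneg[OF t]] by (simp add: powr_minus)
    ultimately show ?thesis by (simp only: mult.commute[of K0])
  qed
  have K0: "K0 > 0" using W_pos[OF Tneg[OF order_refl]] sh_pos[OF Tneg[OF order_refl]] by (simp add: K0_def)
  define K where "K = \<bar>lam\<bar> + K0 powr (p - 1)"
  have h_le: "h t \<le> K * sh t powr (1 / 2)" if t: "t \<le> T" for t
  proof -
    note t0 = Tneg[OF t]
    have "q t \<le> (K0 * sh t powr (m / 4)) powr (p - 1)"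
      unfolding q_def using W_le[OF t] W_pos[OF t0] p_gt by (intro powr_mono2) auto
    also have "\<dots> = K0 powr (p - 1) * sh t powr (m / 4 * (p - 1))"
      using K0 by (simp add: powr_mult powr_powr)
    also have "m / 4 * (p - 1) = 1 / 2" using mp by simp
    finally have q: "q t \<le> K0 powr (p - 1) * sh t powr (1 / 2)" .
    have "(sh t)^2 = sh t powr 2" using sh_pos[OF t0] by simp
    also have "\<dots> \<le> sh t powr (1 / 2)" using sh_pos[OF t0] v'0(2)[OF t] by (intro powr_mono') auto
    finally have "\<bar>lam\<bar> * (sh t)^2 \<le> \<bar>lam\<bar> * sh t powr (1 / 2)" by (intro mult_left_mono) auto
    moreover have "lam * (sh t)^2 \<le> \<bar>lam\<bar> * (sh t)^2" by (intro mult_right_mono) auto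
    ultimately show ?thesis using q by (simp add: h_def K_def distrib_right)
  qed
  have K: "K \<ge> 0" by (simp add: K_def)
  \<comment> \<open>The barrier \<open>2 * K * sh powr (1 / 2)\<close> has the derivative
    \<open>K * ch * sh powr (1 / 2)\<close>, which dominates \<open>h\<close>.\<close>
  have \<phi>_le: "\<phi> t \<le> 2 * K * sh t powr (1 / 2)" if t: "t \<le> T" for t
  proof -
    let ?D' = "\<lambda>t. \<phi>' t - 2 * K * (1 / 2 * ch t * sh t powr (1 / 2))"
    have "\<phi> t - 2 * K * sh t powr (1 / 2) \<le> 0"
    proof (rule nonpos_of_decay_at_bot[of T "\<lambda>t. \<phi> t - 2 * K * sh t powr (1 / 2)" ?D' \<nu> \<nu>])
      fix t assume t: "t \<le> T"
      show "((\<lambda>t. \<phi> t - 2 * K * sh t powr (1 / 2)) has_real_derivative ?D' t) (at t)"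
        by (rule DERIV_diff[OF \<phi>_der[OF t] DERIV_cmult[OF sh_powr_deriv[OF Tneg[OF t]]]])
      have "K * sh t powr (1 / 2) * 1 \<le> K * sh t powr (1 / 2) * ch t"
        using v'0(3)[OF t] K by (intro mult_left_mono) auto
      moreover have "\<nu> * (K * sh t powr (1 / 2)) \<ge> 0" using K \<nu>_pos by simp
      ultimately show "?D' t \<le> - \<nu> * (\<phi> t - 2 * K * sh t powr (1 / 2))"
        using \<phi>'_le[OF t] h_le[OF t] by (simp add: algebra_simps)
      show "\<phi> t - 2 * K * sh t powr (1 / 2) \<le> \<nu>" using \<phi>[OF t] K
        by (smt (verit) mult_nonneg_nonneg powr_ge_zero)
    qed (use t \<nu>_pos in auto)
    then show ?thesis by simp
  qed
  \<comment> \<open>The bound on \<open>\<phi>\<close> is integrable at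
    \<open>- \<infinity>\<close>: \<open>4 * K * sh powr (1 / 2)\<close> has a derivative of at
    least that bound, since \<open>ch \<ge> 1\<close>.\<close>
  have v_le: "ln (v t) \<le> ln (v T) + 4 * K * sh T powr (1 / 2)" if t: "t \<le> T" for t
  proof -
    let ?G = "\<lambda>t. ln (v t) + 4 * K * sh t powr (1 / 2)"
    have "?G t \<le> ?G T"
    proof (rule DERIV_nonneg_imp_nondecreasing[OF t])
      fix x assume x: "t \<le> x" "x \<le> T"
      note x0 = Tneg[OF x(2)]
      have "((\<lambda>t. ln (v t)) has_real_derivative - \<phi> x) (at x)"
        using DERIV_chain2[OF DERIV_ln[OF v_pos[OF x0]] v_deriv[OF x0]] by (simp add: \<phi>_def field_simps)
      then have "(?G has_real_derivative - \<phi> x + 4 * K * (1 / 2 * ch x * sh x powr (1 / 2))) (at x)"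
        by (intro DERIV_add DERIV_cmult sh_powr_deriv x0)
      moreover have "K * sh x powr (1 / 2) * 1 \<le> K * sh x powr (1 / 2) * ch x"
        using v'0(3)[OF x(2)] K by (intro mult_left_mono) auto
      then have "- \<phi> x + 4 * K * (1 / 2 * ch x * sh x powr (1 / 2)) \<ge> 0"
        using \<phi>_le[OF x(2)] by (simp add: algebra_simps)
      ultimately show "\<exists>y. (?G has_real_derivative y) (at x) \<and> y \<ge> 0" by blast
    qed
    moreover have "4 * K * sh t powr (1 / 2) \<ge> 0" using K by simp
    ultimately show ?thesis by linarith
  qed
  have "\<forall>\<^sub>F t in at_bot. v t > exp (ln (v T) + 4 * K * sh T powr (1 / 2))"
    using sing unfolding v_def filterlim_at_top_dense by blast
  from eventually_happens'[OF trivial_limit_at_bot_linorder eventually_conj[OF eventually_le_at_bot[of T] this]]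
  obtain t where t: "t \<le> T" "v t > exp (ln (v T) + 4 * K * sh T powr (1 / 2))" by blast
  then have "ln (v t) > ln (v T) + 4 * K * sh T powr (1 / 2)"
    using v_pos[OF Tneg[OF t(1)]] by (metis exp_less_cancel_iff exp_ln)
  then show False using v_le[OF t(1)] by simp
qed

theorem profile_tendsto: "(W \<longlongrightarrow> L) at_bot" "(X \<longlongrightarrow> 0) at_bot"
proof -
  obtain T0 M where T0: "T0 < 0" "M > 0" "\<And>t. t \<le> T0 \<Longrightarrow> W t \<le> M" and X0: "(X \<longlongrightarrow> 0) at_bot"
    using bounded_and_vanishing by blast
  then show "(X \<longlongrightarrow> 0) at_bot" by simp
  have "((\<lambda>t. W (- t)) \<longlongrightarrow> 0) at_top \<or> ((\<lambda>t. W (- t)) \<longlongrightarrow> A powr (1 / (p - 1))) at_top"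
  proof (rule power_force_dichotomy[OF A_pos p_gt])
    show "continuous_on {1..} (\<lambda>t. W (- t))"
    proof (rule DERIV_continuous_on)
      fix t :: real assume "t \<in> {1..}"
      then have "- t < 0" by simp
      from DERIV_chain2[OF der(1)[OF this] DERIV_minus[OF DERIV_ident]]
      show "((\<lambda>t. W (- t)) has_real_derivative X (- t) * - 1) (at t within {1..})"
        by (rule has_field_derivative_at_within)
    qed
    show "((\<lambda>t. W (- t) powr p - A * W (- t)) \<longlongrightarrow> 0) at_top"
      using force_vanishes[OF T0 X0] by (simp add: filterlim_at_bot_mirror)
  qed (simp add: W_pos)
  then show "(W \<longlongrightarrow> L) at_bot"
    using not_vanishing by (auto simp: L_def filterlim_at_bot_mirror)
qed

end

subsection \<open>Behaviour at infinity\<close>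

definition ct :: "real \<Rightarrow> real" where "ct r = cosh r / sinh r"

lemma coth_tendsto_1: "(ct \<longlongrightarrow> 1) at_top"
proof (rule Lim_transform_eventually)
  have "((\<lambda>r::real. exp (- 2 * r)) \<longlongrightarrow> 0) at_top"
    by (intro filterlim_compose[OF exp_at_bot] filterlim_tendsto_neg_mult_at_bot[OF tendsto_const _ filterlim_ident]) auto
  then have "((\<lambda>r::real. (1 + exp (- 2 * r)) / (1 - exp (- 2 * r))) \<longlongrightarrow> (1 + 0) / (1 - 0)) at_top"
    by (intro tendsto_intros) auto
  then show "((\<lambda>r::real. (1 + exp (- 2 * r)) / (1 - exp (- 2 * r))) \<longlongrightarrow> 1) at_top" by simp
  show "\<forall>\<^sub>F r in at_top. (1 + exp (- 2 * r)) / (1 - exp (- 2 * r)) = ct r"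
    using eventually_gt_at_top[of 0]
  proof eventually_elim
    case (elim r)
    have e: "exp (- 2 * r) = exp (- r) * exp (- r)" by (simp flip: exp_add)
    have "(1 + exp (- 2 * r)) / (1 - exp (- 2 * r)) = (exp r * (1 + exp (- 2 * r))) / (exp r * (1 - exp (- 2 * r)))"
      by simp
    also have "exp r * (1 + exp (- 2 * r)) = 2 * cosh r"
      unfolding e by (simp add: cosh_def algebra_simps exp_minus)
    also have "exp r * (1 - exp (- 2 * r)) = 2 * sinh r"
      unfolding e by (simp add: sinh_def algebra_simps exp_minus)
    finally show ?case by (simp add: ct_def)
  qed
qed

text \<open>Here \<open>v\<close> is the derivative of \<open>u\<close> in \<open>r\<close>. The
  assumption \<open>energy\<close> is \<open>energy_inequality\<close> divided by
  \<open>(sinh r)^2\<close> and written in \<open>r\<close>, where it bounds the logarithmic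
  derivative \<open>v / u\<close>.\<close>

locale hyperbolic_decay =
  fixes \<nu> p lam :: real and u v :: "real \<Rightarrow> real"
  assumes \<nu>_pos: "\<nu> > 0" and p_gt: "p > 1" and lam_le: "lam \<le> \<nu> * (\<nu> + 1)"
    and u_pos: "\<And>r. r > 0 \<Longrightarrow> u r > 0"
    and du: "\<And>r. r > 0 \<Longrightarrow> (u has_real_derivative v r) (at r)"
    and dv: "\<And>r. r > 0 \<Longrightarrow> (v has_real_derivative
       (- (2 * \<nu> + 1) * ct r * v r - lam * u r - u r powr p)) (at r)"
    and energy: "\<And>r. r > 0 \<Longrightarrow> (v r / u r + \<nu> * ct r)^2 + 2 / (p + 1) * u r powr (p - 1)
       < \<nu>^2 / (sinh r)^2 + (\<nu> * (\<nu> + 1) - lam)"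
begin

text \<open>\<open>- \<mu>\<close> and \<open>- \<mu>'\<close> are the roots of the characteristic equation
  \<open>x^2 + (2 \<nu> + 1) x + lam = 0\<close> at infinity.\<close>

definition "\<Lambda> = \<nu> * (\<nu> + 1) - lam"
definition "\<kappa> = sqrt (\<Lambda> + 1 / 4)"
definition "\<mu> = \<nu> + 1 / 2 - \<kappa>"
definition "\<mu>' = \<nu> + 1 / 2 + \<kappa>"
definition "\<psi> r = v r / u r"

lemma \<Lambda>_nonneg: "\<Lambda> \<ge> 0" using lam_le by (simp add: \<Lambda>_def)

lemma roots: "\<mu> + \<mu>' = 2 * \<nu> + 1" "\<mu> * \<mu>' = lam"
proof -
  have "\<kappa>^2 = \<Lambda> + 1 / 4" using \<Lambda>_nonneg by (simp add: \<kappa>_def)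
  then show "\<mu> * \<mu>' = lam" by (simp add: \<mu>_def \<mu>'_def \<Lambda>_def power2_eq_square algebra_simps)
qed (simp add: \<mu>_def \<mu>'_def)

lemma \<mu>'_pos: "\<mu>' > 0" using \<nu>_pos \<Lambda>_nonneg by (simp add: \<mu>'_def \<kappa>_def add_pos_nonneg)

text \<open>The energy excludes the fast decay rate \<open>\<mu>'\<close>.\<close>

lemma \<mu>'_gap: "\<mu>' \<ge> \<nu> + sqrt \<Lambda> + 1 / 2"
  by (simp add: \<mu>'_def \<kappa>_def)

lemma ct_ge_1: "r > 0 \<Longrightarrow> ct r \<ge> 1"
  using sinh_le_cosh_real[of r] by (simp add: ct_def)

lemma \<psi>_bound:
  assumes "r > 0" shows "\<bar>\<psi> r + \<nu> * ct r\<bar> < sqrt (\<nu>^2 / (sinh r)^2 + \<Lambda>)"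
proof (rule real_less_rsqrt)
  have "2 / (p + 1) * u r powr (p - 1) \<ge> 0" using p_gt by simp
  then show "\<bar>\<psi> r + \<nu> * ct r\<bar>^2 < \<nu>^2 / (sinh r)^2 + \<Lambda>"
    using energy[OF assms] unfolding \<psi>_def \<Lambda>_def by simp
qed

lemma sqrt_tendsto: "((\<lambda>r. sqrt (\<nu>^2 / (sinh r)^2 + \<Lambda>)) \<longlongrightarrow> sqrt \<Lambda>) at_top"
proof -
  have "((\<lambda>r. \<nu>^2 / (sinh r)^2) \<longlongrightarrow> 0) at_top"
    by (rule tendsto_divide_0[OF tendsto_const])
      (intro filterlim_at_top_imp_at_infinity filterlim_pow_at_top sinh_real_at_top, simp)
  from tendsto_real_sqrt[OF tendsto_add[OF this tendsto_const[of \<Lambda>]]] show ?thesis by simp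
qed

lemma \<psi>_bounded: obtains K where "\<forall>\<^sub>F r in at_top. \<bar>\<psi> r\<bar> \<le> K"
proof -
  have "\<forall>\<^sub>F r in at_top. sqrt (\<nu>^2 / (sinh r)^2 + \<Lambda>) < sqrt \<Lambda> + 1" "\<forall>\<^sub>F r in at_top. ct r < 2"
    using sqrt_tendsto coth_tendsto_1 by (auto intro: order_tendstoD(2))
  with eventually_gt_at_top[of 0] have "\<forall>\<^sub>F r in at_top. \<bar>\<psi> r\<bar> \<le> sqrt \<Lambda> + 1 + 2 * \<nu>"
  proof eventually_elim
    case (elim r)
    have "\<nu> * ct r \<le> \<nu> * 2" "\<nu> * ct r \<ge> 0" using elim \<nu>_pos ct_ge_1[of r] by (auto intro!: mult_left_mono)
    then show ?case using \<psi>_bound[OF elim(1)] elim by linarith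
  qed
  then show thesis by (rule that)
qed

text \<open>The quantity \<open>\<psi> + \<mu>'\<close> is the damping coefficient in
  \<open>\<psi>_deriv\<close>. Of the gap 1/2 in \<open>\<mu>'_gap\<close>, one half is given to the
  convergence of \<open>ct\<close> and of the square root.\<close>

lemma \<psi>_lower: "\<forall>\<^sub>F r in at_top. \<psi> r + \<mu>' \<ge> 1 / 4"
proof -
  have "((\<lambda>r. \<nu> * ct r + sqrt (\<nu>^2 / (sinh r)^2 + \<Lambda>)) \<longlongrightarrow> \<nu> * 1 + sqrt \<Lambda>) at_top"
    by (intro tendsto_intros coth_tendsto_1 sqrt_tendsto)
  then have "\<forall>\<^sub>F r in at_top. \<nu> * ct r + sqrt (\<nu>^2 / (sinh r)^2 + \<Lambda>) < \<nu> + sqrt \<Lambda> + 1 / 4"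
    by (intro order_tendstoD(2)) auto
  with eventually_gt_at_top[of 0] show ?thesis
  proof eventually_elim
    case (elim r)
    then show ?case using \<psi>_bound[OF elim(1)] \<mu>'_gap by linarith
  qed
qed

definition "err r = - (2 * \<nu> + 1) * (ct r - 1) * \<psi> r - u r powr (p - 1)"

text \<open>The Riccati polynomial \<open>\<psi>^2 + (2 * \<nu> + 1) * \<psi> + lam\<close> is
  factored by its roots. Reading one factor as a coefficient and the other as the unknown gives a
  damped linear equation, forced by \<open>err\<close>, which collects what fades when
  \<open>u\<close> tends to 0.\<close>

lemma \<psi>_deriv:
  assumes r: "r > 0"
  shows "((\<lambda>r. \<psi> r + \<mu>) has_real_derivative err r - (\<psi> r + \<mu>') * (\<psi> r + \<mu>)) (at r)"
proof -
  have up: "u r \<noteq> 0" using u_pos[OF r] by simp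
  have "u r powr p = u r * u r powr (p - 1)"
    using powr_mult_base[of "u r" "p - 1"] u_pos[OF r] by simp
  moreover have "v r = \<psi> r * u r" using up by (simp add: \<psi>_def)
  ultimately have "(- (2 * \<nu> + 1) * ct r * v r - lam * u r - u r powr p) * u r - v r * v r
    = u r * u r * (err r - (2 * \<nu> + 1) * \<psi> r - lam - \<psi> r * \<psi> r)"
    by (simp add: err_def algebra_simps)
  moreover have "(\<psi> r + \<mu>') * (\<psi> r + \<mu>) = \<psi> r * \<psi> r + (\<mu> + \<mu>') * \<psi> r + \<mu> * \<mu>'"
    by (simp add: algebra_simps)
  then have "(\<psi> r + \<mu>') * (\<psi> r + \<mu>) = \<psi> r * \<psi> r + (2 * \<nu> + 1) * \<psi> r + lam"
    unfolding roots .
  ultimately have e: "((- (2 * \<nu> + 1) * ct r * v r - lam * u r - u r powr p) * u r - v r * v r) / (u r * u r)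
     = err r - (\<psi> r + \<mu>') * (\<psi> r + \<mu>)"
    using up by simp
  have "(\<psi> has_real_derivative ((- (2 * \<nu> + 1) * ct r * v r - lam * u r - u r powr p) * u r - v r * v r) / (u r * u r)) (at r)"
    unfolding \<psi>_def[abs_def] by (rule DERIV_divide[OF dv[OF r] du[OF r] up])
  from DERIV_add[OF this DERIV_const[of \<mu>]] show ?thesis unfolding e by simp
qed

lemma err_tendsto:
  assumes "(u \<longlongrightarrow> 0) at_top"
  shows "(err \<longlongrightarrow> 0) at_top"
proof -
  obtain K where K: "\<forall>\<^sub>F r in at_top. \<bar>\<psi> r\<bar> \<le> K" by (rule \<psi>_bounded)
  have "((\<lambda>r. - (2 * \<nu> + 1) * (ct r - 1) * \<psi> r) \<longlongrightarrow> 0) at_top"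
  proof (rule Lim_null_comparison)
    show "\<forall>\<^sub>F r in at_top. norm (- (2 * \<nu> + 1) * (ct r - 1) * \<psi> r) \<le> (2 * \<nu> + 1) * \<bar>ct r - 1\<bar> * K"
      using K
    proof eventually_elim
      case (elim r)
      then have "(2 * \<nu> + 1) * \<bar>ct r - 1\<bar> * \<bar>\<psi> r\<bar> \<le> (2 * \<nu> + 1) * \<bar>ct r - 1\<bar> * K"
        using \<nu>_pos by (intro mult_left_mono) auto
      moreover have "\<bar>- (2 * \<nu> + 1)\<bar> = 2 * \<nu> + 1" using \<nu>_pos by simp
      ultimately show ?case by (simp only: abs_mult real_norm_def)
    qed
    have "((\<lambda>r. (2 * \<nu> + 1) * \<bar>ct r - 1\<bar> * K) \<longlongrightarrow> (2 * \<nu> + 1) * \<bar>1 - 1\<bar> * K) at_top"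
      by (intro tendsto_intros coth_tendsto_1)
    then show "((\<lambda>r. (2 * \<nu> + 1) * \<bar>ct r - 1\<bar> * K) \<longlongrightarrow> 0) at_top" by simp
  qed
  moreover have "((\<lambda>r. u r powr (p - 1)) \<longlongrightarrow> 0 powr (p - 1)) at_top"
    using p_gt assms by (intro tendsto_intros) (auto intro!: eventually_mono[OF eventually_gt_at_top[of 0]] less_imp_le u_pos)
  then have "((\<lambda>r. u r powr (p - 1)) \<longlongrightarrow> 0) at_top" by simp
  ultimately show ?thesis unfolding err_def[abs_def] using tendsto_diff by fastforce
qed

lemma \<psi>_tendsto:
  assumes "(u \<longlongrightarrow> 0) at_top"
  shows "(\<psi> \<longlongrightarrow> - \<mu>) at_top"
proof -
  have "((\<lambda>r. \<psi> r + \<mu>) \<longlongrightarrow> 0) at_top"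
  proof (rule damped_tendsto_zero[of _ err "\<lambda>r. \<psi> r + \<mu>'" "1 / 4"])
    show "\<forall>\<^sub>F r in at_top. ((\<lambda>r. \<psi> r + \<mu>) has_real_derivative err r - (\<psi> r + \<mu>') * (\<psi> r + \<mu>)) (at r)"
      using eventually_gt_at_top[of 0] by eventually_elim (rule \<psi>_deriv)
  qed (use \<psi>_lower err_tendsto[OF assms] in auto)
  from tendsto_diff[OF this tendsto_const[of \<mu>]] show ?thesis by simp
qed

lemma bounded_and_vanishing:
  obtains M where "M > 0" "\<forall>\<^sub>F r in at_top. u r \<le> M" "(v \<longlongrightarrow> 0) at_top"
proof -
  obtain K0 where K0: "\<forall>\<^sub>F r in at_top. \<bar>\<psi> r\<bar> \<le> K0" by (rule \<psi>_bounded)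
  have "\<forall>\<^sub>F r in at_top. sqrt (\<nu>^2 / (sinh r)^2 + \<Lambda>) < sqrt \<Lambda> + 1" "\<forall>\<^sub>F r in at_top. ct r < 2"
    using sqrt_tendsto coth_tendsto_1 by (auto intro: order_tendstoD(2))
  with K0 eventually_gt_at_top[of 0] have "\<forall>\<^sub>F r in at_top. \<bar>\<psi> r\<bar> \<le> K0 \<and> sqrt (\<nu>^2 / (sinh r)^2 + \<Lambda>) < sqrt \<Lambda> + 1 \<and> ct r < 2 \<and> r > 0"
    by eventually_elim auto
  then obtain T where T: "\<And>r. r \<ge> T \<Longrightarrow> \<bar>\<psi> r\<bar> \<le> K0 \<and> sqrt (\<nu>^2 / (sinh r)^2 + \<Lambda>) < sqrt \<Lambda> + 1 \<and> ct r < 2 \<and> r > 0"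
    unfolding eventually_at_top_linorder by blast
  define M where "M = ((p + 1) / 2 * (sqrt \<Lambda> + 1)^2) powr (1 / (p - 1))"
  have "sqrt \<Lambda> + 1 > 0" using \<Lambda>_nonneg by (intro add_nonneg_pos) auto
  then have Mp: "M > 0" using p_gt by (simp add: M_def)
  have M: "u r \<le> M" if r: "r \<ge> T" for r
  proof -
    have "2 / (p + 1) * u r powr (p - 1) < \<nu>^2 / (sinh r)^2 + \<Lambda>"
      using energy[of r] T[OF r] zero_le_power2[of "v r / u r + \<nu> * ct r"] unfolding \<Lambda>_def by linarith
    also have "\<nu>^2 / (sinh r)^2 + \<Lambda> = (sqrt (\<nu>^2 / (sinh r)^2 + \<Lambda>))^2" using \<Lambda>_nonneg by simp
    also have "\<dots> \<le> (sqrt \<Lambda> + 1)^2" using T[OF r] \<Lambda>_nonneg by (intro power_mono) auto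
    finally have "u r powr (p - 1) \<le> (p + 1) / 2 * (sqrt \<Lambda> + 1)^2" using p_gt by (simp add: field_simps)
    then have "(u r powr (p - 1)) powr (1 / (p - 1)) \<le> M"
      unfolding M_def using p_gt by (intro powr_mono2) auto
    then show ?thesis using u_pos[of r] T[OF r] p_gt by (simp add: powr_powr)
  qed
  define K where "K = K0 * M"
  have K: "\<bar>v r\<bar> \<le> K" if r: "r \<ge> T" for r
  proof -
    have "v r = \<psi> r * u r" using u_pos[of r] T[OF r] by (simp add: \<psi>_def)
    then have "\<bar>v r\<bar> = \<bar>\<psi> r\<bar> * u r" using u_pos[of r] T[OF r] by (simp add: abs_mult)
    also have "\<dots> \<le> K0 * M" using T[OF r] M[OF r] u_pos[of r] by (intro mult_mono) auto
    finally show ?thesis by (simp add: K_def)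
  qed
  \<comment> \<open>The mechanical energy with reversed sign, so that the friction term makes it
    increase.\<close>
  define F where "F r = - ((v r)^2 / 2) - lam * (u r)^2 / 2 - u r powr (p + 1) / (p + 1)" for r
  have "(v \<longlongrightarrow> 0) at_top"
  proof (rule tendsto_zero_of_dissipation[of T F "\<lambda>r. (2 * \<nu> + 1) * ct r * (v r)^2" "2 * \<nu> + 1" _ "\<bar>lam\<bar> * M^2 / 2"
        "\<lambda>r. - (2 * \<nu> + 1) * ct r * v r - lam * u r - u r powr p" "(2 * \<nu> + 1) * 2 * K + \<bar>lam\<bar> * M + M powr p"])
    fix r assume rT: "T \<le> r"
    then have r: "r > 0" "ct r < 2" "ct r \<ge> 1" using T ct_ge_1 by auto
    have "((\<lambda>r. u r powr (p + 1)) has_real_derivative (p + 1) * (u r powr p) * v r) (at r)"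
      using DERIV_chain2[OF has_real_derivative_powr[OF u_pos[OF r(1)], of "p + 1"] du[OF r(1)]] by simp
    from DERIV_cdivide[OF this, of "p + 1"]
    have 1: "((\<lambda>r. u r powr (p + 1) / (p + 1)) has_real_derivative u r powr p * v r) (at r)"
      using p_gt by (simp add: mult.assoc)
    have 2: "((\<lambda>r. - ((v r)^2 / 2) - lam * (u r)^2 / 2) has_real_derivative
       - v r * (- (2 * \<nu> + 1) * ct r * v r - lam * u r - u r powr p) - lam * u r * v r) (at r)"
      using r by (auto intro!: derivative_eq_intros du dv)
    show "(F has_real_derivative (2 * \<nu> + 1) * ct r * (v r)^2) (at r)"
      unfolding F_def[abs_def] by (rule DERIV_cong[OF DERIV_diff[OF 2 1]]) (simp add: power2_eq_square algebra_simps)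
    have "(2 * \<nu> + 1) * 1 * (v r)^2 \<le> (2 * \<nu> + 1) * ct r * (v r)^2"
      using r \<nu>_pos by (intro mult_left_mono mult_right_mono) auto
    then show "(2 * \<nu> + 1) * (v r)^2 \<le> (2 * \<nu> + 1) * ct r * (v r)^2" by simp
    have u: "0 < u r" "u r \<le> M" using u_pos[OF r(1)] M[OF rT] by auto
    have "- lam * (u r)^2 \<le> \<bar>lam\<bar> * M^2"
      using u by (intro mult_mono power_mono) auto
    moreover have "u r powr (p + 1) / (p + 1) \<ge> 0" using p_gt by simp
    moreover have "(v r)^2 \<ge> 0" by simp
    ultimately show "F r \<le> \<bar>lam\<bar> * M^2 / 2" unfolding F_def by linarith
    show "(v has_real_derivative - (2 * \<nu> + 1) * ct r * v r - lam * u r - u r powr p) (at r)" by (rule dv[OF r(1)])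
    have "\<bar>(2 * \<nu> + 1) * ct r * v r\<bar> \<le> (2 * \<nu> + 1) * 2 * K"
      unfolding abs_mult using r \<nu>_pos K[OF rT] by (intro mult_mono) auto
    moreover have "\<bar>lam * u r\<bar> \<le> \<bar>lam\<bar> * M" unfolding abs_mult using u by (intro mult_left_mono) auto
    moreover have "0 \<le> u r powr p" "u r powr p \<le> M powr p" using u p_gt by (auto intro!: powr_mono2)
    ultimately show "\<bar>- (2 * \<nu> + 1) * ct r * v r - lam * u r - u r powr p\<bar> \<le> (2 * \<nu> + 1) * 2 * K + \<bar>lam\<bar> * M + M powr p"
      by linarith
  qed (use \<nu>_pos in auto)
  moreover have "\<forall>\<^sub>F r in at_top. u r \<le> M" using M by (auto intro: eventually_at_top_linorderI)
  ultimately show thesis using that Mp by blast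
qed

lemma force_vanishes: "((\<lambda>r. lam * u r + u r powr p) \<longlongrightarrow> 0) at_top"
proof -
  obtain M where M: "M > 0" "\<forall>\<^sub>F r in at_top. u r \<le> M" and v0: "(v \<longlongrightarrow> 0) at_top"
    by (rule bounded_and_vanishing)
  show ?thesis
  proof (rule force_tendsto_zero[of u v "\<lambda>r. - (2 * \<nu> + 1) * ct r * v r" "\<lambda>u. lam * u + u powr p" M])
    show "\<forall>\<^sub>F r in at_top. (u has_real_derivative v r) (at r)"
      using eventually_gt_at_top[of 0] by eventually_elim (rule du)
    show "\<forall>\<^sub>F r in at_top. (v has_real_derivative - (2 * \<nu> + 1) * ct r * v r - (lam * u r + u r powr p)) (at r)"
      using eventually_gt_at_top[of 0] by eventually_elim (use dv in \<open>simp add: diff_diff_eq\<close>)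
    from tendsto_mult[OF tendsto_mult[OF tendsto_const[of "- (2 * \<nu> + 1)"] coth_tendsto_1] v0]
    show "((\<lambda>r. - (2 * \<nu> + 1) * ct r * v r) \<longlongrightarrow> 0) at_top" by simp
    show "continuous_on {0..M} (\<lambda>u. lam * u + u powr p)"
      using p_gt by (intro continuous_intros continuous_on_powr') auto
    show "\<forall>\<^sub>F r in at_top. u r \<in> {0..M}"
      using M(2) eventually_gt_at_top[of 0] by eventually_elim (use u_pos in \<open>auto intro: less_imp_le\<close>)
  qed (rule v0)
qed

lemma u_continuous_on: "continuous_on {1..} u"
proof (rule DERIV_continuous_on)
  fix r :: real assume "r \<in> {1..}"
  then show "(u has_real_derivative v r) (at r within {1..})"
    using du[of r] by (auto intro: has_field_derivative_at_within)
qed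

section \<open>The three regimes of \<open>lam\<close>\<close>

theorem limit_neg:
  assumes "lam < 0"
  shows "(u \<longlongrightarrow> (- lam) powr (1 / (p - 1))) at_top"
proof -
  have "\<not> (u \<longlongrightarrow> 0) at_top"
  proof
    assume u0: "(u \<longlongrightarrow> 0) at_top"
    \<comment> \<open>The product of the roots is \<open>lam < 0\<close>. If \<open>u\<close> tended
      to 0, its logarithmic derivative would tend to \<open>- \<mu> > 0\<close> and \<open>u\<close>
      would eventually increase.\<close>
    have "\<mu> < 0" using roots(2) assms \<mu>'_pos by (smt (verit) mult_nonneg_nonneg)
    then have "\<forall>\<^sub>F r in at_top. \<psi> r > 0" using order_tendstoD(1)[OF \<psi>_tendsto[OF u0], of 0] by simp
    with eventually_gt_at_top[of 0] have "\<forall>\<^sub>F r in at_top. r > 0 \<and> \<psi> r > 0" by eventually_elim auto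
    then obtain T where T: "\<And>r. r \<ge> T \<Longrightarrow> r > 0 \<and> \<psi> r > 0" unfolding eventually_at_top_linorder by blast
    have "u T \<le> u r" if r: "r \<ge> T" for r
    proof (rule DERIV_nonneg_imp_nondecreasing[OF r])
      fix s assume "T \<le> s" "s \<le> r"
      then have s: "s > 0" "\<psi> s > 0" using T by auto
      then have "v s \<ge> 0" using u_pos[OF s(1)] by (simp add: \<psi>_def zero_less_divide_iff)
      then show "\<exists>y. (u has_real_derivative y) (at s) \<and> y \<ge> 0" using du[OF s(1)] by blast
    qed
    then have "u T \<le> 0"
      by (intro tendsto_lowerbound[OF u0]) (auto simp: eventually_at_top_linorder)
    then show False using u_pos[of T] T[of T] by simp
  qed
  moreover have "(u \<longlongrightarrow> 0) at_top \<or> (u \<longlongrightarrow> (- lam) powr (1 / (p - 1))) at_top"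
  proof (rule power_force_dichotomy[OF _ p_gt u_continuous_on])
    show "((\<lambda>r. u r powr p - (- lam) * u r) \<longlongrightarrow> 0) at_top"
      using force_vanishes by (simp add: add.commute)
  qed (use assms u_pos in auto)
  ultimately show ?thesis by blast
qed

lemma vanishing:
  assumes "lam \<ge> 0"
  shows "(u \<longlongrightarrow> 0) at_top"
proof -
  have "((\<lambda>r. u r powr p) \<longlongrightarrow> 0) at_top"
  proof (rule Lim_null_comparison[OF _ force_vanishes])
    show "\<forall>\<^sub>F r in at_top. norm (u r powr p) \<le> lam * u r + u r powr p"
      using eventually_gt_at_top[of 0] by eventually_elim (use assms u_pos in \<open>simp add: less_imp_le\<close>)
  qed
  then have "((\<lambda>r. (u r powr p) powr (1 / p)) \<longlongrightarrow> 0 powr (1 / p)) at_top"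
    using p_gt by (intro tendsto_intros) auto
  then have "((\<lambda>r. (u r powr p) powr (1 / p)) \<longlongrightarrow> 0) at_top" by simp
  then show ?thesis
  proof (rule Lim_transform_eventually)
    show "\<forall>\<^sub>F r in at_top. (u r powr p) powr (1 / p) = u r"
      using eventually_gt_at_top[of 0] by eventually_elim (use p_gt u_pos in \<open>simp add: powr_powr less_imp_le\<close>)
  qed
qed

text \<open>Now \<open>\<mu> = 0\<close>, and \<open>\<psi> \<rightarrow> 0\<close> gives no rate.
  The leading balance is \<open>n * u' = - (u powr p)\<close>, so
  \<open>\<omega> = u' * u powr (- p)\<close> is the right unknown: it solves a linear equation with
  damping \<open>k \<rightarrow> n\<close> and tends to \<open>- 1 / n\<close>. Then
  \<open>u powr (1 - p)\<close> has a derivative with a positive limit, hence linear growth.\<close>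

theorem asymptotics_zero:
  assumes "lam = 0"
  shows "u \<sim>[at_top] (\<lambda>r. ((2 * \<nu> + 1) / (p - 1)) powr (1 / (p - 1)) * r powr (- 1 / (p - 1)))"
proof -
  have u0: "(u \<longlongrightarrow> 0) at_top" using vanishing assms by simp
  have "\<mu> = 0" using roots(2) assms \<mu>'_pos by simp
  then have \<psi>0: "(\<psi> \<longlongrightarrow> 0) at_top" using \<psi>_tendsto[OF u0] by simp
  define n where "n = 2 * \<nu> + 1"
  have n: "n > 0" using \<nu>_pos by (simp add: n_def)
  define \<omega> where "\<omega> r = v r * u r powr (- p)" for r
  define k where "k r = n * ct r + p * \<psi> r" for r
  have k_lim: "(k \<longlongrightarrow> n) at_top"
    using tendsto_add[OF tendsto_mult[OF tendsto_const[of n] coth_tendsto_1] tendsto_mult[OF tendsto_const[of p] \<psi>0]]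
    by (simp add: k_def[abs_def])
  have d\<omega>: "(\<omega> has_real_derivative - 1 - k r * \<omega> r) (at r)" if r: "r > 0" for r
  proof -
    have "((\<lambda>r. u r powr (- p)) has_real_derivative (- p) * u r powr (- p - 1) * v r) (at r)"
      by (rule DERIV_chain2[OF has_real_derivative_powr[OF u_pos[OF r]] du[OF r]])
    from DERIV_mult[OF dv[OF r] this]
    have "(\<omega> has_real_derivative (- (2 * \<nu> + 1) * ct r * v r - lam * u r - u r powr p) * u r powr (- p)
        + (- p) * u r powr (- p - 1) * v r * v r) (at r)"
      by (simp add: \<omega>_def[abs_def])
    moreover have "u r powr p * u r powr (- p) = 1" "u r powr (- p - 1) = u r powr (- p) / u r"
      using u_pos[OF r] by (auto simp: powr_diff simp flip: powr_add)
    then have "(- (2 * \<nu> + 1) * ct r * v r - lam * u r - u r powr p) * u r powr (- p)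
        + (- p) * u r powr (- p - 1) * v r * v r = - 1 - k r * \<omega> r"
      by (simp add: assms k_def \<omega>_def \<psi>_def n_def algebra_simps)
    ultimately show ?thesis by simp
  qed
  have "((\<lambda>r. \<omega> r + 1 / n) \<longlongrightarrow> 0) at_top"
  proof (rule damped_tendsto_zero[of _ "\<lambda>r. k r / n - 1" k "n / 2"])
    show "\<forall>\<^sub>F r in at_top. ((\<lambda>r. \<omega> r + 1 / n) has_real_derivative k r / n - 1 - k r * (\<omega> r + 1 / n)) (at r)"
      using eventually_gt_at_top[of 0]
    proof eventually_elim
      case (elim r)
      from DERIV_add[OF d\<omega>[OF elim] DERIV_const[of "1 / n"]] show ?case by (simp add: algebra_simps)
    qed
    show "\<forall>\<^sub>F r in at_top. n / 2 \<le> k r"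
      using order_tendstoD(1)[OF k_lim, of "n / 2"] n by (auto elim: eventually_mono)
    have "((\<lambda>r. k r / n - 1) \<longlongrightarrow> n / n - 1) at_top" using n by (intro tendsto_intros k_lim) auto
    then show "((\<lambda>r. k r / n - 1) \<longlongrightarrow> 0) at_top" using n by simp
  qed (use n in simp)
  from tendsto_diff[OF this tendsto_const[of "1 / n"]] have \<omega>_lim: "(\<omega> \<longlongrightarrow> - (1 / n)) at_top" by simp
  have "((\<lambda>r. u r powr (1 - p) / r) \<longlongrightarrow> (p - 1) / n) at_top"
  proof (rule lhospital_at_top_at_top[where f' = "\<lambda>r. (1 - p) * \<omega> r" and g' = "\<lambda>r. 1"])
    show "filterlim (\<lambda>r::real. r) at_top at_top" by (rule filterlim_ident)
    show "\<forall>\<^sub>F r in at_top. ((\<lambda>r. u r powr (1 - p)) has_real_derivative (1 - p) * \<omega> r) (at r)"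
      using eventually_gt_at_top[of 0]
    proof eventually_elim
      case (elim r)
      from DERIV_chain2[OF has_real_derivative_powr[OF u_pos[OF elim], of "1 - p"] du[OF elim]]
      show ?case by (simp add: \<omega>_def mult_ac)
    qed
    from tendsto_mult[OF tendsto_const[of "1 - p"] \<omega>_lim]
    show "((\<lambda>r. (1 - p) * \<omega> r / 1) \<longlongrightarrow> (p - 1) / n) at_top" by (simp add: diff_divide_distrib)
  qed auto
  then have "((\<lambda>r. (u r powr (1 - p) / r) powr (- 1 / (p - 1))) \<longlongrightarrow> ((p - 1) / n) powr (- 1 / (p - 1))) at_top"
    by (rule tendsto_powr[OF _ tendsto_const]) (use p_gt n in simp)
  moreover have "((p - 1) / n) powr (- 1 / (p - 1)) = (n / (p - 1)) powr (1 / (p - 1))"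
    using p_gt n by (simp add: powr_minus powr_divide field_simps)
  ultimately have "((\<lambda>r. (u r powr (1 - p) / r) powr (- 1 / (p - 1))) \<longlongrightarrow> (n / (p - 1)) powr (1 / (p - 1))) at_top"
    by simp
  then have "((\<lambda>r. u r / r powr (- 1 / (p - 1))) \<longlongrightarrow> (n / (p - 1)) powr (1 / (p - 1))) at_top"
  proof (rule Lim_transform_eventually)
    show "\<forall>\<^sub>F r in at_top. (u r powr (1 - p) / r) powr (- 1 / (p - 1)) = u r / r powr (- 1 / (p - 1))"
      using eventually_gt_at_top[of 0]
    proof eventually_elim
      case (elim r)
      have "(1 - p) * (- 1 / (p - 1)) = 1" using p_gt by (simp add: field_simps)
      then have "(u r powr (1 - p)) powr (- 1 / (p - 1)) = u r"
        using u_pos[OF elim] by (simp only: powr_powr powr_one less_imp_le)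
      moreover have "(u r powr (1 - p) / r) powr (- 1 / (p - 1))
          = (u r powr (1 - p)) powr (- 1 / (p - 1)) / r powr (- 1 / (p - 1))"
        by (rule powr_divide)
      ultimately show ?case by simp
    qed
  qed
  then show ?thesis using n p_gt unfolding n_def by (intro asymp_equivI'_const) auto
qed

text \<open>An exact constant \<open>c\<close> needs \<open>\<psi> + \<mu>\<close> to be integrable,
  beyond tending to 0. A crude decay of \<open>u\<close> at half the rate makes \<open>err\<close>
  exponentially small, the damped equation passes this on to \<open>\<psi> + \<mu>\<close>, and
  \<open>ln u + \<mu> * r\<close> converges.\<close>

theorem asymptotics_pos:
  assumes "lam > 0"
  shows "\<exists>c>0. u \<sim>[at_top] (\<lambda>r. c * exp (- \<mu> * r))"
proof -
  have u0: "(u \<longlongrightarrow> 0) at_top" using vanishing assms by simp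
  have \<mu>_pos: "\<mu> > 0" using roots(2) assms \<mu>'_pos by (metis zero_less_mult_pos2)
  have "\<forall>\<^sub>F r in at_top. \<psi> r < - \<mu> / 2"
    using order_tendstoD(2)[OF \<psi>_tendsto[OF u0], of "- \<mu> / 2"] \<mu>_pos by simp
  with eventually_ge_at_top[of 1] have "\<forall>\<^sub>F r in at_top. r \<ge> 1 \<and> \<psi> r < - \<mu> / 2" by eventually_elim auto
  then obtain T where T: "\<And>r. r \<ge> T \<Longrightarrow> r \<ge> 1 \<and> \<psi> r < - \<mu> / 2" unfolding eventually_at_top_linorder by blast
  define K0 where "K0 = exp (\<mu> / 2 * T) * u T"
  have K0: "K0 > 0" using u_pos[of T] T[of T] by (simp add: K0_def)
  have u_le: "u r \<le> K0 * exp (- (\<mu> / 2) * r)" if r: "r \<ge> T" for r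
  proof -
    have "exp (\<mu> / 2 * r) * u r \<le> exp (\<mu> / 2 * T) * u T"
    proof (rule DERIV_nonpos_imp_nonincreasing[OF r, of "\<lambda>r. exp (\<mu> / 2 * r) * u r"])
      fix s assume "T \<le> s" "s \<le> r"
      then have s: "s > 0" "\<psi> s < - \<mu> / 2" using T[of s] by auto
      have vs: "v s = \<psi> s * u s" using u_pos[OF s(1)] by (simp add: \<psi>_def)
      have "((\<lambda>r. exp (\<mu> / 2 * r) * u r) has_real_derivative exp (\<mu> / 2 * s) * ((\<mu> / 2 + \<psi> s) * u s)) (at s)"
        using s by (auto intro!: derivative_eq_intros du simp: vs algebra_simps)
      moreover have "(\<mu> / 2 + \<psi> s) * u s \<le> 0" using s u_pos[OF s(1)] by (intro mult_nonpos_nonneg) auto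
      then have "exp (\<mu> / 2 * s) * ((\<mu> / 2 + \<psi> s) * u s) \<le> 0" by (rule mult_nonneg_nonpos[rotated]) auto
      ultimately show "\<exists>y. ((\<lambda>r. exp (\<mu> / 2 * r) * u r) has_real_derivative y) (at s) \<and> y \<le> 0" by blast
    qed
    then have "exp (- (\<mu> / 2) * r) * (exp (\<mu> / 2 * r) * u r) \<le> exp (- (\<mu> / 2) * r) * K0"
      unfolding K0_def by (intro mult_left_mono) auto
    then show ?thesis by (simp add: exp_minus field_simps)
  qed
  \<comment> \<open>The two parts of \<open>err\<close> decay at the rates 1 (from
    \<open>ct r - 1 = exp (- r) / sinh r\<close>) and \<open>\<mu> / 2 * (p - 1)\<close> (from the
    crude bound on \<open>u\<close>).\<close>
  define \<gamma> where "\<gamma> = min 1 (\<mu> / 2 * (p - 1))"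
  have \<gamma>: "\<gamma> > 0" "\<gamma> \<le> 1" "\<gamma> \<le> \<mu> / 2 * (p - 1)" using \<mu>_pos p_gt by (auto simp: \<gamma>_def)
  obtain K\<psi> where K\<psi>: "\<forall>\<^sub>F r in at_top. \<bar>\<psi> r\<bar> \<le> K\<psi>" by (rule \<psi>_bounded)
  define K where "K = (2 * \<nu> + 1) * \<bar>K\<psi>\<bar> + K0 powr (p - 1)"
  have err_le: "\<forall>\<^sub>F r in at_top. \<bar>err r\<bar> \<le> K * exp (- \<gamma> * r)"
    using K\<psi> eventually_ge_at_top[of T]
  proof eventually_elim
    case (elim r)
    then have r: "r \<ge> 1" "r > 0" "r \<ge> T" using T[of r] by auto
    have e: "exp (- r) \<le> exp (- \<gamma> * r)" using \<gamma> r by (simp add: mult_left_le_one_le)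
    have "sinh r \<ge> 1" using real_le_x_sinh[of r] r by (simp add: sinh_field_def exp_minus)
    moreover have "ct r - 1 = exp (- r) / sinh r"
      unfolding ct_def cosh_minus_sinh[symmetric] using \<open>sinh r \<ge> 1\<close> r by (simp add: diff_divide_distrib)
    moreover have "exp (- r) / sinh r \<le> exp (- r) / 1"
      using \<open>sinh r \<ge> 1\<close> r by (intro divide_left_mono) auto
    ultimately have "ct r - 1 \<le> exp (- \<gamma> * r)" using e by linarith
    then have "(2 * \<nu> + 1) * (ct r - 1) * \<bar>\<psi> r\<bar> \<le> (2 * \<nu> + 1) * exp (- \<gamma> * r) * \<bar>K\<psi>\<bar>"
      using \<nu>_pos elim ct_ge_1[OF r(2)] by (intro mult_mono) auto
    moreover have "\<bar>- (2 * \<nu> + 1) * (ct r - 1) * \<psi> r\<bar> = (2 * \<nu> + 1) * (ct r - 1) * \<bar>\<psi> r\<bar>"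
    proof -
      have "\<bar>- (2 * \<nu> + 1)\<bar> = 2 * \<nu> + 1" "\<bar>ct r - 1\<bar> = ct r - 1" using \<nu>_pos ct_ge_1[OF r(2)] by auto
      then show ?thesis by (simp only: abs_mult)
    qed
    moreover have "u r powr (p - 1) \<le> K0 powr (p - 1) * exp (- \<gamma> * r)"
    proof -
      have "u r powr (p - 1) \<le> (K0 * exp (- (\<mu> / 2) * r)) powr (p - 1)"
        using u_le[OF r(3)] u_pos[OF r(2)] p_gt by (intro powr_mono2) auto
      also have "\<dots> = K0 powr (p - 1) * exp (- (\<mu> / 2) * r) powr (p - 1)" by (rule powr_mult)
      also have "exp (- (\<mu> / 2) * r) powr (p - 1) = exp (- (\<mu> / 2 * (p - 1)) * r)"
        by (simp add: powr_def mult_ac)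
      also have "exp (- (\<mu> / 2 * (p - 1)) * r) \<le> exp (- \<gamma> * r)"
        using \<gamma>(3) r mult_right_mono[of \<gamma> "\<mu> / 2 * (p - 1)" r] by simp
      finally show ?thesis by (simp add: mult_left_mono)
    qed
    moreover have "\<bar>err r\<bar> \<le> \<bar>- (2 * \<nu> + 1) * (ct r - 1) * \<psi> r\<bar> + u r powr (p - 1)"
      unfolding err_def using powr_ge_zero[of "u r" "p - 1"] by linarith
    ultimately show ?case unfolding K_def by (simp add: algebra_simps)
  qed
  \<comment> \<open>The rate must stay below both the damping 1/4 and
    \<open>\<gamma>\<close>.\<close>
  define \<delta> where "\<delta> = min (1 / 8) (\<gamma> / 2)"
  have \<delta>: "\<delta> > 0" "\<delta> < 1 / 4" "\<delta> < \<gamma>" using \<gamma> by (auto simp: \<delta>_def)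
  have "\<forall>\<^sub>F r in at_top. \<bar>\<psi> r + \<mu>\<bar> \<le> exp (- \<delta> * r)"
  proof (rule damped_exponential_bound[of _ err "\<lambda>r. \<psi> r + \<mu>'" "1 / 4" \<delta> \<gamma> K])
    show "\<forall>\<^sub>F r in at_top. ((\<lambda>r. \<psi> r + \<mu>) has_real_derivative err r - (\<psi> r + \<mu>') * (\<psi> r + \<mu>)) (at r)"
      using eventually_gt_at_top[of 0] by eventually_elim (rule \<psi>_deriv)
  qed (use \<psi>_lower err_le \<delta> in auto)
  with eventually_gt_at_top[of 0] have "\<forall>\<^sub>F r in at_top. r > 0 \<and> \<bar>\<psi> r + \<mu>\<bar> \<le> exp (- \<delta> * r)" by eventually_elim auto
  then obtain T2 where T2: "\<And>r. r \<ge> T2 \<Longrightarrow> r > 0 \<and> \<bar>\<psi> r + \<mu>\<bar> \<le> exp (- \<delta> * r)" unfolding eventually_at_top_linorder by blast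
  obtain c where c: "((\<lambda>r. ln (u r) + \<mu> * r) \<longlongrightarrow> c) at_top"
  proof (rule convergent_of_exponential_derivative[of T2 "\<lambda>r. ln (u r) + \<mu> * r" "\<lambda>r. \<psi> r + \<mu>" \<delta>])
    fix r assume "T2 \<le> r"
    then have r: "r > 0" using T2 by simp
    show "((\<lambda>r. ln (u r) + \<mu> * r) has_real_derivative \<psi> r + \<mu>) (at r)"
      using r u_pos[OF r] by (auto intro!: derivative_eq_intros du simp: \<psi>_def)
  qed (use T2 \<delta> in auto)
  have "((\<lambda>r. exp (ln (u r) + \<mu> * r)) \<longlongrightarrow> exp c) at_top" by (intro tendsto_intros c)
  then have "((\<lambda>r. u r / exp (- \<mu> * r)) \<longlongrightarrow> exp c) at_top"
  proof (rule Lim_transform_eventually)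
    show "\<forall>\<^sub>F r in at_top. exp (ln (u r) + \<mu> * r) = u r / exp (- \<mu> * r)"
      using eventually_gt_at_top[of 0]
      by eventually_elim (use u_pos in \<open>simp add: exp_add exp_minus field_simps\<close>)
  qed
  then show ?thesis by (intro exI[of _ "exp c"] conjI asymp_equivI'_const) auto
qed

end

subsection \<open>Back to the radial variable\<close>

text \<open>\<open>tr r = ln (tanh (r / 2))\<close>, with inverse \<open>rt\<close>.\<close>

definition tr :: "real \<Rightarrow> real" where "tr r = arsinh (- 1 / sinh r)"
definition rt :: "real \<Rightarrow> real" where "rt t = arsinh (sh t)"

lemma tr_neg: "r > 0 \<Longrightarrow> tr r < 0"
  by (simp add: tr_def divide_neg_pos)

lemma sh_tr: "r > 0 \<Longrightarrow> sh (tr r) = sinh r"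
  by (simp add: tr_def sh_def)

lemma ch_tr: "r > 0 \<Longrightarrow> ch (tr r) = cosh r"
proof -
  assume r: "r > 0"
  have "sqrt (1 + (sinh r)^2) = cosh r"
    using cosh_square_eq[of r] by (intro real_sqrt_unique) auto
  then show ?thesis using ch_eq[OF tr_neg[OF r]] sh_tr[OF r] by simp
qed

lemma tr_deriv:
  assumes r: "r > 0" shows "(tr has_real_derivative 1 / sinh r) (at r)"
proof -
  have "((\<lambda>r. - 1 / sinh r) has_real_derivative cosh r / (sinh r)^2) (at r)"
    using r by (auto intro!: derivative_eq_intros simp: power2_eq_square)
  from DERIV_chain2[OF arsinh_real_has_field_derivative this]
  have "(tr has_real_derivative 1 / sqrt ((- 1 / sinh r)^2 + 1) * (cosh r / (sinh r)^2)) (at r)"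
    by (simp add: tr_def[abs_def])
  moreover have "sqrt ((- 1 / sinh r)^2 + 1) = cosh r / sinh r"
  proof (rule real_sqrt_unique)
    show "(cosh r / sinh r)^2 = (- 1 / sinh r)^2 + 1"
      using r cosh_square_eq[of r] by (simp add: power_divide add_divide_distrib)
  qed (use r in simp)
  ultimately show ?thesis using r cosh_real_pos[of r] by (simp add: power2_eq_square)
qed

lemma tr_tendsto: "filterlim tr at_bot (at_right 0)"
  unfolding filterlim_at_bot
proof
  fix Z :: real
  have s0: "(sinh \<longlongrightarrow> (0::real)) (at_right 0)"
    using tendsto_sinh[OF tendsto_ident_at, of "0::real" "{0<..}"] by simp
  have "\<forall>\<^sub>F r in at_right 0. sinh r < 1 / (1 + \<bar>sinh Z\<bar>)"
    by (rule order_tendstoD(2)[OF s0]) (simp add: add_pos_nonneg)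
  moreover have "\<forall>\<^sub>F r in at_right 0. r > (0::real)" by (simp add: eventually_at_right_less)
  ultimately show "\<forall>\<^sub>F r in at_right 0. tr r \<le> Z"
  proof eventually_elim
    case (elim r)
    then have s: "sinh r > 0" by simp
    have "1 + \<bar>sinh Z\<bar> < 1 / sinh r" using elim s by (simp add: field_simps)
    then have "- 1 / sinh r < sinh Z" by simp
    then have "arsinh (- 1 / sinh r) < arsinh (sinh Z)" by (rule arsinh_real_strict_mono)
    then show ?case by (simp add: tr_def arsinh_sinh_real)
  qed
qed

lemma rt_pos: "t < 0 \<Longrightarrow> rt t > 0"
  using sh_pos by (simp add: rt_def)

lemma sinh_rt: "sinh (rt t) = sh t"
  by (simp add: rt_def)

lemma cosh_rt: "t < 0 \<Longrightarrow> cosh (rt t) = ch t"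
  by (simp add: rt_def cosh_arsinh_real ch_eq add.commute)

lemma rt_deriv:
  assumes t: "t < 0" shows "(rt has_real_derivative sh t) (at t)"
proof -
  from DERIV_chain2[OF arsinh_real_has_field_derivative sh_deriv[OF t]]
  have "(rt has_real_derivative 1 / sqrt ((sh t)^2 + 1) * (sh t * ch t)) (at t)"
    by (simp add: rt_def[abs_def])
  moreover have "sqrt ((sh t)^2 + 1) = ch t" using ch_eq[OF t] by (simp add: add.commute)
  ultimately show ?thesis using ch_pos[OF t] by simp
qed

lemma rt_tr: "r > 0 \<Longrightarrow> rt (tr r) = r"
  by (simp add: rt_def sh_tr arsinh_sinh_real)

lemma rt_tendsto: "filterlim rt (at_right 0) at_bot"
proof (rule tendsto_imp_filterlim_at_right)
  show "(rt \<longlongrightarrow> 0) at_bot" unfolding rt_def[abs_def] using tendsto_arsinh[OF sh_tendsto_0] by simp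
  show "\<forall>\<^sub>F t in at_bot. rt t > 0"
    using rt_pos by (auto simp: eventually_at_bot_dense intro!: exI[of _ 0])
qed

lemma (in singular_profile) radial_derivs:
  assumes r: "r > 0"
  shows "((\<lambda>r. v (tr r)) has_real_derivative v' (tr r) / sinh r) (at r)"
    and "((\<lambda>r. v' (tr r) / sinh r) has_real_derivative
       (- (2 * \<nu> + 1) * (cosh r / sinh r) * (v' (tr r) / sinh r) - lam * v (tr r) - v (tr r) powr p)) (at r)"
proof -
  note t = tr_neg[OF r] and [simp] = sh_tr[OF r] ch_tr[OF r]
  have s: "sinh r > 0" using r by simp
  show "((\<lambda>r. v (tr r)) has_real_derivative v' (tr r) / sinh r) (at r)"
    using DERIV_chain2[OF v_deriv[OF t] tr_deriv[OF r]] by simp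
  have 1: "((\<lambda>r. v' (tr r)) has_real_derivative
      (- 2 * \<nu> * cosh r * v' (tr r) - (lam * (sinh r)^2 + q (tr r)) * v (tr r)) / sinh r) (at r)"
    using DERIV_chain2[OF v'_deriv[OF t] tr_deriv[OF r]] by simp
  have 2: "(sinh has_real_derivative cosh r) (at r)" by (auto intro!: derivative_eq_intros)
  have q: "q (tr r) * v (tr r) = (sinh r)^2 * v (tr r) powr p"
    using q_eq[OF t] powr_p[of "v (tr r)"] v_pos[OF t] by simp
  have "((- 2 * \<nu> * cosh r * v' (tr r) - (lam * (sinh r)^2 + q (tr r)) * v (tr r)) / sinh r * sinh r - v' (tr r) * cosh r) / (sinh r * sinh r)
     = - (2 * \<nu> + 1) * (cosh r / sinh r) * (v' (tr r) / sinh r) - lam * v (tr r) - v (tr r) powr p"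
    unfolding distrib_right q using s by (simp add: field_simps power2_eq_square)
  then show "((\<lambda>r. v' (tr r) / sinh r) has_real_derivative
       (- (2 * \<nu> + 1) * (cosh r / sinh r) * (v' (tr r) / sinh r) - lam * v (tr r) - v (tr r) powr p)) (at r)"
    using DERIV_divide[OF 1 2] s by simp
qed

lemma pos_radial_singular_solutionI:
  assumes pos: "\<And>r. r > 0 \<Longrightarrow> u r > 0"
    and du: "\<And>r. r > 0 \<Longrightarrow> (u has_real_derivative u1 r) (at r)"
    and du1: "\<And>r. r > 0 \<Longrightarrow> (u1 has_real_derivative
       (- (real N - 1) * (cosh r / sinh r) * u1 r - lam * u r - u r powr p)) (at r)"
    and sing: "filterlim u at_top (at_right 0)"
  shows "pos_radial_singular_solution N p lam u"
proof -
  let ?F = "\<lambda>r. - (real N - 1) * (cosh r / sinh r) * u1 r - lam * u r - u r powr p"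
  have d1: "deriv u r = u1 r" if "r > 0" for r using DERIV_imp_deriv[OF du[OF that]] .
  \<comment> \<open>\<open>deriv u\<close> is identified with \<open>u1\<close> only for
    \<open>r > 0\<close>, so the derivative is transferred on the open set
    \<open>{0<..}\<close>.\<close>
  have dd: "(deriv u has_real_derivative ?F r) (at r)" if "r > 0" for r
    by (rule has_field_derivative_transform_within_open[OF du1[OF that], of "{0<..}"]) (use d1 that in auto)
  have d2: "deriv (deriv u) r = ?F r" if "r > 0" for r using DERIV_imp_deriv[OF dd[OF that]] .
  have c: "continuous_on {0<..} u" "continuous_on {0<..} u1"
    using du du1 by (auto intro!: DERIV_continuous_on intro: has_field_derivative_at_within)
  have "continuous_on {0<..} ?F"
    using c pos by (intro continuous_intros) (auto simp: less_imp_neq[symmetric])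
  then have "continuous_on {0<..} (deriv (deriv u))"
    by (rule continuous_on_eq) (simp add: d2)
  moreover have "\<forall>r>0. radial_laplacian N u r + lam * u r + u r powr p = 0"
  proof (intro allI impI)
    fix r :: real assume r: "r > 0"
    have *: "- n * c * y - l - w + n * c * y + l + w = 0" for n c y l w :: real by simp
    show "radial_laplacian N u r + lam * u r + u r powr p = 0"
      unfolding radial_laplacian_def d1[OF r] d2[OF r] by (rule *)
  qed
  moreover have "\<forall>r>0. u differentiable (at r)" "\<forall>r>0. deriv u differentiable (at r)"
    using du dd real_differentiable_def by blast+
  ultimately show ?thesis
    unfolding pos_radial_singular_solution_def C2_pos_def using pos sing by blast
qed

section \<open>From radial solutions to singular profiles\<close>

context hyperbolic_lane_emden
begin

lemma singular_profile_of_solution: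
  assumes sol: "pos_radial_singular_solution N p lam u" and N: "real N = 2 * \<nu> + 2"
  obtains W X where "singular_profile \<nu> m p lam W X" "\<And>r. r > 0 \<Longrightarrow> u r = sinh r powr (- m) * W (tr r)"
proof -
  have N1: "real N - 1 = 2 * \<nu> + 1" using N by simp
  define u1 where "u1 = deriv u"
  have pos: "u r > 0" and du: "(u has_real_derivative u1 r) (at r)"
    and du1: "(u1 has_real_derivative (- (2 * \<nu> + 1) * (cosh r / sinh r) * u1 r - lam * u r - u r powr p)) (at r)"
    if r: "r > 0" for r
  proof -
    show "u r > 0" using sol r by (simp add: pos_radial_singular_solution_def)
    show "(u has_real_derivative u1 r) (at r)"
      using sol r by (simp add: pos_radial_singular_solution_def C2_pos_def u1_def DERIV_deriv_iff_real_differentiable)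
    have "(u1 has_real_derivative deriv u1 r) (at r)"
      using sol r by (simp add: pos_radial_singular_solution_def C2_pos_def u1_def DERIV_deriv_iff_real_differentiable)
    moreover have "deriv u1 r + (2 * \<nu> + 1) * (cosh r / sinh r) * u1 r + lam * u r + u r powr p = 0"
      using sol r unfolding pos_radial_singular_solution_def radial_laplacian_def u1_def N1 by blast
    then have "deriv u1 r = - (2 * \<nu> + 1) * (cosh r / sinh r) * u1 r - lam * u r - u r powr p"
      by (simp add: algebra_simps)
    ultimately show "(u1 has_real_derivative (- (2 * \<nu> + 1) * (cosh r / sinh r) * u1 r - lam * u r - u r powr p)) (at r)"
      by simp
  qed
  define W where "W t = sh t powr m * u (rt t)" for t
  define X where "X t = sh t powr m * (m * ch t * u (rt t) + sh t * u1 (rt t))" for t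
  have solW: "sol {..<0} W X"
    unfolding sol_def
  proof (intro ballI conjI)
    fix t :: real assume "t \<in> {..<0}"
    then show t: "t < 0" by simp
    define f g where "f = u (rt t)" and "g = u1 (rt t)"
    have s: "sh t > 0" by (rule sh_pos[OF t])
    show "W t > 0" using s pos[OF rt_pos[OF t]] by (simp add: W_def)
    have df: "((\<lambda>t. u (rt t)) has_real_derivative g * sh t) (at t)"
      unfolding g_def by (rule DERIV_chain2[OF du[OF rt_pos[OF t]] rt_deriv[OF t]])
    have dg: "((\<lambda>t. u1 (rt t)) has_real_derivative
        (- (2 * \<nu> + 1) * (ch t / sh t) * g - lam * f - f powr p) * sh t) (at t)"
      using DERIV_chain2[OF du1[OF rt_pos[OF t]] rt_deriv[OF t]] unfolding f_def g_def sinh_rt cosh_rt[OF t] .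
    show "(W has_real_derivative X t) (at t)"
      unfolding W_def[abs_def] X_def
      by (rule DERIV_cong[OF DERIV_mult[OF sh_powr_deriv[OF t] df]]) (simp add: g_def algebra_simps)
    define h where "h = m * (sh t)^2 * f + m * ch t * (g * sh t)
       + (sh t * ch t * g + sh t * ((- (2 * \<nu> + 1) * (ch t / sh t) * g - lam * f - f powr p) * sh t))"
    define y where "y = m * ch t * f + sh t * g"
    have 1: "((\<lambda>t. m * ch t * u (rt t) + sh t * u1 (rt t)) has_real_derivative h) (at t)"
      by (rule DERIV_cong[OF DERIV_add[OF DERIV_mult[OF DERIV_cmult[OF ch_deriv[OF t]] df] DERIV_mult[OF sh_deriv[OF t] dg]]])
        (simp add: f_def g_def h_def algebra_simps)
    have Wp: "W t powr p = sh t powr m * ((sh t)^2 * f powr p)"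
    proof -
      have "m * p = m + 2" using mp by (simp add: algebra_simps)
      then have "(sh t powr m) powr p = sh t powr m * (sh t)^2" using s by (simp add: powr_powr powr_add)
      then show ?thesis using s pos[OF rt_pos[OF t]] by (simp add: W_def f_def powr_mult)
    qed
    have c: "ch t * ch t = 1 + (sh t)^2" using ch_sq[OF t] by (simp add: power2_eq_square)
    have id: "m * ch t * y + h = - a * ch t * y + (A + B * (sh t)^2) * f - (sh t)^2 * f powr p"
    proof -
      have e: "ch t * y = m * (1 + (sh t)^2) * f + ch t * sh t * g"
        unfolding c[symmetric] y_def by (simp add: algebra_simps)
      have "sh t * ((- (2 * \<nu> + 1) * (ch t / sh t) * g - lam * f - f powr p) * sh t)
        = - (2 * \<nu> + 1) * ch t * sh t * g - lam * (sh t)^2 * f - (sh t)^2 * f powr p"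
        using s by (simp add: power2_eq_square field_simps)
      then show ?thesis
        unfolding mult.assoc[of _ "ch t" y] e h_def a_def A_def B_def
        by (simp add: power2_eq_square algebra_simps)
    qed
    have "rhs t (W t) (X t) = sh t powr m * (- a * ch t * y + (A + B * (sh t)^2) * f - (sh t)^2 * f powr p)"
      unfolding rhs_def Wp by (simp add: W_def X_def y_def f_def g_def algebra_simps)
    then have "m * ch t * sh t powr m * y + h * sh t powr m = rhs t (W t) (X t)"
      unfolding id[symmetric] by (simp add: algebra_simps)
    then show "(X has_real_derivative rhs t (W t) (X t)) (at t)"
      unfolding X_def[abs_def]
      by (intro DERIV_cong[OF DERIV_mult[OF sh_powr_deriv[OF t] 1]]) (simp add: y_def f_def g_def)
  qed
  have "singular_profile \<nu> m p lam W X"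
  proof (unfold_locales, rule solW)
    have "filterlim (\<lambda>t. u (rt t)) at_top at_bot"
      using sol unfolding pos_radial_singular_solution_def by (auto intro: filterlim_compose[OF _ rt_tendsto])
    moreover have "\<forall>\<^sub>F t in at_bot. u (rt t) = sh t powr (- m) * W t"
      using eventually_at_bot_neg by eventually_elim (auto simp: W_def powr_minus dest: sh_pos)
    ultimately show "filterlim (\<lambda>t. sh t powr (- m) * W t) at_top at_bot"
      by (simp cong: filterlim_cong)
  qed
  moreover have "u r = sinh r powr (- m) * W (tr r)" if "r > 0" for r
    using that by (simp add: W_def sh_tr rt_tr powr_minus)
  ultimately show thesis by (rule that)
qed

end

lemma sh_powr_neg_at_top:
  assumes "k > 0" shows "filterlim (\<lambda>t. sh t powr (- k)) at_top at_bot"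
proof -
  have ev: "\<forall>\<^sub>F t in at_bot. sh t > 0"
    using sh_pos by (auto simp: eventually_at_bot_dense intro!: exI[of _ 0])
  have "filterlim sh (at_right 0) at_bot"
    by (rule tendsto_imp_filterlim_at_right[OF sh_tendsto_0 ev])
  from filterlim_compose[OF ln_at_0 this]
  have "filterlim (\<lambda>t. k * ln (sh t)) at_bot at_bot"
    using assms by (intro filterlim_tendsto_pos_mult_at_bot[OF tendsto_const])
  then have "filterlim (\<lambda>t. - (k * ln (sh t))) at_top at_bot" by (simp add: filterlim_uminus_at_bot)
  from filterlim_compose[OF exp_at_top this] have "filterlim (\<lambda>t. exp (- (k * ln (sh t)))) at_top at_bot" .
  moreover have "\<forall>\<^sub>F t in at_bot. exp (- (k * ln (sh t))) = sh t powr (- k)"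
    using ev by eventually_elim (simp add: powr_def)
  ultimately show ?thesis by (simp cong: filterlim_cong)
qed

theorem theorem1p4:
  fixes N :: nat and p lam :: real
  assumes "N \<ge> 3"
    and "p > (real N + 2) / (real N - 2)"
    and "lam \<le> real N * (real N - 2) / 4"
  shows "\<exists>u. pos_radial_singular_solution N p lam u \<and>
    (\<forall>v. pos_radial_singular_solution N p lam v \<longrightarrow> (\<forall>r>0. v r = u r)) \<and>
    (\<lambda>r. u r - (L_const N p * sinh r powr (- m_exp p)
        + (L_const N p powr p - (lam - m_exp p) * L_const N p) / (4 * real N - 4 - 6 * m_exp p)
          * sinh r powr (2 - m_exp p)))
      \<in> O[at_right 0](\<lambda>r. sinh r powr (4 - m_exp p)) \<and>
    (lam < 0 \<longrightarrow> (u \<longlongrightarrow> (- lam) powr (1 / (p - 1))) at_top) \<and>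
    (lam = 0 \<longrightarrow>
      u \<sim>[at_top] (\<lambda>r. ((real N - 1) / (p - 1)) powr (1 / (p - 1)) * r powr (- 1 / (p - 1)))) \<and>
    (0 < lam \<longrightarrow>
      (\<exists>c>0. u \<sim>[at_top] (\<lambda>r. c * exp (- mu_rate N lam * r))))"
proof -
  define \<nu> where "\<nu> = (real N - 2) / 2"
  define m where "m = m_exp p"
  have N: "real N = 2 * \<nu> + 2" by (simp add: \<nu>_def field_simps)
  have \<nu>_pos: "\<nu> > 0" using assms(1) by (simp add: \<nu>_def)
  \<comment> \<open>The critical exponent is \<open>1 + 2 / \<nu>\<close>, so supercriticality
    becomes \<open>m < \<nu>\<close>.\<close>
  have p': "p - 1 > 2 / \<nu>" using assms(2) \<nu>_pos unfolding N by (simp add: field_simps)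
  then have p: "p > 1" using \<nu>_pos by (smt (verit) divide_pos_pos)
  have m: "m * (p - 1) = 2" "0 < m" using p by (auto simp: m_def m_exp_def field_simps)
  have "m < \<nu>" using p' p \<nu>_pos by (simp add: m_def m_exp_def field_simps)
  have lam: "lam \<le> \<nu> * (\<nu> + 1)" using assms(3) unfolding N by (simp add: field_simps)
  interpret H: hyperbolic_lane_emden \<nu> m p lam
    using p m \<open>m < \<nu>\<close> lam by unfold_locales
  have L: "L_const N p = H.L"
    unfolding L_const_def H.L_def H.A_def N m_def[symmetric] by simp
  have c2: "(L_const N p powr p - (lam - m_exp p) * L_const N p) / (4 * real N - 4 - 6 * m_exp p) = H.c2"
  proof -
    have "H.L powr p - (lam - m) * H.L = H.B * H.L"
      using H.powr_p[of H.L] H.L_pos H.L_powr by (simp add: H.A_def H.B_def algebra_simps)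
    then show ?thesis unfolding L H.c2_def m_def[symmetric] by (simp add: N algebra_simps)
  qed
  \<comment> \<open>Since \<open>(N - 1) / 2 = \<nu> + 1 / 2\<close>, this identifies the stated
    rate with the slow root \<open>\<mu>\<close> of \<open>hyperbolic_decay\<close>.\<close>
  have mu: "mu_rate N lam = \<nu> + 1 / 2 - sqrt (\<nu> * (\<nu> + 1) - lam + 1 / 4)"
  proof -
    have "(real N - 1)^2 / 4 - lam = \<nu> * (\<nu> + 1) - lam + 1 / 4"
      unfolding N by (simp add: power2_eq_square algebra_simps add_divide_distrib)
    moreover have "(real N - 1) / 2 = \<nu> + 1 / 2" unfolding N by (simp add: add_divide_distrib)
    ultimately show ?thesis by (simp only: mu_rate_def)
  qed
  show ?thesis
  proof (rule H.singular_profile_exists)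
    fix W X C T
    assume C: "C > 0" and T: "T < 0" and sol: "H.sol {..<0} W X"
      and en: "\<And>t. t < 0 \<Longrightarrow> H.energy t (W t) (X t) < 0"
      and app: "\<And>t. t \<le> T \<Longrightarrow> \<bar>W t - H.wapp t\<bar> \<le> C * (sh t)^4"
    have "(W \<longlongrightarrow> H.L) at_bot"
    proof -
      have "((\<lambda>t. W t - H.wapp t) \<longlongrightarrow> 0) at_bot"
      proof (rule Lim_null_comparison)
        show "\<forall>\<^sub>F t in at_bot. norm (W t - H.wapp t) \<le> C * (sh t)^4"
          using app by (auto simp: eventually_at_bot_linorder)
      qed (rule H.sh_power_tendsto_0, simp)
      from tendsto_add[OF this H.wapp_tendsto] show ?thesis by simp
    qed
    from filterlim_tendsto_pos_mult_at_top[OF this H.L_pos sh_powr_neg_at_top[OF m(2)]]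
    have sing: "filterlim (\<lambda>t. sh t powr (- m) * W t) at_top at_bot" by (simp add: mult.commute)
    interpret P: singular_profile \<nu> m p lam W X
      using sol sing by unfold_locales
    define u where "u r = P.v (tr r)" for r
    define u1 where "u1 r = P.v' (tr r) / sinh r" for r
    have u_eq: "u r = sinh r powr (- m) * W (tr r)" if "r > 0" for r
      using sh_tr[OF that] by (simp add: u_def P.v_def)
    have u_pos: "u r > 0" if "r > 0" for r
      using P.v_pos[OF tr_neg[OF that]] by (simp add: u_def)
    have du: "(u has_real_derivative u1 r) (at r)"
      and du1: "(u1 has_real_derivative (- (2 * \<nu> + 1) * (cosh r / sinh r) * u1 r - lam * u r - u r powr p)) (at r)"
      if "r > 0" for r
      using P.radial_derivs[OF that] by (simp_all add: u_def[abs_def] u1_def[abs_def])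
    have u_sol: "pos_radial_singular_solution N p lam u"
    proof (rule pos_radial_singular_solutionI[OF u_pos du])
      show "(u1 has_real_derivative - (real N - 1) * (cosh r / sinh r) * u1 r - lam * u r - u r powr p) (at r)"
        if "r > 0" for r
      proof -
        have "real N - 1 = 2 * \<nu> + 1" by (simp add: N)
        then show ?thesis using du1[OF that] by (simp only:)
      qed
      have "filterlim P.v at_top at_bot" using sing by (simp add: P.v_def[abs_def])
      from filterlim_compose[OF this tr_tendsto] show "filterlim u at_top (at_right 0)"
        by (simp add: u_def[abs_def])
    qed
    have unique: "v r = u r" if v: "pos_radial_singular_solution N p lam v" and r: "r > 0" for v r
    proof (rule H.singular_profile_of_solution[OF v N])
      fix W2 X2 assume P2: "singular_profile \<nu> m p lam W2 X2"
        and v_eq: "\<And>r. r > 0 \<Longrightarrow> v r = sinh r powr (- m) * W2 (tr r)"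
      interpret P2: singular_profile \<nu> m p lam W2 X2 by (rule P2)
      have "W2 (tr r) = W (tr r)"
        by (rule H.profile_unique[OF P2.sol P2.profile_tendsto P.sol P.profile_tendsto tr_neg[OF r]])
      then show ?thesis using u_eq[OF r] v_eq[OF r] by simp
    qed
    have expansion: "(\<lambda>r. u r - (H.L * sinh r powr (- m) + H.c2 * sinh r powr (2 - m)))
      \<in> O[at_right 0](\<lambda>r. sinh r powr (4 - m))"
    proof (rule bigoI[where c = C])
      have "\<forall>\<^sub>F r in at_right 0. tr r \<le> T" using tr_tendsto unfolding filterlim_at_bot by blast
      moreover have "\<forall>\<^sub>F r in at_right 0. r > (0::real)" by (simp add: eventually_at_right_less)
      ultimately show "\<forall>\<^sub>F r in at_right 0. norm (u r - (H.L * sinh r powr (- m) + H.c2 * sinh r powr (2 - m)))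
          \<le> C * norm (sinh r powr (4 - m))"
      proof eventually_elim
        case (elim r)
        have s: "sinh r > 0" using elim by simp
        have e: "sinh r powr (2 - m) = sinh r powr (- m) * (sinh r)^2"
          "sinh r powr (4 - m) = sinh r powr (- m) * (sinh r)^4"
          using s powr_add[of "sinh r" "- m" 2] powr_add[of "sinh r" "- m" 4] by (simp_all add: add.commute)
        have "u r - (H.L * sinh r powr (- m) + H.c2 * sinh r powr (2 - m))
            = sinh r powr (- m) * (W (tr r) - H.wapp (tr r))"
          unfolding e u_eq[OF elim(2)] H.wapp_def sh_tr[OF elim(2)] by (simp add: algebra_simps)
        also have "norm \<dots> = sinh r powr (- m) * \<bar>W (tr r) - H.wapp (tr r)\<bar>" by (simp add: abs_mult)
        also have "\<dots> \<le> sinh r powr (- m) * (C * (sinh r)^4)"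
          using app[OF elim(1)] sh_tr[OF elim(2)] by (intro mult_left_mono) auto
        also have "\<dots> = C * norm (sinh r powr (4 - m))" using s by (simp add: e)
        finally show ?case .
      qed
    qed
    interpret D: hyperbolic_decay \<nu> p lam u u1
    proof (unfold_locales, rule \<nu>_pos, rule p, rule lam, rule u_pos, assumption, rule du, assumption)
      fix r :: real assume r: "r > 0"
      show "(u1 has_real_derivative - (2 * \<nu> + 1) * ct r * u1 r - lam * u r - u r powr p) (at r)"
        using du1[OF r] by (simp add: ct_def)
      define t where "t = tr r"
      have t: "t < 0" using tr_neg[OF r] by (simp add: t_def)
      have s: "sinh r > 0" "sh t = sinh r" "ch t = cosh r" using r sh_tr[OF r] ch_tr[OF r] by (auto simp: t_def)
      have Wt: "W t > 0" by (rule P.W_pos[OF t])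
      \<comment> \<open>The derivative in \<open>r\<close> is that in \<open>t\<close> divided by
        \<open>sinh r\<close>; the factor \<open>sh powr (- m)\<close> shifts the logarithmic
        derivative by \<open>- m * ch\<close>, which turns \<open>\<nu>\<close> into
        \<open>\<nu> - m\<close>.\<close>
      have f1: "u1 r / u r + \<nu> * ct r = (X t / W t + (\<nu> - m) * ch t) / sinh r"
      proof -
        have "u1 r / u r = (X t - m * ch t * W t) / W t / sinh r"
          using s Wt by (simp add: u_def u1_def P.v_def P.v'_def flip: t_def)
        also have "\<dots> = (X t / W t - m * ch t) / sinh r" using Wt by (simp add: diff_divide_distrib)
        finally show ?thesis using s by (simp add: ct_def left_diff_distrib add_divide_distrib diff_divide_distrib)
      qed
      have f2: "u r powr (p - 1) = W t powr (p - 1) / (sinh r)^2"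
        using P.q_eq[OF t] s by (simp add: P.q_def u_def flip: t_def)
      have "(u1 r / u r + \<nu> * ct r)^2 + 2 / (p + 1) * u r powr (p - 1)
        = ((X t / W t + (\<nu> - m) * ch t)^2 + 2 / (p + 1) * W t powr (p - 1)) / (sinh r)^2"
        unfolding f1 f2 power_divide by (simp only: add_divide_distrib times_divide_eq_right)
      also have "\<dots> < (\<nu>^2 + H.Lam * (sh t)^2) / (sinh r)^2"
        using H.energy_inequality[OF t Wt en[OF t]] s by (intro divide_strict_right_mono) auto
      also have "\<dots> = \<nu>^2 / (sinh r)^2 + (\<nu> * (\<nu> + 1) - lam)"
        using s by (simp add: add_divide_distrib H.Lam_def)
      finally show "(u1 r / u r + \<nu> * ct r)^2 + 2 / (p + 1) * u r powr (p - 1)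
        < \<nu>^2 / (sinh r)^2 + (\<nu> * (\<nu> + 1) - lam)" .
    qed
    have N1: "2 * \<nu> + 1 = real N - 1" by (simp add: N)
    have zero: "u \<sim>[at_top] (\<lambda>r. ((real N - 1) / (p - 1)) powr (1 / (p - 1)) * r powr (- 1 / (p - 1)))"
      if "lam = 0"
      using D.asymptotics_zero[OF that] unfolding N1 .
    have "D.\<mu> = mu_rate N lam" by (simp add: D.\<mu>_def D.\<kappa>_def D.\<Lambda>_def mu)
    then have pos: "\<exists>c>0. u \<sim>[at_top] (\<lambda>r. c * exp (- mu_rate N lam * r))" if "lam > 0"
      using D.asymptotics_pos[OF that] by simp
    show ?thesis
      unfolding c2 unfolding L m_def[symmetric]
      using u_sol unique expansion D.limit_neg zero pos by blast
  qed
qed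

end
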